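(* The variety $\mathcal{NJS}^{(2,3)}$ of nilpotent Jordan superalgebras of type $(2,3)$ over $\mathbb{C}$ has five irreducible components. Two of them are given by $$\mathcal{C}_1=\overline{\bigcup_{\lambda\in\mathbb{C}\setminus\{0\}}O((2,3)_{31}^{\lambda})},\qquad \mathcal{C}_2=\overline{\bigcup_{\phi\in\mathbb{C}}O((2,3)_{44}^{\phi})},$$ and the others are given by $$\mathcal{C}_3=\overline{O((2,3)_{15})},\quad \mathcal{C}_4=\overline{O((2,3)_{33})},\quad \mathcal{C}_5=\overline{O((2,3)_{41})},$$ where, on a homogeneous basis $\{e_1,e_2\}\cup\{f_1,f_2,f_3\}$ ($e_i$ even, $f_j$ odd), \begin{itemize} \item $(2,3)_{15}$: $e_1f_2=f_1,\ e_2f_3=f_2$; \item $(2,3)_{31}^{\lambda}$, $\lambda\in\mathbb{C}\setminus\{0\}$: $e_1^2=e_2,\ e_1f_2=f_1,\ f_1f_3=\lambda e_2,\ f_2f_3=e_1$; \item $(2,3)_{33}$: $e_1^2=e_2,\ e_1f_2=f_1,\ e_1f_3=f_2,\ f_1f_3=e_2$; \item $(2,3)_{41}$: $e_1^2=e_2,\ e_1f_3=e_2f_2=f_1,\ f_2f_3=e_1$; \item $(2,3)_{44}^{\phi}$, $\phi\in\mathbb{C}$: $e_1^2=e_2,\ e_1f_2=f_3,\ e_1f_3=\phi f_1,\ e_2f_2=f_1,\ f_2f_3=e_2$. \end{itemize} In particular, up to isomorphism, the rigid superalgebras in $\mathcal{NJS}^{(2,3)}$ are exactly $(2,3)_i$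 with $i\in\{15,33,41\}$.
   Context: All vector spaces are over $\mathbb{C}$. A superalgebra $J=J_0\oplus J_1$ is a $\mathbb{Z}_2$-graded (not necessarily associative) algebra: $J_iJ_j\subseteq J_{i+j \bmod 2}$; $|x|=i$ denotes the parity of a nonzero $x\in J_i$. A Jordan superalgebra is a superalgebra satisfying, for all nonzero homogeneous $x,y,z,w$, supercommutativity $xy=(-1)^{|x||y|}yx$ and the Jordan superidentity $$(wx)(yz)+(-1)^{|x||y|}(wy)(xz)+(-1)^{(|x|+|y|)|z|}(wz)(xy)-(-1)^{|w||x|}x(w(yz))-(-1)^{|y|(|w|+|x|)}y(w(xz))-(-1)^{|z|(|w|+|x|+|y|)}z(w(xy))=0.$$ $J$ is of type $(m,n)$ if $\dim J_0=m$ and $\dim J_1=n$. Put $J^1=J$ and $J^{k+1}=J^kJ+J^{k-1}J^2+\cdots+JJ^k$ for $k\ge 1$; $J$ is nilpotent if $J^k=0$ for some $k\geq 1$. Fix a $\mathbb{Z}_2$-graded vector space $V=V_0\oplus V_1$ with homogeneous basis $\{e_1,\dots,e_m\}\cup\{f_1,\dots,f_n\}$. A Jordan superalgebra structure on $V$ is encoded by its structure constants $(c_{ij}^k,\rho_{ij}^k,\Gamma_{ij}^k)\in\mathbb{C}^{m^3+2mn^2}$, where $e_ie_j=\sum_{k=1}^m c_{ij}^ke_k$, $e_if_j=\sum_{k=1}^n\rho_{ij}^kf_k$, $f_if_j=\sum_{k=1}^m\Gamma_{ij}^ke_k$. $\mathcal{NJS}^{(m,n)}\subseteq\mathbb{C}^{m^3+2mn^2}$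 is the affine variety (Zariski closed set) of all structure constants of nilpotent Jordan superalgebras of type $(m,n)$. The group $G=\mathrm{GL}_m(\mathbb{C})\times\mathrm{GL}_n(\mathbb{C})$ acts on it by change of basis; its orbits are the isomorphism classes (isomorphisms are grading-preserving). $O(J)$ denotes the $G$-orbit of $J$ and the bar denotes Zariski closure. $J\in\mathcal{NJS}^{(m,n)}$ is rigid if $O(J)$ is Zariski open in $\mathcal{NJS}^{(m,n)}$. In multiplication tables, products of basis elements that are neither listed nor obtained from listed ones by supercommutativity ($e_if_j=f_je_i$, $f_if_j=-f_jf_i$, $e_ie_j=e_je_i$) are zero. *)

theory Defs
  imports "HOL-Analysis.Analysis"
begin

section \<open>Superalgebras\<close>

text \<open>The parities are the naturals 0 and 1, and \<open>grade p\<close> is the homogeneous part of parity \<open>p\<close>.\<close>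

locale superalgebra = vector_space scale
  for scale :: "complex \<Rightarrow> 'a::ab_group_add \<Rightarrow> 'a" +
  fixes grade :: "nat \<Rightarrow> 'a set"
    and mult :: "'a \<Rightarrow> 'a \<Rightarrow> 'a"
  assumes mult_add_left: "mult (x + y) z = mult x z + mult y z"
    and mult_add_right: "mult x (y + z) = mult x y + mult x z"
    and mult_scale_left: "mult (scale a x) y = scale a (mult x y)"
    and mult_scale_right: "mult x (scale a y) = scale a (mult x y)"
    and subspace_grade: "p \<in> {0, 1} \<Longrightarrow> subspace (grade p)"
    and grade_sum: "\<exists>u \<in> grade 0. \<exists>v \<in> grade 1. x = u + v"
    and grade_disjoint: "grade 0 \<inter> grade 1 = {0}"
    and mult_grade: "\<lbrakk>p \<in> {0, 1}; q \<in> {0, 1}; x \<in> grade p; y \<in> grade q\<rbrakk>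
                       \<Longrightarrow> mult x y \<in> grade ((p + q) mod 2)"
begin

text \<open>\<open>alg_power k\<close> is the power $J^k$ for $k \ge 1$, the sum of subspaces being the span of
  their union.  The value at 0 is a dummy.\<close>

fun alg_power :: "nat \<Rightarrow> 'a set" where
  "alg_power 0 = UNIV"
| "alg_power (Suc 0) = UNIV"
| "alg_power (Suc (Suc k)) =
     span (\<Union>i \<in> {0..k}. {mult x y | x y. x \<in> alg_power (Suc k - i) \<and> y \<in> alg_power (Suc i)})"

definition nilpotent_alg :: bool where
  "nilpotent_alg \<longleftrightarrow> (\<exists>k \<ge> 1. alg_power k = {0})"

end

text \<open>The axioms are trivially true when an argument is zero, so zero, which belongs to both
  homogeneous parts, need not be excluded.\<close>

locale jordan_superalgebra = superalgebra +
  assumes supercommutative: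
    "\<lbrakk>p \<in> {0, 1}; q \<in> {0, 1}; x \<in> grade p; y \<in> grade q\<rbrakk>
       \<Longrightarrow> mult x y = scale ((- 1) ^ (p * q)) (mult y x)"
    and jordan_superidentity:
    "\<lbrakk>pw \<in> {0, 1}; px \<in> {0, 1}; py \<in> {0, 1}; pz \<in> {0, 1};
      w \<in> grade pw; x \<in> grade px; y \<in> grade py; z \<in> grade pz\<rbrakk>
       \<Longrightarrow> mult (mult w x) (mult y z)
         + scale ((- 1) ^ (px * py)) (mult (mult w y) (mult x z))
         + scale ((- 1) ^ ((px + py) * pz)) (mult (mult w z) (mult x y))
         - scale ((- 1) ^ (pw * px)) (mult x (mult w (mult y z)))
         - scale ((- 1) ^ (py * (pw + px))) (mult y (mult w (mult x z)))
         - scale ((- 1) ^ (pz * (pw + px + py))) (mult z (mult w (mult x y))) = 0"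


section \<open>Structure constants\<close>

text \<open>\<open>V\<close> is \<open>complex ^ ('m + 'n)\<close>, with \<open>e\<^sub>i\<close> the coordinate vector at \<open>Inl i\<close> and \<open>f\<^sub>j\<close> the one
  at \<open>Inr j\<close>.\<close>

definition even_basis :: "'m::finite \<Rightarrow> complex ^ ('m + 'n::finite)" where
  "even_basis i = axis (Inl i) 1"

definition odd_basis :: "'n::finite \<Rightarrow> complex ^ ('m::finite + 'n)" where
  "odd_basis j = axis (Inr j) 1"

definition std_grade :: "nat \<Rightarrow> (complex ^ ('m::finite + 'n::finite)) set" where
  "std_grade p = (if p = 0 then {v. \<forall>j. v $ Inr j = 0} else {v. \<forall>i. v $ Inl i = 0})"

type_synonym ('m, 'n) struct_consts =
  "complex ^ (('m \<times> 'm \<times> 'm) + ('m \<times> 'n \<times> 'n) + ('n \<times> 'n \<times> 'm))"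

abbreviation sc_c :: "('m::finite, 'n::finite) struct_consts \<Rightarrow> 'm \<Rightarrow> 'm \<Rightarrow> 'm \<Rightarrow> complex" where
  "sc_c s i j k \<equiv> s $ Inl (i, j, k)"

abbreviation sc_rho :: "('m::finite, 'n::finite) struct_consts \<Rightarrow> 'm \<Rightarrow> 'n \<Rightarrow> 'n \<Rightarrow> complex" where
  "sc_rho s i j k \<equiv> s $ Inr (Inl (i, j, k))"

abbreviation sc_Gamma :: "('m::finite, 'n::finite) struct_consts \<Rightarrow> 'n \<Rightarrow> 'n \<Rightarrow> 'm \<Rightarrow> complex" where
  "sc_Gamma s i j k \<equiv> s $ Inr (Inr (i, j, k))"

definition make_sc ::
  "('m \<Rightarrow> 'm \<Rightarrow> 'm \<Rightarrow> complex) \<Rightarrow> ('m \<Rightarrow> 'n \<Rightarrow> 'n \<Rightarrow> complex) \<Rightarrow> ('n \<Rightarrow> 'n \<Rightarrow> 'm \<Rightarrow> complex)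
     \<Rightarrow> ('m::finite, 'n::finite) struct_consts" where
  "make_sc c r g = (\<chi> t. case t of
       Inl (i, j, k) \<Rightarrow> c i j k
     | Inr (Inl (i, j, k)) \<Rightarrow> r i j k
     | Inr (Inr (i, j, k)) \<Rightarrow> g i j k)"

text \<open>The multiplication encoded by structure constants; the constants do not list the products
  \<open>f\<^sub>j e\<^sub>i\<close>, which are put equal to \<open>e\<^sub>i f\<^sub>j\<close> as supercommutativity requires.\<close>

definition sc_mult :: "('m::finite, 'n::finite) struct_consts
    \<Rightarrow> complex ^ ('m + 'n) \<Rightarrow> complex ^ ('m + 'n) \<Rightarrow> complex ^ ('m + 'n)" where
  "sc_mult s x y = (\<chi> t. case t of
       Inl k \<Rightarrow> (\<Sum>i\<in>UNIV. \<Sum>j\<in>UNIV. sc_c s i j k * x $ Inl i * y $ Inl j)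
             + (\<Sum>i\<in>UNIV. \<Sum>j\<in>UNIV. sc_Gamma s i j k * x $ Inr i * y $ Inr j)
     | Inr k \<Rightarrow> (\<Sum>i\<in>UNIV. \<Sum>j\<in>UNIV. sc_rho s i j k *
                  (x $ Inl i * y $ Inr j + y $ Inl i * x $ Inr j)))"

lemma axis_sum_delta:
  fixes F :: "'k::finite \<Rightarrow> 'l::finite \<Rightarrow> complex"
  shows "(\<Sum>i\<in>UNIV. \<Sum>j\<in>UNIV. F i j * ((if i = a then 1 else 0) * (if j = b then 1 else 0))) = F a b"
proof -
  have "(\<Sum>j\<in>UNIV. F i j * ((if i = a then 1 else 0) * (if j = b then 1 else 0)))
      = (if i = a then F i b else 0)" for i
  proof -
    have "(\<Sum>j\<in>UNIV. F i j * ((if i = a then 1 else 0) * (if j = b then 1 else 0)))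
        = (\<Sum>j\<in>UNIV. if j = b then (if i = a then F i j else 0) else 0)"
      by (rule sum.cong) auto
    then show ?thesis by simp
  qed
  then show ?thesis by simp
qed

lemma sum_axis_nth:
  fixes g :: "'k::finite \<Rightarrow> complex" and h :: "'k \<Rightarrow> 'l::finite"
  shows "(\<Sum>k\<in>UNIV. g k *s axis (h k) (1::complex)) $ t = (\<Sum>k\<in>UNIV. if h k = t then g k else 0)"
  unfolding sum_component
  by (rule sum.cong) (auto simp: axis_def)

lemma sc_mult_even_even:
  "sc_mult s (even_basis i) (even_basis j) = (\<Sum>k\<in>UNIV. sc_c s i j k *s even_basis k)"
  unfolding vec_eq_iff even_basis_def sum_axis_nth sc_mult_def
  by (simp add: axis_def axis_sum_delta mult.assoc split: sum.split)

lemma sc_mult_even_odd: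
  "sc_mult s (even_basis i) (odd_basis j) = (\<Sum>k\<in>UNIV. sc_rho s i j k *s odd_basis k)"
  unfolding vec_eq_iff even_basis_def odd_basis_def sum_axis_nth sc_mult_def
  by (simp add: axis_def axis_sum_delta mult.assoc split: sum.split)

lemma sc_mult_odd_even:
  "sc_mult s (odd_basis j) (even_basis i) = sc_mult s (even_basis i) (odd_basis j)"
  unfolding vec_eq_iff even_basis_def odd_basis_def sc_mult_def
  by (simp add: axis_def split: sum.split)

lemma sc_mult_odd_odd:
  "sc_mult s (odd_basis i) (odd_basis j) = (\<Sum>k\<in>UNIV. sc_Gamma s i j k *s even_basis k)"
  unfolding vec_eq_iff even_basis_def odd_basis_def sum_axis_nth sc_mult_def
  by (simp add: axis_def axis_sum_delta mult.assoc split: sum.split)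

definition NJS :: "('m::finite, 'n::finite) struct_consts set" where
  "NJS = {s. jordan_superalgebra (*s) std_grade (sc_mult s) \<and>
             superalgebra.nilpotent_alg (*s) (sc_mult s)}"

definition isomorphic_sc ::
  "('m::finite, 'n::finite) struct_consts \<Rightarrow> ('m, 'n) struct_consts \<Rightarrow> bool" where
  "isomorphic_sc s t \<longleftrightarrow> (\<exists>\<phi>. Vector_Spaces.linear (*s) (*s) \<phi> \<and> bij \<phi> \<and>
      (\<forall>p \<in> {0, 1}. \<phi> ` std_grade p \<subseteq> std_grade p) \<and>
      (\<forall>x y. \<phi> (sc_mult s x y) = sc_mult t (\<phi> x) (\<phi> y)))"

text \<open>The action by change of basis: the multiplication \<open>\<mu>\<close> goes to
  \<open>(x, y) \<mapsto> (g, h) \<mu> ((g, h)\<inverse> x, (g, h)\<inverse> y)\<close>, written in structure constants.\<close>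

definition gl_act :: "complex ^ 'm ^ 'm \<Rightarrow> complex ^ 'n ^ 'n
    \<Rightarrow> ('m::finite, 'n::finite) struct_consts \<Rightarrow> ('m, 'n) struct_consts" where
  "gl_act g h s = (let g' = matrix_inv g; h' = matrix_inv h in make_sc
     (\<lambda>i j k. \<Sum>p\<in>UNIV. \<Sum>q\<in>UNIV. \<Sum>r\<in>UNIV. g' $ p $ i * g' $ q $ j * sc_c s p q r * g $ k $ r)
     (\<lambda>i j k. \<Sum>p\<in>UNIV. \<Sum>q\<in>UNIV. \<Sum>r\<in>UNIV. g' $ p $ i * h' $ q $ j * sc_rho s p q r * h $ k $ r)
     (\<lambda>i j k. \<Sum>p\<in>UNIV. \<Sum>q\<in>UNIV. \<Sum>r\<in>UNIV. h' $ p $ i * h' $ q $ j * sc_Gamma s p q r * g $ k $ r))"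

definition orbit :: "('m::finite, 'n::finite) struct_consts \<Rightarrow> ('m, 'n) struct_consts set" where
  "orbit s = {gl_act g h s | g h. invertible g \<and> invertible h}"


section \<open>The Zariski topology on affine space\<close>

inductive_set poly_functions :: "(complex ^ 'i::finite \<Rightarrow> complex) set" where
  const: "(\<lambda>x. a) \<in> poly_functions"
| coord: "(\<lambda>x. x $ i) \<in> poly_functions"
| add: "\<lbrakk>p \<in> poly_functions; q \<in> poly_functions\<rbrakk> \<Longrightarrow> (\<lambda>x. p x + q x) \<in> poly_functions"
| mult: "\<lbrakk>p \<in> poly_functions; q \<in> poly_functions\<rbrakk> \<Longrightarrow> (\<lambda>x. p x * q x) \<in> poly_functions"

definition zariski_closed :: "(complex ^ 'i::finite) set \<Rightarrow> bool" where
  "zariski_closed S \<longleftrightarrow> (\<exists>P \<subseteq> poly_functions. S = {x. \<forall>p \<in> P. p x = 0})"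

definition zariski :: "(complex ^ 'i::finite) topology" where
  "zariski = topology (\<lambda>U. zariski_closed (- U))"

lemma zariski_closed_Un:
  assumes "zariski_closed S" "zariski_closed T"
  shows "zariski_closed (S \<union> T)"
proof -
  obtain P where P: "P \<subseteq> poly_functions" "S = {x. \<forall>p \<in> P. p x = 0}"
    using assms(1) unfolding zariski_closed_def by (elim exE conjE)
  obtain Q where Q: "Q \<subseteq> poly_functions" "T = {x. \<forall>q \<in> Q. q x = 0}"
    using assms(2) unfolding zariski_closed_def by (elim exE conjE)
  define R where "R = (\<lambda>(p, q) x. p x * q x) ` (P \<times> Q)"
  have "R \<subseteq> poly_functions"
  proof
    fix r assume "r \<in> R"
    then obtain p q where "r = (\<lambda>x. p x * q x)" "p \<in> P" "q \<in> Q"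
      unfolding R_def by auto
    then show "r \<in> poly_functions"
      using P(1) Q(1) by (simp add: poly_functions.mult subsetD)
  qed
  moreover have "x \<in> S \<union> T \<longleftrightarrow> (\<forall>r \<in> R. r x = 0)" for x
  proof
    assume "x \<in> S \<union> T"
    then show "\<forall>r \<in> R. r x = 0" unfolding P(2) Q(2) R_def by auto
  next
    assume R: "\<forall>r \<in> R. r x = 0"
    have "p x * q x = 0" if "p \<in> P" "q \<in> Q" for p q
    proof -
      have "(\<lambda>x. p x * q x) \<in> R" unfolding R_def
        using that by (intro image_eqI[of _ _ "(p, q)"]) simp_all
      then show ?thesis using bspec[OF R] by fastforce
    qed
    then show "x \<in> S \<union> T" unfolding P(2) Q(2) by auto
  qed
  then have "S \<union> T = {x. \<forall>r \<in> R. r x = 0}" by (intro set_eqI) simp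
  ultimately show ?thesis
    unfolding zariski_closed_def by (intro exI[of _ R] conjI)
qed

lemma zariski_closed_INT:
  assumes "\<And>S. S \<in> \<S> \<Longrightarrow> zariski_closed S"
  shows "zariski_closed (\<Inter>\<S>)"
proof -
  define R where "R = {p \<in> poly_functions. \<exists>S \<in> \<S>. \<forall>x \<in> S. p x = 0}"
  have "x \<in> \<Inter>\<S>" if x: "\<forall>r \<in> R. r x = 0" for x
  proof
    fix S assume S: "S \<in> \<S>"
    obtain P where P: "P \<subseteq> poly_functions" "S = {x. \<forall>p \<in> P. p x = 0}"
      using assms[OF S] unfolding zariski_closed_def by (elim exE conjE)
    have "p x = 0" if p: "p \<in> P" for p
    proof -
      have "\<forall>y \<in> S. p y = 0" using p P(2) by simp
      then have "p \<in> R" unfolding R_def using p P(1) S by (simp add: subsetD) (rule bexI)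
      then show ?thesis using x by simp
    qed
    then show "x \<in> S" using P(2) by simp
  qed
  moreover have "\<forall>r \<in> R. r x = 0" if "x \<in> \<Inter>\<S>" for x
    using that unfolding R_def by auto
  ultimately have "\<Inter>\<S> = {x. \<forall>r \<in> R. r x = 0}" by (intro set_eqI) (simp, metis)
  moreover have "R \<subseteq> poly_functions" unfolding R_def by simp
  ultimately show ?thesis
    unfolding zariski_closed_def by (intro exI[of _ R] conjI)
qed

lemma openin_zariski:
  fixes U :: "(complex ^ 'i::finite) set"
  shows "openin zariski U \<longleftrightarrow> zariski_closed (- U)"
proof -
  have "istopology (\<lambda>U. zariski_closed (- U :: (complex ^ 'i) set))"
    unfolding istopology_def
  proof (intro conjI allI impI)
    fix S T :: "(complex ^ 'i) set"
    assume "zariski_closed (- S)" "zariski_closed (- T)"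
    then show "zariski_closed (- (S \<inter> T))"
      by (simp add: zariski_closed_Un Compl_Int)
  next
    fix \<K> :: "(complex ^ 'i) set set"
    assume "\<forall>K\<in>\<K>. zariski_closed (- K)"
    then have "zariski_closed (\<Inter>(uminus ` \<K>))"
      by (intro zariski_closed_INT) auto
    moreover have "- \<Union>\<K> = \<Inter>(uminus ` \<K>)" by auto
    ultimately show "zariski_closed (- \<Union>\<K>)" by simp
  qed
  then show ?thesis unfolding zariski_def by (simp add: topology_inverse')
qed

lemma topspace_zariski [simp]: "topspace zariski = UNIV"
proof -
  have "zariski_closed ({} :: (complex ^ 'i) set)"
    unfolding zariski_closed_def
    by (rule exI[of _ "{\<lambda>x. 1}"]) (simp add: poly_functions.const)
  then have "openin zariski (UNIV :: (complex ^ 'i) set)" by (simp add: openin_zariski)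
  then show ?thesis using openin_subset top.extremum_uniqueI by metis
qed

lemma closedin_zariski: "closedin zariski S \<longleftrightarrow> zariski_closed S"
  by (simp add: closedin_def openin_zariski Compl_eq_Diff_UNIV[symmetric])

definition irreducible_in :: "'a topology \<Rightarrow> 'a set \<Rightarrow> bool" where
  "irreducible_in X S \<longleftrightarrow> S \<subseteq> topspace X \<and> S \<noteq> {} \<and>
     (\<forall>A B. closedin X A \<and> closedin X B \<and> S \<subseteq> A \<union> B \<longrightarrow> S \<subseteq> A \<or> S \<subseteq> B)"

definition irreducible_components :: "'a topology \<Rightarrow> 'a set \<Rightarrow> 'a set set" where
  "irreducible_components X N =
     {C. C \<subseteq> N \<and> irreducible_in X C \<and>
         (\<forall>D. D \<subseteq> N \<and> irreducible_in X D \<and> C \<subseteq> D \<longrightarrow> D = C)}"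

definition rigid :: "('m::finite, 'n::finite) struct_consts \<Rightarrow> bool" where
  "rigid s \<longleftrightarrow> s \<in> NJS \<and> openin (subtopology zariski NJS) (orbit s)"


section \<open>The superalgebras of type (2,3)\<close>

text \<open>In type \<open>2\<close> the numeral 2 denotes 0, and in type \<open>3\<close> the numeral 3 denotes 0, so 1, 2 and
  1, 2, 3 enumerate the respective index types without repetition.\<close>

definition alg15 :: "(2, 3) struct_consts" where
  "alg15 = make_sc
     (\<lambda>i j k. 0)
     (\<lambda>i j k. if (i, j, k) \<in> {(1, 2, 1), (2, 3, 2)} then 1 else 0)
     (\<lambda>i j k. 0)"

definition alg31 :: "complex \<Rightarrow> (2, 3) struct_consts" where
  "alg31 l = make_sc
     (\<lambda>i j k. if (i, j, k) = (1, 1, 2) then 1 else 0)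
     (\<lambda>i j k. if (i, j, k) = (1, 2, 1) then 1 else 0)
     (\<lambda>i j k. if (i, j, k) = (1, 3, 2) then l else if (i, j, k) = (3, 1, 2) then - l
           else if (i, j, k) = (2, 3, 1) then 1 else if (i, j, k) = (3, 2, 1) then - 1 else 0)"

definition alg33 :: "(2, 3) struct_consts" where
  "alg33 = make_sc
     (\<lambda>i j k. if (i, j, k) = (1, 1, 2) then 1 else 0)
     (\<lambda>i j k. if (i, j, k) \<in> {(1, 2, 1), (1, 3, 2)} then 1 else 0)
     (\<lambda>i j k. if (i, j, k) = (1, 3, 2) then 1 else if (i, j, k) = (3, 1, 2) then - 1 else 0)"

definition alg41 :: "(2, 3) struct_consts" where
  "alg41 = make_sc
     (\<lambda>i j k. if (i, j, k) = (1, 1, 2) then 1 else 0)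
     (\<lambda>i j k. if (i, j, k) \<in> {(1, 3, 1), (2, 2, 1)} then 1 else 0)
     (\<lambda>i j k. if (i, j, k) = (2, 3, 1) then 1 else if (i, j, k) = (3, 2, 1) then - 1 else 0)"

definition alg44 :: "complex \<Rightarrow> (2, 3) struct_consts" where
  "alg44 a = make_sc
     (\<lambda>i j k. if (i, j, k) = (1, 1, 2) then 1 else 0)
     (\<lambda>i j k. if (i, j, k) \<in> {(1, 2, 3), (2, 2, 1)} then 1
           else if (i, j, k) = (1, 3, 1) then a else 0)
     (\<lambda>i j k. if (i, j, k) = (2, 3, 2) then 1 else if (i, j, k) = (3, 2, 2) then - 1 else 0)"

end

theory Submission
  imports Defs "HOL-Computational_Algebra.Polynomial"
begin

text \<open>
  A nilpotent superalgebra has a homogeneous basis along a flag of ideals, so its multiplication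
  is strictly triangular.  In type (2,3) this leaves thirteen structure constants, and comparing
  the positions of \<open>e\<^sub>1, e\<^sub>2\<close> in the flag with those of \<open>f\<^sub>1, f\<^sub>2\<close> gives six patterns of constants
  that vanish (\<open>triangular_form\<close>).  The Jordan identity adds a few equations between monomials,
  and simple changes of basis then bring every nilpotent Jordan superalgebra into one of five
  coordinate subspaces, called slices here (\<open>normal_form\<close>).

  A generic point of each slice is isomorphic to a member of the corresponding one of the five
  families (\<open>generic_15\<close>, \<open>generic_44\<close>, \<open>generic_33\<close>, \<open>generic_41\<close>, \<open>generic_31\<close>).  Every point of a
  slice is a limit of generic points of it, and a Zariski closed set is closed in the Euclidean
  topology; hence each slice lies in the closure of its family.  As nilpotency of algebras of a
  given dimension amounts to identities of bounded length, the variety is closed (\<open>NJS_iff\<close>,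
  \<open>zariski_closed_NJS\<close>), and so it is the union of the five closures.

  Each closure is irreducible because its family is swept out by two invertible matrices and at most
  one parameter, and any two points of it are joined by a rational curve (\<open>irreducible_orbits\<close>).
  No closure contains another one: identities such as \<open>x (y f) = y (x f)\<close> for even \<open>x, y\<close> and odd \<open>f\<close>
  define closed sets that are stable under isomorphism, and such identities hold on some of the
  families and fail on others.  The five closures are therefore the irreducible components.

  The orbits of (2,3)_15, (2,3)_33 and (2,3)_41 are open because each of them is the complement
  in the variety of a closed set given by such conditions (\<open>alg15_orbit\<close>, \<open>alg33_orbit\<close>,
  \<open>alg41_orbit\<close>).  Conversely an open orbit meets the dense family of a component that contains it.
  In the two families with a parameter, an identity involving the parameter holds on one orbit but
  not on the others, so no orbit there is dense, let alone open (\<open>line_not_rigid\<close>).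
\<close>

section \<open>Irreducible sets and closures in the Zariski topology\<close>

lemma poly_functions_sum:
  "(\<And>i. i \<in> A \<Longrightarrow> f i \<in> poly_functions) \<Longrightarrow> (\<lambda>x. \<Sum>i\<in>A. f i x) \<in> poly_functions"
proof (induction A rule: infinite_finite_induct)
  case (insert i A)
  then have "(\<lambda>x. f i x + (\<Sum>i\<in>A. f i x)) \<in> poly_functions"
    by (intro poly_functions.add) auto
  with insert show ?case by simp
qed (simp_all add: poly_functions.const)

definition poly_map :: "(complex ^ 'i::finite \<Rightarrow> complex ^ 'j::finite) \<Rightarrow> bool" where
  "poly_map F \<longleftrightarrow> (\<forall>k. (\<lambda>x. F x $ k) \<in> poly_functions)"

lemma poly_map_const: "poly_map (\<lambda>x. v)"
  by (simp add: poly_map_def poly_functions.const)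

lemma poly_map_add: "poly_map F \<Longrightarrow> poly_map G \<Longrightarrow> poly_map (\<lambda>x. F x + G x)"
  by (simp add: poly_map_def poly_functions.add)

lemma poly_map_scale: "poly_map F \<Longrightarrow> poly_map (\<lambda>x. a *s F x)"
  by (simp add: poly_map_def poly_functions.mult poly_functions.const)

lemma poly_functions_compose:
  assumes "p \<in> poly_functions" "poly_map F"
  shows "(\<lambda>x. p (F x)) \<in> poly_functions"
  using assms(1)
proof (induction rule: poly_functions.induct)
  case (coord i)
  show ?case using assms(2) by (simp add: poly_map_def)
qed (simp_all add: poly_functions.intros)

lemma zariski_closed_zero:
  assumes "p \<in> poly_functions"
  shows "zariski_closed {x. p x = 0}"
  unfolding zariski_closed_def using assms by (intro exI[of _ "{p}"]) auto

lemma zariski_closed_all: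
  assumes "\<And>i. i \<in> I \<Longrightarrow> zariski_closed {x. P i x}"
  shows "zariski_closed {x. \<forall>i\<in>I. P i x}"
proof -
  have "{x. \<forall>i\<in>I. P i x} = \<Inter>((\<lambda>i. {x. P i x}) ` I)" by auto
  then show ?thesis using zariski_closed_INT[of "(\<lambda>i. {x. P i x}) ` I"] assms by auto
qed

lemma zariski_closed_vector_zero:
  assumes "poly_map F"
  shows "zariski_closed {x. F x = 0}"
proof -
  have "{x. F x = 0} = {x. \<forall>k\<in>UNIV. F x $ k = 0}" by (auto simp: vec_eq_iff)
  moreover have "zariski_closed {x. \<forall>k\<in>UNIV. F x $ k = 0}"
    using assms by (intro zariski_closed_all zariski_closed_zero) (simp add: poly_map_def)
  ultimately show ?thesis by simp
qed

lemma zariski_closed_vimage: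
  assumes "poly_map F" "zariski_closed S"
  shows "zariski_closed (F -` S)"
proof -
  obtain P where P: "P \<subseteq> poly_functions" "S = {x. \<forall>p \<in> P. p x = 0}"
    using assms(2) unfolding zariski_closed_def by blast
  have "F -` S = {x. \<forall>p\<in>P. p (F x) = 0}" by (auto simp: P)
  moreover have "zariski_closed {x. \<forall>p\<in>P. p (F x) = 0}"
    by (rule zariski_closed_all[OF zariski_closed_zero[OF
          poly_functions_compose[OF subsetD[OF P(1)] assms(1)]]])
  ultimately show ?thesis by simp
qed

lemma isCont_poly_function: "p \<in> poly_functions \<Longrightarrow> isCont p x"
  by (induction rule: poly_functions.induct) (auto intro!: continuous_intros)

lemma zariski_closed_imp_closed:
  assumes "zariski_closed S"
  shows "closed S"
proof -
  obtain P where P: "P \<subseteq> poly_functions" "S = {x. \<forall>p \<in> P. p x = 0}"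
    using assms unfolding zariski_closed_def by blast
  have "S = (\<Inter>p\<in>P. p -` {0})" by (auto simp: P)
  moreover have "closed (p -` {0})" if "p \<in> P" for p
    using P that isCont_poly_function by (intro continuous_closed_vimage) auto
  ultimately show ?thesis by auto
qed

lemma closedin_closure: "zariski_closed (zariski closure_of S)"
  using closedin_closure_of[of zariski S] by (simp only: closedin_zariski)

lemma closure_minimal: "S \<subseteq> T \<Longrightarrow> zariski_closed T \<Longrightarrow> zariski closure_of S \<subseteq> T"
  by (simp add: closure_of_minimal closedin_zariski)

lemma subset_closure: "S \<subseteq> zariski closure_of S"
  by (simp add: closure_of_subset)

text \<open>Polynomials are continuous, so the Euclidean limits of a set belong to its Zariski closure.
  This is how degenerations are established: a curve inside a union of orbits has its limit in
  the closure of that union.\<close>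

lemma limit_in_closure:
  fixes \<gamma> :: "complex \<Rightarrow> complex ^ 'i::finite"
  assumes "(\<gamma> \<longlongrightarrow> s) (at 0)" "\<forall>\<^sub>F t in at 0. \<gamma> t \<in> S"
  shows "s \<in> zariski closure_of S"
proof (rule Lim_in_closed_set[OF _ _ _ assms(1)])
  show "closed (zariski closure_of S)"
    by (rule zariski_closed_imp_closed[OF closedin_closure])
  show "\<forall>\<^sub>F t in at 0. \<gamma> t \<in> zariski closure_of S"
    using assms(2) by eventually_elim (use subset_closure in blast)
qed simp

lemma irreducible_in_closure:
  assumes "irreducible_in zariski S"
  shows "irreducible_in zariski (zariski closure_of S)"
  unfolding irreducible_in_def
proof (intro conjI allI impI)
  show "zariski closure_of S \<noteq> {}"
    using assms subset_closure[of S] unfolding irreducible_in_def by auto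
  fix A B
  assume H: "closedin zariski A \<and> closedin zariski B \<and> zariski closure_of S \<subseteq> A \<union> B"
  then have "S \<subseteq> A \<or> S \<subseteq> B"
    using assms subset_closure[of S] unfolding irreducible_in_def by blast
  then show "zariski closure_of S \<subseteq> A \<or> zariski closure_of S \<subseteq> B"
    using H closure_of_minimal[of S _ zariski] by metis
qed simp

lemma irreducible_in_Union:
  assumes "irreducible_in X D" "finite \<C>" "\<And>C. C \<in> \<C> \<Longrightarrow> closedin X C" "D \<subseteq> \<Union>\<C>"
  shows "\<exists>C\<in>\<C>. D \<subseteq> C"
  using assms(2-4)
proof (induction \<C>)
  case empty
  then show ?case using assms(1) by (auto simp: irreducible_in_def)
next
  case (insert C \<C>)
  have "closedin X (\<Union>\<C>)" using insert by (intro closedin_Union) auto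
  then have "D \<subseteq> C \<or> D \<subseteq> \<Union>\<C>"
    using assms(1) insert.prems unfolding irreducible_in_def by (metis Union_insert insertI1)
  then show ?case using insert by blast
qed

text \<open>An irreducible set inside a finite union of closed sets lies in one of them, so a finite
  antichain of closed irreducible sets covering \<open>N\<close> is the set of irreducible components.\<close>

lemma irreducible_components_eq:
  assumes fin: "finite \<C>" and cl: "\<And>C. C \<in> \<C> \<Longrightarrow> closedin X C"
    and irr: "\<And>C. C \<in> \<C> \<Longrightarrow> irreducible_in X C"
    and N: "\<Union>\<C> = N" and anti: "\<And>C D. C \<in> \<C> \<Longrightarrow> D \<in> \<C> \<Longrightarrow> C \<subseteq> D \<Longrightarrow> C = D"
  shows "irreducible_components X N = \<C>"
proof (intro set_eqI iffI)
  fix C assume C: "C \<in> irreducible_components X N"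
  then have "C \<subseteq> \<Union>\<C>" "irreducible_in X C"
    using N by (auto simp: irreducible_components_def)
  then obtain D where D: "D \<in> \<C>" "C \<subseteq> D"
    using irreducible_in_Union[OF _ fin cl, of C] by auto
  moreover have "D \<subseteq> N" using D(1) N by blast
  ultimately have "D = C" using C D irr[OF D(1)] unfolding irreducible_components_def by simp
  then show "C \<in> \<C>" using D by simp
next
  fix C assume C: "C \<in> \<C>"
  have "D = C" if D: "D \<subseteq> N" "irreducible_in X D" "C \<subseteq> D" for D
  proof -
    obtain E where E: "E \<in> \<C>" "D \<subseteq> E"
      using irreducible_in_Union[OF D(2) fin cl] D(1) N by auto
    then have "C = E" using anti[OF C, of E] D(3) by simp
    then show ?thesis using D(3) E by simp
  qed
  moreover have "C \<subseteq> N" using C N by blast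
  ultimately show "C \<in> irreducible_components X N"
    using irr[OF C] unfolding irreducible_components_def by simp
qed

text \<open>Rational functions of one variable whose poles are among the zeros of \<open>D\<close>.  Values at
  the zeros of \<open>D\<close> are left arbitrary, since matrix inverses have no meaning there.\<close>

definition rational_away :: "complex poly \<Rightarrow> (complex \<Rightarrow> complex) \<Rightarrow> bool" where
  "rational_away D f \<longleftrightarrow> (\<exists>P n. \<forall>t. poly D t \<noteq> 0 \<longrightarrow> f t = poly P t / poly D t ^ n)"

lemma rational_away_poly: "rational_away D (poly P)"
  unfolding rational_away_def by (intro exI[of _ P] exI[of _ 0]) simp

lemma rational_away_const: "rational_away D (\<lambda>t. a)"
  unfolding rational_away_def by (intro exI[of _ "[:a:]"] exI[of _ 0]) simp

lemma rational_away_add: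
  assumes "rational_away D f" "rational_away D g"
  shows "rational_away D (\<lambda>t. f t + g t)"
proof -
  obtain P n where P: "\<And>t. poly D t \<noteq> 0 \<Longrightarrow> f t = poly P t / poly D t ^ n"
    using assms(1) unfolding rational_away_def by blast
  obtain Q m where Q: "\<And>t. poly D t \<noteq> 0 \<Longrightarrow> g t = poly Q t / poly D t ^ m"
    using assms(2) unfolding rational_away_def by blast
  show ?thesis unfolding rational_away_def
    by (intro exI[of _ "P * D ^ m + Q * D ^ n"] exI[of _ "n + m"])
       (simp add: P Q field_simps power_add)
qed

lemma rational_away_mult:
  assumes "rational_away D f" "rational_away D g"
  shows "rational_away D (\<lambda>t. f t * g t)"
proof -
  obtain P n where P: "\<And>t. poly D t \<noteq> 0 \<Longrightarrow> f t = poly P t / poly D t ^ n"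
    using assms(1) unfolding rational_away_def by blast
  obtain Q m where Q: "\<And>t. poly D t \<noteq> 0 \<Longrightarrow> g t = poly Q t / poly D t ^ m"
    using assms(2) unfolding rational_away_def by blast
  show ?thesis unfolding rational_away_def
    by (intro exI[of _ "P * Q"] exI[of _ "n + m"]) (simp add: P Q power_add)
qed

lemma rational_away_sum:
  "(\<And>i. i \<in> A \<Longrightarrow> rational_away D (f i)) \<Longrightarrow> rational_away D (\<lambda>t. \<Sum>i\<in>A. f i t)"
  by (induction A rule: infinite_finite_induct)
     (simp_all add: rational_away_const rational_away_add)

lemma rational_away_prod:
  "(\<And>i. i \<in> A \<Longrightarrow> rational_away D (f i)) \<Longrightarrow> rational_away D (\<lambda>t. \<Prod>i\<in>A. f i t)"
  by (induction A rule: infinite_finite_induct)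
     (simp_all add: rational_away_const rational_away_mult)

lemma rational_away_compose:
  assumes "p \<in> poly_functions" "\<And>k. rational_away D (\<lambda>t. \<gamma> t $ k)"
  shows "rational_away D (\<lambda>t. p (\<gamma> t))"
  using assms(1)
  by (induction rule: poly_functions.induct)
     (simp_all add: assms(2) rational_away_const rational_away_add rational_away_mult)

text \<open>A set any two of whose points lie on a rational curve in the set is irreducible: if
  polynomials \<open>p\<close> and \<open>q\<close> do not vanish at \<open>u\<close> and \<open>v\<close>, then their restrictions to a curve
  through \<open>u\<close> and \<open>v\<close> are nonzero rational functions, and so is their product.\<close>

lemma irreducible_by_rational_curves:
  fixes S :: "(complex ^ 'i::finite) set"
  assumes "S \<noteq> {}"
    and curve: "\<And>u v. u \<in> S \<Longrightarrow> v \<in> S \<Longrightarrow> \<exists>\<gamma> D. poly D 0 \<noteq> 0 \<and> poly D 1 \<noteq> 0 \<and> \<gamma> 0 = u \<and> \<gamma> 1 = v \<and>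
        (\<forall>t. poly D t \<noteq> 0 \<longrightarrow> \<gamma> t \<in> S) \<and> (\<forall>k. rational_away D (\<lambda>t. \<gamma> t $ k))"
  shows "irreducible_in zariski S"
  unfolding irreducible_in_def
proof (intro conjI allI impI)
  fix A B
  assume AB: "closedin zariski A \<and> closedin zariski B \<and> S \<subseteq> A \<union> B"
  obtain P where P: "P \<subseteq> poly_functions" "A = {x. \<forall>p \<in> P. p x = 0}"
    using AB unfolding closedin_zariski zariski_closed_def by blast
  obtain Q where Q: "Q \<subseteq> poly_functions" "B = {x. \<forall>p \<in> Q. p x = 0}"
    using AB unfolding closedin_zariski zariski_closed_def by blast
  show "S \<subseteq> A \<or> S \<subseteq> B"
  proof (rule ccontr)
    assume "\<not> (S \<subseteq> A \<or> S \<subseteq> B)"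
    then obtain u v p q where uv: "u \<in> S" "v \<in> S" "p \<in> P" "q \<in> Q" "p u \<noteq> 0" "q v \<noteq> 0"
      unfolding P(2) Q(2) by blast
    obtain \<gamma> D where D: "poly D 0 \<noteq> 0" "poly D 1 \<noteq> 0" "\<gamma> 0 = u" "\<gamma> 1 = v"
        and \<gamma>: "\<And>t. poly D t \<noteq> 0 \<Longrightarrow> \<gamma> t \<in> S" "\<And>k. rational_away D (\<lambda>t. \<gamma> t $ k)"
      using curve[OF uv(1,2)] by blast
    have "rational_away D (\<lambda>t. p (\<gamma> t))" "rational_away D (\<lambda>t. q (\<gamma> t))"
      by (rule rational_away_compose[OF subsetD[OF P(1) uv(3)] \<gamma>(2)]
          rational_away_compose[OF subsetD[OF Q(1) uv(4)] \<gamma>(2)])+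
    then obtain F n G m where F: "\<And>t. poly D t \<noteq> 0 \<Longrightarrow> p (\<gamma> t) = poly F t / poly D t ^ n"
        and G: "\<And>t. poly D t \<noteq> 0 \<Longrightarrow> q (\<gamma> t) = poly G t / poly D t ^ m"
      unfolding rational_away_def by blast
    have "poly F 0 \<noteq> 0" "poly G 1 \<noteq> 0" using F[OF D(1)] G[OF D(2)] D uv by auto
    then have "D * F * G \<noteq> 0" using D by (metis no_zero_divisors poly_0)
    moreover have "poly (D * F * G) t = 0" for t
    proof (cases "poly D t = 0")
      case False
      then have "\<gamma> t \<in> A \<union> B" using \<gamma>(1) AB by blast
      then have "p (\<gamma> t) = 0 \<or> q (\<gamma> t) = 0" using uv(3,4) unfolding P(2) Q(2) by blast
      then show ?thesis using F[OF False] G[OF False] False by auto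
    qed simp
    ultimately show False using poly_all_0_iff_0 by blast
  qed
qed (use assms in auto)

section \<open>Isomorphism and the action of the general linear groups\<close>

lemma sc_mult_Inl:
  "sc_mult s x y $ Inl k = (\<Sum>i\<in>UNIV. \<Sum>j\<in>UNIV. sc_c s i j k * (x $ Inl i * y $ Inl j))
             + (\<Sum>i\<in>UNIV. \<Sum>j\<in>UNIV. sc_Gamma s i j k * (x $ Inr i * y $ Inr j))"
  by (simp add: sc_mult_def mult.assoc)

lemma sc_mult_Inr:
  "sc_mult s x y $ Inr k = (\<Sum>i\<in>UNIV. \<Sum>j\<in>UNIV. sc_rho s i j k *
                  (x $ Inl i * y $ Inr j + y $ Inl i * x $ Inr j))"
  by (simp add: sc_mult_def)

lemma vec_sum_eqI:
  fixes x y :: "'c ^ ('m::finite + 'n::finite)"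
  assumes "\<And>i. x $ Inl i = y $ Inl i" "\<And>j. x $ Inr j = y $ Inr j"
  shows "x = y"
  unfolding vec_eq_iff
proof
  fix k show "x $ k = y $ k" using assms by (cases k) auto
qed

lemma sc_mult_add_left: "sc_mult s (x + y) z = sc_mult s x z + sc_mult s y z"
  by (rule vec_sum_eqI; simp add: sc_mult_Inl sc_mult_Inr algebra_simps sum.distrib)

lemma sc_mult_add_right: "sc_mult s x (y + z) = sc_mult s x y + sc_mult s x z"
  by (rule vec_sum_eqI; simp add: sc_mult_Inl sc_mult_Inr algebra_simps sum.distrib)

lemma sc_mult_scale_left: "sc_mult s (a *s x) y = a *s sc_mult s x y"
  by (rule vec_sum_eqI; simp add: sc_mult_Inl sc_mult_Inr algebra_simps sum_distrib_left)

lemma sc_mult_scale_right: "sc_mult s x (a *s y) = a *s sc_mult s x y"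
  by (rule vec_sum_eqI; simp add: sc_mult_Inl sc_mult_Inr algebra_simps sum_distrib_left)

lemma sc_mult_zero [simp]: "sc_mult s 0 y = 0" "sc_mult s x 0 = 0"
  by (rule vec_sum_eqI; simp add: sc_mult_Inl sc_mult_Inr)+

lemma sc_mult_sum_right: "sc_mult s x (\<Sum>i\<in>A. f i) = (\<Sum>i\<in>A. sc_mult s x (f i))"
  by (induction A rule: infinite_finite_induct) (simp_all add: sc_mult_add_right)

lemma sc_mult_sum_left: "sc_mult s (\<Sum>i\<in>A. f i) y = (\<Sum>i\<in>A. sc_mult s (f i) y)"
  by (induction A rule: infinite_finite_induct) (simp_all add: sc_mult_add_left)

lemma std_grade_0: "x \<in> std_grade 0 \<longleftrightarrow> (\<forall>j. x $ Inr j = 0)"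
  and std_grade_Suc_0: "x \<in> std_grade (Suc 0) \<longleftrightarrow> (\<forall>i. x $ Inl i = 0)"
  by (simp_all add: std_grade_def)

definition even_part :: "complex ^ ('m::finite + 'n::finite) \<Rightarrow> complex ^ ('m + 'n)" where
  "even_part x = (\<chi> k. case k of Inl i \<Rightarrow> x $ Inl i | Inr j \<Rightarrow> 0)"

definition odd_part :: "complex ^ ('m::finite + 'n::finite) \<Rightarrow> complex ^ ('m + 'n)" where
  "odd_part x = (\<chi> k. case k of Inl i \<Rightarrow> 0 | Inr j \<Rightarrow> x $ Inr j)"

lemma even_part_nth [simp]: "even_part x $ Inl i = x $ Inl i" "even_part x $ Inr j = 0"
  and odd_part_nth [simp]: "odd_part x $ Inl i = 0" "odd_part x $ Inr j = x $ Inr j"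
  by (simp_all add: even_part_def odd_part_def)

lemma even_part_grade: "even_part x \<in> std_grade 0"
  and odd_part_grade: "odd_part x \<in> std_grade 1"
  by (simp_all add: std_grade_0 std_grade_Suc_0)

lemma even_plus_odd: "even_part x + odd_part x = x"
  by (rule vec_sum_eqI) simp_all

lemma superalgebra_sc_mult:
  fixes s :: "('m::finite, 'n::finite) struct_consts"
  shows "superalgebra (*s) std_grade (sc_mult s)"
proof
  show "vec.subspace (std_grade p)" for p
    by (auto simp: vec.subspace_def std_grade_def)
  show "\<exists>u\<in>std_grade 0. \<exists>v\<in>std_grade 1. x = u + v" for x :: "complex ^ ('m + 'n)"
    by (intro bexI[of _ "even_part x"] bexI[of _ "odd_part x"])
       (simp_all only: even_plus_odd even_part_grade odd_part_grade)
  show "std_grade 0 \<inter> std_grade 1 = {0 :: complex ^ ('m + 'n)}"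
    by (auto simp: std_grade_0 std_grade_Suc_0 intro: vec_sum_eqI)
  show "sc_mult s x y \<in> std_grade ((p + q) mod 2)"
    if "p \<in> {0, 1}" "q \<in> {0, 1}" "x \<in> std_grade p" "y \<in> std_grade q" for p q x y
    using that by (auto simp: std_grade_0 std_grade_Suc_0 sc_mult_Inl sc_mult_Inr)
qed (simp_all add: sc_mult_add_left sc_mult_add_right sc_mult_scale_left sc_mult_scale_right)

lemmas sc_mult_grade = superalgebra.mult_grade[OF superalgebra_sc_mult]

lemma sc_eqI:
  fixes s t :: "('m::finite, 'n::finite) struct_consts"
  assumes "\<And>i j k. sc_c s i j k = sc_c t i j k" "\<And>i j k. sc_rho s i j k = sc_rho t i j k"
    "\<And>i j k. sc_Gamma s i j k = sc_Gamma t i j k"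
  shows "s = t"
  unfolding vec_eq_iff
proof
  fix a show "s $ a = t $ a"
  proof (cases a)
    case (Inl b)
    then show ?thesis using assms(1) by (cases b) auto
  next
    case (Inr b)
    then show ?thesis
    proof (cases b)
      case (Inl d)
      then show ?thesis using assms(2) Inr by (cases d) auto
    next
      case b: (Inr d)
      then show ?thesis using assms(3) Inr by (cases d) auto
    qed
  qed
qed

lemma sc_mult_inject:
  assumes "sc_mult s = sc_mult t"
  shows "s = t"
proof -
  have "sc_c s i j k = sc_c t i j k" for i j k
    using arg_cong[OF assms, of "\<lambda>m. m (even_basis i) (even_basis j) $ Inl k"]
    unfolding sc_mult_even_even unfolding even_basis_def sum_axis_nth by simp
  moreover have "sc_rho s i j k = sc_rho t i j k" for i j k
    using arg_cong[OF assms, of "\<lambda>m. m (even_basis i) (odd_basis j) $ Inr k"]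
    unfolding sc_mult_even_odd unfolding odd_basis_def sum_axis_nth by simp
  moreover have "sc_Gamma s i j k = sc_Gamma t i j k" for i j k
    using arg_cong[OF assms, of "\<lambda>m. m (odd_basis i) (odd_basis j) $ Inl k"]
    unfolding sc_mult_odd_odd unfolding even_basis_def sum_axis_nth by simp
  ultimately show ?thesis by (rule sc_eqI)
qed

definition block :: "complex ^ 'm ^ 'm \<Rightarrow> complex ^ 'n ^ 'n
    \<Rightarrow> complex ^ ('m::finite + 'n::finite) \<Rightarrow> complex ^ ('m + 'n)" where
  "block g h x = (\<chi> k. case k of
       Inl i \<Rightarrow> (\<Sum>r\<in>UNIV. g $ i $ r * x $ Inl r)
     | Inr j \<Rightarrow> (\<Sum>r\<in>UNIV. h $ j $ r * x $ Inr r))"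

lemma block_nth:
  "block g h x $ Inl i = (\<Sum>r\<in>UNIV. g $ i $ r * x $ Inl r)"
  "block g h x $ Inr j = (\<Sum>r\<in>UNIV. h $ j $ r * x $ Inr r)"
  by (simp_all add: block_def)

lemma linear_block: "Vector_Spaces.linear (*s) (*s) (block g h)"
  unfolding Vector_Spaces.linear_iff
proof (intro conjI allI)
  show "vector_space ((*s) :: complex \<Rightarrow> complex ^ ('a + 'b) \<Rightarrow> complex ^ ('a + 'b))"
    by (rule vec.vector_space_axioms)
  show "vector_space ((*s) :: complex \<Rightarrow> complex ^ ('a + 'b) \<Rightarrow> complex ^ ('a + 'b))"
    by (rule vec.vector_space_axioms)
  show "block g h (x + y) = block g h x + block g h y" for x y
    by (rule vec_sum_eqI; simp add: block_nth algebra_simps sum.distrib)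
  show "block g h (a *s x) = a *s block g h x" for a x
    by (rule vec_sum_eqI; simp add: block_nth algebra_simps sum_distrib_left)
qed

lemma block_grade: "x \<in> std_grade p \<Longrightarrow> block g h x \<in> std_grade p"
  by (auto simp: std_grade_def block_nth split: if_splits)

lemma block_block: "block g h (block g' h' x) = block (g ** g') (h ** h') x"
proof -
  have *: "(\<Sum>r\<in>UNIV. g $ i $ r * (\<Sum>q\<in>UNIV. g' $ r $ q * z q))
      = (\<Sum>q\<in>UNIV. (g ** g') $ i $ q * z q)" for g g' :: "complex ^ 'k::finite ^ 'k" and i z
    unfolding matrix_matrix_mult_def
    by (simp add: sum_distrib_left sum_distrib_right mult.assoc) (rule sum.swap)
  show ?thesis by (rule vec_sum_eqI; simp only: block_nth *)
qed

lemma block_one: "block (mat 1) (mat 1) x = x"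
proof -
  have *: "(\<Sum>r\<in>UNIV. (mat 1 :: complex ^ 'k::finite ^ 'k) $ i $ r * z r) = z i" for i z
    by (simp add: mat_def if_distrib[of "\<lambda>c. c * _"] cong: if_cong)
  show ?thesis by (rule vec_sum_eqI; simp only: block_nth *)
qed

lemma matrix_inv_mult:
  assumes "invertible (g :: complex ^ 'n::finite ^ 'n)"
  shows "g ** matrix_inv g = mat 1" "matrix_inv g ** g = mat 1"
  using assms unfolding invertible_def matrix_inv_def by (metis (mono_tags, lifting) someI_ex)+

lemma block_inverse:
  assumes "invertible g" "invertible h"
  shows "block g h (block (matrix_inv g) (matrix_inv h) x) = x"
    "block (matrix_inv g) (matrix_inv h) (block g h x) = x"
  by (simp_all add: block_block block_one matrix_inv_mult assms)

lemma bij_block: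
  assumes "invertible g" "invertible h"
  shows "bij (block g h)"
  by (rule o_bij[of "block (matrix_inv g) (matrix_inv h)"])
     (simp_all add: fun_eq_iff block_inverse assms)

text \<open>The three kinds of structure constants transform by the same formula; this is the common step
  that pulls the old constants out of the transformed product.\<close>

lemma triple_sum_factor:
  fixes u :: "'p::finite \<Rightarrow> 'i::finite \<Rightarrow> complex" and v :: "'q::finite \<Rightarrow> 'j::finite \<Rightarrow> complex"
    and F :: "'p \<Rightarrow> 'q \<Rightarrow> 'r::finite \<Rightarrow> complex"
  shows "(\<Sum>i\<in>UNIV. \<Sum>j\<in>UNIV. (\<Sum>p\<in>UNIV. \<Sum>q\<in>UNIV. \<Sum>r\<in>UNIV. u p i * v q j * F p q r * w r) * (X i * Y j))
    = (\<Sum>r\<in>UNIV. w r * (\<Sum>p\<in>UNIV. \<Sum>q\<in>UNIV. F p q r * ((\<Sum>i\<in>UNIV. u p i * X i) * (\<Sum>j\<in>UNIV. v q j * Y j))))"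
    (is "?L = ?R")
proof -
  let ?t = "\<lambda>i j p q r. u p i * v q j * F p q r * w r * (X i * Y j)"
  have "?L = (\<Sum>i\<in>UNIV. \<Sum>j\<in>UNIV. \<Sum>p\<in>UNIV. \<Sum>q\<in>UNIV. \<Sum>r\<in>UNIV. ?t i j p q r)"
    by (simp add: sum_distrib_right)
  also have "\<dots> = (\<Sum>(i, j, p, q, r)\<in>UNIV. ?t i j p q r)"
    by (simp add: sum.cartesian_product case_prod_unfold)
  also have "\<dots> = (\<Sum>(r, p, q, i, j)\<in>UNIV. ?t i j p q r)"
    by (rule sum.reindex_bij_witness[of _ "\<lambda>(r, p, q, i, j). (i, j, p, q, r)"
          "\<lambda>(i, j, p, q, r). (r, p, q, i, j)"]) auto
  also have "\<dots> = (\<Sum>r\<in>UNIV. \<Sum>p\<in>UNIV. \<Sum>q\<in>UNIV. \<Sum>i\<in>UNIV. \<Sum>j\<in>UNIV. ?t i j p q r)"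
    by (simp add: sum.cartesian_product case_prod_unfold)
  also have "\<dots> = (\<Sum>r\<in>UNIV. w r * (\<Sum>p\<in>UNIV. \<Sum>q\<in>UNIV. F p q r *
      (\<Sum>i\<in>UNIV. \<Sum>j\<in>UNIV. (u p i * X i) * (v q j * Y j))))"
    by (simp add: sum_distrib_left mult_ac)
  also have "\<dots> = ?R"
    by (simp only: sum_product)
  finally show ?thesis .
qed

lemma gl_act_nth:
  "sc_c (gl_act g h s) i j k = (\<Sum>p\<in>UNIV. \<Sum>q\<in>UNIV. \<Sum>r\<in>UNIV.
      matrix_inv g $ p $ i * matrix_inv g $ q $ j * sc_c s p q r * g $ k $ r)"
  "sc_rho (gl_act g h s) i j' k' = (\<Sum>p\<in>UNIV. \<Sum>q\<in>UNIV. \<Sum>r\<in>UNIV.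
      matrix_inv g $ p $ i * matrix_inv h $ q $ j' * sc_rho s p q r * h $ k' $ r)"
  "sc_Gamma (gl_act g h s) i' j' k = (\<Sum>p\<in>UNIV. \<Sum>q\<in>UNIV. \<Sum>r\<in>UNIV.
      matrix_inv h $ p $ i' * matrix_inv h $ q $ j' * sc_Gamma s p q r * g $ k $ r)"
  by (simp_all add: gl_act_def make_sc_def Let_def)

lemma sc_mult_gl_act:
  "sc_mult (gl_act g h s) x y =
     block g h (sc_mult s (block (matrix_inv g) (matrix_inv h) x)
                          (block (matrix_inv g) (matrix_inv h) y))"
  by (rule vec_sum_eqI;
      simp only: sc_mult_Inl sc_mult_Inr block_nth gl_act_nth ring_distribs sum.distrib triple_sum_factor)

definition sc_iso :: "('m::finite, 'n::finite) struct_consts \<Rightarrow> ('m, 'n) struct_consts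
    \<Rightarrow> (complex ^ ('m + 'n) \<Rightarrow> complex ^ ('m + 'n)) \<Rightarrow> bool" where
  "sc_iso s t \<phi> \<longleftrightarrow> Vector_Spaces.linear (*s) (*s) \<phi> \<and> bij \<phi> \<and>
      (\<forall>p \<in> {0, 1}. \<phi> ` std_grade p \<subseteq> std_grade p) \<and>
      (\<forall>x y. \<phi> (sc_mult s x y) = sc_mult t (\<phi> x) (\<phi> y))"

lemma isomorphic_sc_iff: "isomorphic_sc s t \<longleftrightarrow> (\<exists>\<phi>. sc_iso s t \<phi>)"
  by (simp add: isomorphic_sc_def sc_iso_def)

lemma sc_iso_block:
  assumes "invertible g" "invertible h"
  shows "sc_iso s (gl_act g h s) (block g h)"
  unfolding sc_iso_def
  by (auto simp: linear_block bij_block block_grade assms sc_mult_gl_act block_inverse)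

lemma vec_expansion: "(x :: complex ^ 'i::finite) = (\<Sum>k\<in>UNIV. x $ k *s axis k (1::complex))"
proof -
  have "(\<Sum>k\<in>UNIV. x $ k * axis k 1 $ i) = (\<Sum>k\<in>UNIV. if i = k then x $ k else 0)" for i
    by (rule sum.cong) (auto simp: axis_def)
  then show ?thesis by (simp add: vec_eq_iff)
qed

text \<open>Grading-preserving linear maps are block diagonal, which identifies isomorphisms with the
  change of basis by a pair of matrices.\<close>

lemma graded_linear_is_block:
  fixes \<phi> :: "complex ^ ('m::finite + 'n::finite) \<Rightarrow> complex ^ ('m + 'n)"
  assumes lin: "Vector_Spaces.linear (*s) (*s) \<phi>"
    and gr: "\<forall>p \<in> {0, 1}. \<phi> ` std_grade p \<subseteq> std_grade p"
  shows "\<phi> = block (\<chi> i r. \<phi> (axis (Inl r) 1) $ Inl i) (\<chi> j r. \<phi> (axis (Inr r) 1) $ Inr j)"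
    (is "\<phi> = block ?g ?h")
proof
  fix x :: "complex ^ ('m + 'n)"
  have \<phi>x: "\<phi> x = (\<Sum>k\<in>UNIV. x $ k *s \<phi> (axis k 1))"
  proof -
    interpret Vector_Spaces.linear "(*s)" "(*s)" \<phi> by (rule lin)
    show ?thesis using arg_cong[OF vec_expansion[of x], of \<phi>] by (simp add: sum scale)
  qed
  have "axis (Inl r) 1 \<in> (std_grade 0 :: (complex ^ ('m + 'n)) set)"
    "axis (Inr q) 1 \<in> (std_grade 1 :: (complex ^ ('m + 'n)) set)" for r q
    by (auto simp: std_grade_0 std_grade_Suc_0 axis_def)
  then have gr': "\<phi> (axis (Inl r) 1) \<in> std_grade 0" "\<phi> (axis (Inr q) 1) \<in> std_grade 1" for r q
    using gr by auto
  show "\<phi> x = block ?g ?h x"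
    by (rule vec_sum_eqI;
        insert gr';
        simp add: block_nth \<phi>x sum_component
          std_grade_0 std_grade_Suc_0 UNIV_Plus_UNIV[symmetric] sum.Plus mult.commute del: UNIV_Plus_UNIV)
qed

lemma block_inject:
  assumes "block g h = block g' h'"
  shows "g = g' \<and> h = h'"
proof -
  have "(\<Sum>r\<in>UNIV. g $ i $ r * axis q 1 $ r) = g $ i $ q"
    for g :: "complex ^ 'k::finite ^ 'k" and i q
    by (simp add: axis_def if_distrib[of "\<lambda>c. _ * c"] cong: if_cong)
  note * = this
  have ax: "(axis (Inl q) 1 :: complex ^ ('a + 'b)) $ Inl r = axis q 1 $ r"
    "(axis (Inr q') 1 :: complex ^ ('a + 'b)) $ Inr r' = axis q' 1 $ r'" for q r q' r'
    by (simp_all add: axis_def)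
  have "g $ i $ q = g' $ i $ q" for i q
    using arg_cong[OF assms, of "\<lambda>f. f (axis (Inl q) 1) $ Inl i"]
    by (simp add: block_nth ax *)
  moreover have "h $ i $ q = h' $ i $ q" for i q
    using arg_cong[OF assms, of "\<lambda>f. f (axis (Inr q) 1) $ Inr i"]
    by (simp add: block_nth ax *)
  ultimately show ?thesis by (simp add: vec_eq_iff)
qed


lemma sc_iso_graded:
  assumes "sc_iso s t \<phi>" "x \<in> std_grade p"
  shows "\<phi> x \<in> std_grade p"
proof -
  have "std_grade p = (std_grade (if p = 0 then 0 else 1) :: (complex ^ ('a + 'b)) set)"
    by (simp add: std_grade_def)
  moreover have "(if p = 0 then 0 else 1 :: nat) \<in> {0, 1}" by simp
  ultimately show ?thesis using assms unfolding sc_iso_def by blast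
qed

lemma sc_iso_add: "sc_iso s t \<phi> \<Longrightarrow> \<phi> (x + y) = \<phi> x + \<phi> y"
  and sc_iso_scale: "sc_iso s t \<phi> \<Longrightarrow> \<phi> (a *s x) = a *s \<phi> x"
  and sc_iso_mult: "sc_iso s t \<phi> \<Longrightarrow> \<phi> (sc_mult s x y) = sc_mult t (\<phi> x) (\<phi> y)"
  by (auto simp: sc_iso_def Vector_Spaces.linear_iff)

lemma sc_iso_zero: "sc_iso s t \<phi> \<Longrightarrow> \<phi> 0 = 0"
  using sc_iso_scale[of s t \<phi> 0 0] by simp

lemma sc_iso_inv:
  fixes s t :: "('m::finite, 'n::finite) struct_consts"
  assumes iso: "sc_iso s t \<phi>"
  shows "sc_iso t s (inv \<phi>)"
proof -
  have bij: "bij \<phi>" using iso by (simp add: sc_iso_def)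
  then have inv: "\<phi> (inv \<phi> y) = y" "inv \<phi> (\<phi> x) = x" for x y
    by (simp_all add: bij_is_surj surj_f_inv_f bij_is_inj)
  have eqI: "inv \<phi> y = x" if "\<phi> x = y" for x y using that inv(2) by auto
  have "inv \<phi> y \<in> std_grade p" if p: "p \<in> {0, 1}" and y: "y \<in> std_grade p" for p y
  proof -
    let ?x = "inv \<phi> y"
    have e: "\<phi> (even_part ?x) + \<phi> (odd_part ?x) = y"
      by (metis sc_iso_add[OF iso] even_plus_odd inv(1))
    have gr: "\<phi> (even_part ?x) \<in> std_grade 0" "\<phi> (odd_part ?x) \<in> std_grade 1"
      by (rule sc_iso_graded[OF iso even_part_grade] sc_iso_graded[OF iso odd_part_grade])+
    show ?thesis
    proof (cases "p = 0")
      case True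
      have "\<phi> (odd_part ?x) = 0"
        using gr y True e
        by (intro vec_sum_eqI) (auto simp: std_grade_0 std_grade_Suc_0 vec_eq_iff, metis add_0)
      then have "odd_part ?x = 0" using inv(2) sc_iso_zero[OF iso] by metis
      then have "?x = even_part ?x" using even_plus_odd[of ?x] by simp
      then show ?thesis using True even_part_grade by metis
    next
      case False
      have "\<phi> (even_part ?x) = 0"
        using gr y False p e
        by (intro vec_sum_eqI) (auto simp: std_grade_0 std_grade_Suc_0 vec_eq_iff, metis add_0_right)
      then have "even_part ?x = 0" using inv(2) sc_iso_zero[OF iso] by metis
      then have "?x = odd_part ?x" using even_plus_odd[of ?x] by simp
      then show ?thesis using False p odd_part_grade by (metis insertE singletonD)
    qed
  qed
  moreover have "Vector_Spaces.linear (*s) (*s) (inv \<phi>)"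
    using iso unfolding Vector_Spaces.linear_iff sc_iso_def
    by (auto intro!: eqI simp: sc_iso_add[OF iso] sc_iso_scale[OF iso] inv)
  moreover have "inv \<phi> (sc_mult t x y) = sc_mult s (inv \<phi> x) (inv \<phi> y)" for x y
    by (rule eqI) (simp add: sc_iso_mult[OF iso] inv)
  ultimately show ?thesis
    using bij unfolding sc_iso_def by (auto simp: bij_imp_bij_inv)
qed

lemma isomorphic_sc_refl: "isomorphic_sc s s"
  unfolding isomorphic_sc_iff sc_iso_def
  by (intro exI[of _ id]) (auto simp: Vector_Spaces.linear_iff vec.vector_space_axioms)

lemma isomorphic_sc_sym: "isomorphic_sc s t \<Longrightarrow> isomorphic_sc t s"
  using sc_iso_inv unfolding isomorphic_sc_iff by blast

lemma isomorphic_sc_trans: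
  assumes "isomorphic_sc s t" "isomorphic_sc t u"
  shows "isomorphic_sc s u"
proof -
  obtain \<phi> \<psi> where iso: "sc_iso s t \<phi>" "sc_iso t u \<psi>"
    using assms unfolding isomorphic_sc_iff by blast
  have "sc_iso s u (\<psi> \<circ> \<phi>)"
    unfolding sc_iso_def
  proof (intro conjI ballI allI)
    show "Vector_Spaces.linear (*s) (*s) (\<psi> \<circ> \<phi>)" "bij (\<psi> \<circ> \<phi>)"
      using iso by (auto simp: sc_iso_def intro: Vector_Spaces.linear_compose bij_comp)
    show "(\<psi> \<circ> \<phi>) ` std_grade p \<subseteq> std_grade p" for p
      using sc_iso_graded[OF iso(1)] sc_iso_graded[OF iso(2)] by auto
  qed (simp add: sc_iso_mult[OF iso(1)] sc_iso_mult[OF iso(2)])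
  then show ?thesis unfolding isomorphic_sc_iff by blast
qed

lemma isomorphic_sc_gl_act:
  "isomorphic_sc s t \<longleftrightarrow> (\<exists>g h. invertible g \<and> invertible h \<and> t = gl_act g h s)"
proof
  assume "isomorphic_sc s t"
  then obtain \<phi> where \<phi>: "sc_iso s t \<phi>" unfolding isomorphic_sc_iff by blast
  then have \<phi>': "sc_iso t s (inv \<phi>)" by (rule sc_iso_inv)
  obtain g h where gh: "\<phi> = block g h"
    using graded_linear_is_block[of \<phi>] \<phi> unfolding sc_iso_def by blast
  obtain g' h' where gh': "inv \<phi> = block g' h'"
    using graded_linear_is_block[of "inv \<phi>"] \<phi>' unfolding sc_iso_def by blast
  have "\<phi> (inv \<phi> x) = x" "inv \<phi> (\<phi> x) = x" for x
    using \<phi> by (simp_all add: sc_iso_def bij_is_surj surj_f_inv_f bij_is_inj)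
  then have "block g h (block g' h' x) = x" "block g' h' (block g h x) = x" for x
    by (metis gh gh')+
  then have "block (g ** g') (h ** h') = block (mat 1) (mat 1)"
    "block (g' ** g) (h' ** h) = block (mat 1) (mat 1)"
    by (simp_all add: fun_eq_iff block_block block_one)
  then have inv: "invertible g" "invertible h"
    unfolding invertible_def by (metis block_inject)+
  have "sc_mult t = sc_mult (gl_act g h s)"
  proof (intro ext)
    fix x y
    let ?b = "block (matrix_inv g) (matrix_inv h)"
    have "sc_mult t x y = sc_mult t (\<phi> (?b x)) (\<phi> (?b y))"
      by (simp add: gh block_inverse inv)
    also have "\<dots> = \<phi> (sc_mult s (?b x) (?b y))"
      by (simp add: sc_iso_mult[OF \<phi>])
    also have "\<dots> = sc_mult (gl_act g h s) x y"
      by (simp add: gh sc_mult_gl_act)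
    finally show "sc_mult t x y = sc_mult (gl_act g h s) x y" .
  qed
  then show "\<exists>g h. invertible g \<and> invertible h \<and> t = gl_act g h s"
    using inv sc_mult_inject by blast
next
  assume "\<exists>g h. invertible g \<and> invertible h \<and> t = gl_act g h s"
  then show "isomorphic_sc s t" using sc_iso_block unfolding isomorphic_sc_iff by blast
qed

lemma orbit_eq: "orbit s = {t. isomorphic_sc s t}"
  by (auto simp: orbit_def isomorphic_sc_gl_act)

lemma poly_map_gl_act: "poly_map (gl_act g h :: ('m::finite, 'n::finite) struct_consts \<Rightarrow> _)"
  unfolding poly_map_def
proof
  fix a :: "('m \<times> 'm \<times> 'm) + ('m \<times> 'n \<times> 'n) + ('n \<times> 'n \<times> 'm)"
  have sum: "(\<lambda>s. \<Sum>p\<in>UNIV. \<Sum>q\<in>UNIV. \<Sum>r\<in>UNIV. F p q r * s $ v p q r * G p q r) \<in> poly_functions"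
    for F G :: "'p::finite \<Rightarrow> 'q::finite \<Rightarrow> 'r::finite \<Rightarrow> complex" and v :: "'p \<Rightarrow> 'q \<Rightarrow> 'r \<Rightarrow> 'k::finite"
    by (intro poly_functions_sum poly_functions.mult poly_functions.const poly_functions.coord)
  show "(\<lambda>s. gl_act g h s $ a) \<in> poly_functions"
  proof (cases a)
    case (Inl b)
    then show ?thesis by (cases b) (simp add: gl_act_nth sum)
  next
    case (Inr b)
    then show ?thesis
    proof (cases b)
      case (Inl d)
      then show ?thesis using Inr by (cases d) (simp add: gl_act_nth sum)
    next
      case b: (Inr d)
      then show ?thesis using Inr by (cases d) (simp add: gl_act_nth sum)
    qed
  qed
qed

text \<open>For fixed matrices the action is linear in the structure constants, so it is continuous
  for the Zariski topology and preserves the closure of a stable set.\<close>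

lemma closure_isomorphic:
  assumes stable: "\<And>s t. s \<in> S \<Longrightarrow> isomorphic_sc s t \<Longrightarrow> t \<in> S"
    and "s \<in> zariski closure_of S" "isomorphic_sc s t"
  shows "t \<in> zariski closure_of S"
proof -
  obtain g h where gh: "invertible g" "invertible h" "t = gl_act g h s"
    using assms(3) isomorphic_sc_gl_act by blast
  have "zariski_closed (gl_act g h -` (zariski closure_of S))"
    by (rule zariski_closed_vimage[OF poly_map_gl_act closedin_closure])
  moreover have "S \<subseteq> gl_act g h -` (zariski closure_of S)"
    using stable gh isomorphic_sc_gl_act subset_closure[of S] by blast
  ultimately have "zariski closure_of S \<subseteq> gl_act g h -` (zariski closure_of S)"
    by (simp add: closure_minimal)
  then show ?thesis using assms(2) gh(3) by blast
qed

section \<open>Graded identities\<close>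

text \<open>Conditions of the form ``a linear combination of nonassociative monomials vanishes on vectors
  of prescribed parities'' are at once polynomial in the structure constants and invariant under
  isomorphism.  Evaluating syntactic monomials proves both facts for all such identities together.\<close>

datatype nonassoc = Var nat | Prod nonassoc nonassoc

primrec term_val :: "('m::finite, 'n::finite) struct_consts \<Rightarrow> (nat \<Rightarrow> complex ^ ('m + 'n))
    \<Rightarrow> nonassoc \<Rightarrow> complex ^ ('m + 'n)" where
  "term_val s env (Var n) = env n"
| "term_val s env (Prod a b) = sc_mult s (term_val s env a) (term_val s env b)"

definition law :: "(nat \<Rightarrow> nat) \<Rightarrow> (complex \<times> nonassoc) list
    \<Rightarrow> ('m::finite, 'n::finite) struct_consts \<Rightarrow> bool" where
  "law par L s \<longleftrightarrow> (\<forall>env. (\<forall>n. env n \<in> std_grade (par n)) \<longrightarrow>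
     (\<Sum>(a, m)\<leftarrow>L. a *s term_val s env m) = 0)"

lemma term_val_iso: "sc_iso s t \<phi> \<Longrightarrow> \<phi> (term_val s env m) = term_val t (\<phi> \<circ> env) m"
  by (induction m) (simp_all add: sc_iso_mult)

lemma law_isomorphic:
  fixes s t :: "('m::finite, 'n::finite) struct_consts"
  assumes "isomorphic_sc s t" "law par L s"
  shows "law par L t"
  unfolding law_def
proof (intro allI impI)
  fix env :: "nat \<Rightarrow> complex ^ ('m + 'n)"
  assume env: "\<forall>n. env n \<in> std_grade (par n)"
  obtain \<phi> where iso: "sc_iso t s \<phi>"
    using isomorphic_sc_sym[OF assms(1)] unfolding isomorphic_sc_iff by blast
  have "\<phi> (\<Sum>(a, m)\<leftarrow>L. a *s term_val t env m) = (\<Sum>(a, m)\<leftarrow>L. a *s term_val s (\<phi> \<circ> env) m)"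
    by (induction L)
       (auto simp: sc_iso_zero[OF iso] sc_iso_add[OF iso] sc_iso_scale[OF iso] term_val_iso[OF iso] o_def)
  also have "\<dots> = 0"
    using assms(2) env sc_iso_graded[OF iso] unfolding law_def by simp
  finally show "(\<Sum>(a, m)\<leftarrow>L. a *s term_val t env m) = 0"
    using iso sc_iso_zero[OF iso] unfolding sc_iso_def by (metis bij_is_inj injD)
qed

lemma poly_map_sc_mult:
  assumes "poly_map F" "poly_map G"
  shows "poly_map (\<lambda>s. sc_mult s (F s) (G s))"
  unfolding poly_map_def
proof
  fix k
  have [simp]: "(\<lambda>s. F s $ i) \<in> poly_functions" "(\<lambda>s. G s $ i) \<in> poly_functions" for i
    using assms by (simp_all add: poly_map_def)
  show "(\<lambda>s. sc_mult s (F s) (G s) $ k) \<in> poly_functions"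
    by (cases k)
       (simp_all add: sc_mult_Inl sc_mult_Inr,
        (intro poly_functions_sum poly_functions.add poly_functions.mult poly_functions.coord; simp)+)
qed

lemma poly_map_term_val: "poly_map (\<lambda>s. term_val s env m)"
  by (induction m) (simp_all add: poly_map_const poly_map_sc_mult)

lemma zariski_closed_law: "zariski_closed {s. law par L s}"
proof -
  have "poly_map (\<lambda>s. \<Sum>(a, m)\<leftarrow>L. a *s term_val s env m)"
    for env :: "nat \<Rightarrow> complex ^ ('a + 'b)"
    by (induction L)
       (auto simp: poly_map_const intro!: poly_map_add poly_map_scale poly_map_term_val)
  then have "zariski_closed {s. \<forall>env\<in>{env. \<forall>n. env n \<in> std_grade (par n)}.
      (\<Sum>(a, m)\<leftarrow>L. a *s term_val s env m) = (0 :: complex ^ ('a + 'b))}"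
    by (intro zariski_closed_all zariski_closed_vector_zero)
  then show ?thesis by (simp add: law_def)
qed

section \<open>Flags and the closedness of the variety\<close>

definition supercomm :: "('m::finite, 'n::finite) struct_consts \<Rightarrow> bool" where
  "supercomm s \<longleftrightarrow> (\<forall>p\<in>{0, 1}. \<forall>q\<in>{0, 1}. \<forall>x\<in>std_grade p. \<forall>y\<in>std_grade q.
     sc_mult s x y = ((- 1) ^ (p * q)) *s sc_mult s y x)"

definition jordan_terms :: "nat \<Rightarrow> nat \<Rightarrow> nat \<Rightarrow> nat \<Rightarrow> (complex \<times> nonassoc) list" where
  "jordan_terms pw px py pz = (let w = Var 0; x = Var 1; y = Var 2; z = Var 3 in
     [(1, Prod (Prod w x) (Prod y z)),
      ((- 1) ^ (px * py), Prod (Prod w y) (Prod x z)),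
      ((- 1) ^ ((px + py) * pz), Prod (Prod w z) (Prod x y)),
      (- ((- 1) ^ (pw * px)), Prod x (Prod w (Prod y z))),
      (- ((- 1) ^ (py * (pw + px))), Prod y (Prod w (Prod x z))),
      (- ((- 1) ^ (pz * (pw + px + py))), Prod z (Prod w (Prod x y)))])"

text \<open>An assignment of values to the variables 0 to 3; the remaining variables get 0, which lies in
  both homogeneous parts.\<close>

definition four :: "'a \<Rightarrow> 'a \<Rightarrow> 'a \<Rightarrow> 'a \<Rightarrow> nat \<Rightarrow> 'a::zero" where
  "four w x y z = (\<lambda>n. if n = 0 then w else if n = 1 then x else if n = 2 then y
     else if n = 3 then z else 0)"

lemma four_simps [simp]: "four w x y z 0 = w" "four w x y z (Suc 0) = x" "four w x y z 1 = x"
  "four w x y z 2 = y" "four w x y z 3 = z"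
  by (simp_all add: four_def)

lemma zero_grade [simp]: "0 \<in> std_grade p"
  by (simp add: std_grade_def)

lemma four_grade:
  assumes "w \<in> std_grade (par 0)" "x \<in> std_grade (par 1)" "y \<in> std_grade (par 2)"
    "z \<in> std_grade (par 3)"
  shows "\<forall>n. four w x y z n \<in> std_grade (par n)"
  using assms by (auto simp: four_def)

text \<open>The assumption says that only the variables 0 to 3 occur in \<open>L\<close>; the quantifier over
  assignments then becomes one over four vectors.\<close>

lemma law_four:
  assumes "\<And>env env'. (\<forall>n<4. env n = env' n) \<Longrightarrow>
      (\<Sum>(a, m)\<leftarrow>L. a *s term_val s env m) = (\<Sum>(a, m)\<leftarrow>L. a *s term_val s env' m)"
  shows "law par L s \<longleftrightarrow> (\<forall>w\<in>std_grade (par 0). \<forall>x\<in>std_grade (par 1). \<forall>y\<in>std_grade (par 2).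
     \<forall>z\<in>std_grade (par 3). (\<Sum>(a, m)\<leftarrow>L. a *s term_val s (four w x y z) m) = 0)"
proof
  assume "law par L s"
  then show "\<forall>w\<in>std_grade (par 0). \<forall>x\<in>std_grade (par 1). \<forall>y\<in>std_grade (par 2).
     \<forall>z\<in>std_grade (par 3). (\<Sum>(a, m)\<leftarrow>L. a *s term_val s (four w x y z) m) = 0"
    unfolding law_def using four_grade by blast
next
  assume R: "\<forall>w\<in>std_grade (par 0). \<forall>x\<in>std_grade (par 1). \<forall>y\<in>std_grade (par 2).
     \<forall>z\<in>std_grade (par 3). (\<Sum>(a, m)\<leftarrow>L. a *s term_val s (four w x y z) m) = 0"
  have "(\<Sum>(a, m)\<leftarrow>L. a *s term_val s env m) = 0" if env: "\<forall>n. env n \<in> std_grade (par n)" for env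
  proof -
    have "\<forall>n<4. env n = four (env 0) (env 1) (env 2) (env 3) n"
      by (auto simp: four_def less_Suc_eq numeral_eq_Suc)
    then have "(\<Sum>(a, m)\<leftarrow>L. a *s term_val s env m)
        = (\<Sum>(a, m)\<leftarrow>L. a *s term_val s (four (env 0) (env 1) (env 2) (env 3)) m)"
      by (rule assms)
    also have "\<dots> = 0" using R env by blast
    finally show ?thesis .
  qed
  then show "law par L s" unfolding law_def by blast
qed

definition jordan_identity :: "('m::finite, 'n::finite) struct_consts \<Rightarrow> bool" where
  "jordan_identity s \<longleftrightarrow> (\<forall>pw\<in>{0, 1}. \<forall>px\<in>{0, 1}. \<forall>py\<in>{0, 1}. \<forall>pz\<in>{0, 1}.
     law (four pw px py pz) (jordan_terms pw px py pz) s)"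

lemma jordan_identity_iff:
  "jordan_identity s \<longleftrightarrow> (\<forall>pw\<in>{0, 1}. \<forall>px\<in>{0, 1}. \<forall>py\<in>{0, 1}. \<forall>pz\<in>{0, 1}.
     \<forall>w\<in>std_grade pw. \<forall>x\<in>std_grade px. \<forall>y\<in>std_grade py. \<forall>z\<in>std_grade pz.
       sc_mult s (sc_mult s w x) (sc_mult s y z)
         + ((- 1) ^ (px * py)) *s sc_mult s (sc_mult s w y) (sc_mult s x z)
         + ((- 1) ^ ((px + py) * pz)) *s sc_mult s (sc_mult s w z) (sc_mult s x y)
         - ((- 1) ^ (pw * px)) *s sc_mult s x (sc_mult s w (sc_mult s y z))
         - ((- 1) ^ (py * (pw + px))) *s sc_mult s y (sc_mult s w (sc_mult s x z))
         - ((- 1) ^ (pz * (pw + px + py))) *s sc_mult s z (sc_mult s w (sc_mult s x y)) = 0)"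
  unfolding jordan_identity_def
  by (subst law_four) (simp_all add: jordan_terms_def Let_def vec.scale_minus_left algebra_simps)

lemma supercomm_law:
  "supercomm s \<longleftrightarrow> (\<forall>p\<in>{0, 1}. \<forall>q\<in>{0, 1}. law (four p q 0 0)
     [(1, Prod (Var 0) (Var 1)), (- ((- 1) ^ (p * q)), Prod (Var 1) (Var 0))] s)"
proof -
  have [simp]: "\<exists>x :: complex ^ ('a + 'b). x \<in> std_grade p" for p
    using zero_grade[of p] by blast
  show ?thesis
    unfolding supercomm_def by (subst law_four) (simp_all add: vec.scale_minus_left)
qed

text \<open>The product \<open>v\<^sub>n (v\<^sub>n\<^sub>-\<^sub>1 (\<dots> (v\<^sub>1 v\<^sub>0)))\<close>.  In a supercommutative algebra
  nilpotency can be tested on these products alone.\<close>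

primrec left_term :: "nat \<Rightarrow> nonassoc" where
  "left_term 0 = Var 0"
| "left_term (Suc n) = Prod (Var (Suc n)) (left_term n)"

definition left_nil :: "nat \<Rightarrow> ('m::finite, 'n::finite) struct_consts \<Rightarrow> bool" where
  "left_nil N s \<longleftrightarrow> (\<forall>par. law par [(1, left_term N)] s)"

lemma left_nil_iff:
  "left_nil N s \<longleftrightarrow> (\<forall>env. (\<forall>n. \<exists>p\<in>{0, 1}. env n \<in> std_grade p) \<longrightarrow> term_val s env (left_term N) = 0)"
proof
  assume L: "left_nil N s"
  show "\<forall>env. (\<forall>n. \<exists>p\<in>{0, 1}. env n \<in> std_grade p) \<longrightarrow> term_val s env (left_term N) = 0"
  proof (intro allI impI)
    fix env :: "nat \<Rightarrow> complex ^ ('a + 'b)"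
    assume "\<forall>n. \<exists>p\<in>{0, 1}. env n \<in> std_grade p"
    then obtain par where "\<forall>n. env n \<in> std_grade (par n)" by metis
    then show "term_val s env (left_term N) = 0" using L unfolding left_nil_def law_def by auto
  qed
next
  assume R: "\<forall>env. (\<forall>n. \<exists>p\<in>{0, 1}. env n \<in> std_grade p) \<longrightarrow> term_val s env (left_term N) = 0"
  have "\<exists>q\<in>{0, 1}. x \<in> std_grade q" if "x \<in> std_grade p" for p and x :: "complex ^ ('a + 'b)"
    using that by (auto simp: std_grade_def split: if_splits)
  then show "left_nil N s" using R unfolding left_nil_def law_def by fastforce
qed

lemma NJS_iff_nilpotent:
  "s \<in> NJS \<longleftrightarrow> supercomm s \<and> jordan_identity s \<and> superalgebra.nilpotent_alg (*s) (sc_mult s)"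
  unfolding NJS_def jordan_superalgebra_def jordan_superalgebra_axioms_def supercomm_def
    jordan_identity_iff
  by (simp only: mem_Collect_eq superalgebra_sc_mult Ball_def all_simps simp_thms conj_assoc)

lemmas alg_power_simps = superalgebra.alg_power.simps[OF superalgebra_sc_mult]

lemma left_term_in_alg_power:
  "term_val s env (left_term n) \<in> superalgebra.alg_power (*s) (sc_mult s) (Suc n)"
proof (induction n)
  case (Suc n)
  have "sc_mult s (env (Suc n)) (term_val s env (left_term n))
      \<in> {sc_mult s x y | x y. x \<in> superalgebra.alg_power (*s) (sc_mult s) (Suc n - n) \<and>
            y \<in> superalgebra.alg_power (*s) (sc_mult s) (Suc n)}"
    using Suc by (auto simp: alg_power_simps Suc_diff_le)
  then show ?case
    unfolding alg_power_simps by (intro vec.span_base UN_I[of n]) simp_all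
qed (simp add: alg_power_simps)

lemma nilpotent_imp_left_nil:
  assumes "superalgebra.nilpotent_alg (*s) (sc_mult s)"
  shows "\<exists>N. left_nil N s"
proof -
  obtain k where k: "k \<ge> 1" "superalgebra.alg_power (*s) (sc_mult s) k = {0}"
    using assms superalgebra.nilpotent_alg_def[OF superalgebra_sc_mult] by blast
  then have "superalgebra.alg_power (*s) (sc_mult s) (Suc (k - 1)) = {0}" by simp
  then have "term_val s env (left_term (k - 1)) = 0" for env
    using left_term_in_alg_power[of s env "k - 1"] by simp
  then show ?thesis unfolding left_nil_iff by blast
qed

lemma left_term_cong:
  "(\<And>i. i \<le> n \<Longrightarrow> env i = env' i) \<Longrightarrow> term_val s env (left_term n) = term_val s env' (left_term n)"
  by (induction n) auto

lemma left_term_homogeneous: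
  assumes "\<forall>n. \<exists>p\<in>{0, 1}. env n \<in> std_grade p"
  shows "\<exists>p\<in>{0, 1}. term_val s env (left_term n) \<in> std_grade p"
proof (induction n)
  case (Suc n)
  obtain p q where pq: "p \<in> {0, 1}" "q \<in> {0, 1}" "env (Suc n) \<in> std_grade p"
      "term_val s env (left_term n) \<in> std_grade q"
    using Suc assms by blast
  have "(p + q) mod 2 \<in> {0, 1}" by auto
  then show ?case using sc_mult_grade[OF pq] by auto
qed (use assms in auto)

text \<open>Left products are applied to a homogeneous vector outside \<open>U\<close> for as long as they stay
  outside \<open>U\<close>; nilpotency stops this process at a vector that annihilates modulo \<open>U\<close>.\<close>

lemma annihilating_modulo:
  fixes s :: "('m::finite, 'n::finite) struct_consts"
  assumes comm: "supercomm s" and nil: "left_nil N s" and U: "vec.subspace U" "U \<noteq> UNIV"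
  shows "\<exists>p\<in>{0, 1}. \<exists>v\<in>std_grade p. v \<notin> U \<and> (\<forall>w. sc_mult s w v \<in> U \<and> sc_mult s v w \<in> U)"
proof (rule ccontr)
  assume none: "\<not> ?thesis"
  have parts: "x \<in> U" if "even_part x \<in> U" "odd_part x \<in> U" for x
    using vec.subspace_add[OF U(1) that] by (simp add: even_plus_odd)
  have step: "\<exists>p\<in>{0, 1}. \<exists>w\<in>std_grade p. sc_mult s w u \<notin> U"
    if u: "q \<in> {0, 1}" "u \<in> std_grade q" "u \<notin> U" for u q
  proof (rule ccontr)
    assume no: "\<not> ?thesis"
    have L: "sc_mult s w u \<in> U \<and> sc_mult s u w \<in> U" if w: "p \<in> {0, 1}" "w \<in> std_grade p" for p w
    proof -
      have "sc_mult s w u \<in> U" using no w by blast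
      moreover have "sc_mult s u w = ((- 1) ^ (q * p)) *s sc_mult s w u"
        using comm w u unfolding supercomm_def by blast
      ultimately show ?thesis by (simp add: vec.subspace_scale[OF U(1)])
    qed
    have "sc_mult s w u \<in> U \<and> sc_mult s u w \<in> U" for w
    proof -
      have "sc_mult s (even_part w + odd_part w) u \<in> U" "sc_mult s u (even_part w + odd_part w) \<in> U"
        using L[OF _ even_part_grade, of w] L[OF _ odd_part_grade, of w]
        by (simp_all add: sc_mult_add_left sc_mult_add_right vec.subspace_add[OF U(1)])
      then show ?thesis by (simp add: even_plus_odd)
    qed
    then show False using none u by blast
  qed
  have "\<exists>env. (\<forall>n. \<exists>p\<in>{0, 1}. env n \<in> std_grade p) \<and> term_val s env (left_term n) \<notin> U" for n
  proof (induction n)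
    case 0
    obtain x where "x \<notin> U" using U(2) by blast
    then obtain y p where "p \<in> {0, 1}" "y \<in> std_grade p" "y \<notin> U"
      using parts even_part_grade odd_part_grade by blast
    then show ?case by (intro exI[of _ "\<lambda>_. y"]) auto
  next
    case (Suc n)
    then obtain env where env: "\<forall>n. \<exists>p\<in>{0, 1}. env n \<in> std_grade p"
      "term_val s env (left_term n) \<notin> U" by blast
    obtain q where q: "q \<in> {0, 1}" "term_val s env (left_term n) \<in> std_grade q"
      using left_term_homogeneous[OF env(1), of s n] by (elim bexE)
    obtain p w where w: "p \<in> {0, 1}" "w \<in> std_grade p"
        "sc_mult s w (term_val s env (left_term n)) \<notin> U"
      using step[OF q env(2)] by (elim bexE)
    have "term_val s (env(Suc n := w)) (left_term n) = term_val s env (left_term n)"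
      by (rule left_term_cong) simp
    then have "term_val s (env(Suc n := w)) (left_term (Suc n)) \<notin> U"
      using w(3) by (simp only: left_term.simps term_val.simps fun_upd_same not_False_eq_True)
    moreover have "\<forall>i. \<exists>p\<in>{0, 1}. (env(Suc n := w)) i \<in> std_grade p" using env(1) w by auto
    ultimately show ?case by blast
  qed
  then obtain env where "\<forall>n. \<exists>p\<in>{0, 1}. env n \<in> std_grade p" "term_val s env (left_term N) \<notin> U"
    by blast
  moreover have "0 \<in> U" by (rule vec.subspace_0[OF U(1)])
  ultimately show False using nil unfolding left_nil_iff by metis
qed

definition parity :: "'m + 'n \<Rightarrow> nat" where
  "parity k = (case k of Inl _ \<Rightarrow> 0 | Inr _ \<Rightarrow> 1)"

lemma parity_simps [simp]: "parity (Inl i) = 0" "parity (Inr j) = 1"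
  by (simp_all add: parity_def)

lemma grade_in_span_axes:
  fixes x :: "complex ^ ('m::finite + 'n::finite)"
  assumes "x \<in> std_grade p" "p \<in> {0, 1}"
  shows "x \<in> vec.span ((\<lambda>k. axis k 1) ` {k. parity k = p})"
proof -
  have "x $ k *s axis k 1 \<in> vec.span ((\<lambda>k. axis k 1) ` {k. parity k = p})" for k
  proof (cases "parity k = p")
    case True
    then show ?thesis by (intro vec.span_scale vec.span_base) auto
  next
    case False
    then have "x $ k = 0" using assms by (cases k) (auto simp: std_grade_def split: if_splits)
    then show ?thesis by (simp add: vec.span_zero)
  qed
  then have "(\<Sum>k\<in>UNIV. x $ k *s axis k 1) \<in> vec.span ((\<lambda>k. axis k 1) ` {k. parity k = p})"
    by (intro vec.span_sum)
  then show ?thesis using vec_expansion[of x] by simp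
qed

text \<open>The basis is built from the bottom, each new vector being one that annihilates modulo the
  span of the earlier ones.  The new vector takes the free index of its parity with the least
  priority, so that within each parity the ranks follow a prescribed order.\<close>

lemma exists_flag_basis:
  fixes s :: "('m::finite, 'n::finite) struct_consts" and pr :: "'m + 'n \<Rightarrow> nat"
  assumes comm: "supercomm s" and nil: "left_nil N s"
  shows "n \<le> CARD('m + 'n) \<Longrightarrow> \<exists>K b rk. card K = n \<and>
    (\<forall>k\<in>K. b k \<in> std_grade (parity k)) \<and> inj_on b K \<and> vec.independent (b ` K) \<and>
    (\<forall>k\<in>K. \<forall>w. sc_mult s w (b k) \<in> vec.span (b ` {j\<in>K. rk j < rk k}) \<and>
               sc_mult s (b k) w \<in> vec.span (b ` {j\<in>K. rk j < rk k})) \<and>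
    (\<forall>k\<in>K. rk k < n) \<and>
    (\<forall>k\<in>K. \<forall>j. parity j = parity k \<and> pr j < pr k \<longrightarrow> j \<in> K \<and> rk j < (rk k :: nat))"
proof (induction n)
  case 0
  show ?case by (intro exI[of _ "{}"]) (auto simp: vec.independent_empty)
next
  case (Suc n)
  then have "n \<le> CARD('m + 'n)" by simp
  from Suc.IH[OF this] obtain K b rk where flag: "card K = n"
    "\<forall>k\<in>K. b k \<in> std_grade (parity k)" "inj_on b K" "vec.independent (b ` K)"
    "\<forall>k\<in>K. \<forall>w. sc_mult s w (b k) \<in> vec.span (b ` {j\<in>K. rk j < rk k}) \<and>
               sc_mult s (b k) w \<in> vec.span (b ` {j\<in>K. rk j < rk k})"
    "\<forall>k\<in>K. rk k < n"
    "\<forall>k\<in>K. \<forall>j. parity j = parity k \<and> pr j < pr k \<longrightarrow> j \<in> K \<and> rk j < (rk k :: nat)"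
    by (elim exE conjE) (rule that)
  note K = flag(1) and gr = bspec[OF flag(2)] and inj = flag(3) and ind = flag(4)
    and ann = spec[OF bspec[OF flag(5)]] and rk = bspec[OF flag(6)] and ord = flag(7)
  have "vec.span (b ` K) \<noteq> UNIV"
  proof
    assume "vec.span (b ` K) = UNIV"
    then have "CARD('m + 'n) \<le> card (b ` K)"
      using vec.dim_le_card[of UNIV "b ` K"] vec_dim_card[where 'n = "'m + 'n" and 'a = complex] by simp
    then show False using Suc.prems K card_image_le[of K b] by simp
  qed
  then obtain p v where v: "p \<in> {0, 1}" "v \<in> std_grade p" "v \<notin> vec.span (b ` K)"
    and vann: "\<And>w. sc_mult s w v \<in> vec.span (b ` K) \<and> sc_mult s v w \<in> vec.span (b ` K)"
    using annihilating_modulo[OF comm nil vec.subspace_span, of "b ` K"] by blast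
  have "\<exists>j. j \<notin> K \<and> parity j = p"
  proof (rule ccontr)
    assume "\<not> ?thesis"
    then have sub: "{j. parity j = p} \<subseteq> K" by blast
    let ?I = "insert v (b ` {j. parity j = p})"
    have v': "v \<notin> vec.span (b ` {j. parity j = p})"
      using v(3) vec.span_mono[OF image_mono[OF sub, of b]] by blast
    have ind': "vec.independent ?I"
      using v' vec.independent_mono[OF ind image_mono[OF sub]] by (simp add: vec.independent_insertI)
    have "?I \<subseteq> vec.span ((\<lambda>k. axis k 1) ` {k. parity k = p})"
    proof (intro insert_subsetI subsetI)
      show "v \<in> vec.span ((\<lambda>k. axis k 1) ` {k. parity k = p})"
        by (rule grade_in_span_axes[OF v(2,1)])
      fix x assume "x \<in> b ` {j. parity j = p}"
      then obtain j where "x = b j" "parity j = p" by blast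
      then have "x \<in> std_grade p" using gr[of j] sub by blast
      then show "x \<in> vec.span ((\<lambda>k. axis k 1) ` {k. parity k = p})"
        by (rule grade_in_span_axes[OF _ v(1)])
    qed
    then have "card ?I \<le> card ((\<lambda>k. axis k (1::complex)) ` {k :: 'm + 'n. parity k = p})"
      using vec.independent_span_bound[OF _ ind'] by simp
    also have "\<dots> \<le> card {k :: 'm + 'n. parity k = p}" by (rule card_image_le) simp
    also have "\<dots> = card (b ` {j. parity j = p})"
      by (rule card_image[symmetric]) (rule inj_on_subset[OF inj sub])
    also have "\<dots> < card ?I"
    proof -
      have "v \<notin> b ` {j. parity j = p}" using v' vec.span_base by metis
      then show ?thesis by simp
    qed
    finally show False by simp
  qed
  then obtain j where j: "j \<notin> K" "parity j = p" and
      least: "\<And>i. i \<notin> K \<Longrightarrow> parity i = p \<Longrightarrow> pr j \<le> pr i"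
    using ex_has_least_nat[of "\<lambda>j. j \<notin> K \<and> parity j = p" _ pr] by blast
  define b' where "b' = b(j := v)"
  define rk' where "rk' = rk(j := n)"
  have b': "b' k = b k" "rk' k = rk k" if "k \<in> K" for k using that j by (auto simp: b'_def rk'_def)
  have bj: "b' j = v" "rk' j = n" by (simp_all add: b'_def rk'_def)
  have im: "b' ` K = b ` K" using b' by (auto simp: image_iff)
  have set1: "{i \<in> insert j K. rk' i < rk' k} = {i \<in> K. rk i < rk k}" if "k \<in> K" for k
    using that b' bj rk[OF that] by auto
  have set2: "{i \<in> insert j K. rk' i < rk' j} = K" using b' bj rk by auto
  have im1: "b' ` {i \<in> K. rk i < rk k} = b ` {i \<in> K. rk i < rk k}" for k
    using b' by (auto simp: image_iff)
  show ?case
  proof (intro exI[of _ "insert j K"] exI[of _ b'] exI[of _ rk'] conjI ballI allI impI)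
    show "card (insert j K) = Suc n" using j K by simp
    show "b' k \<in> std_grade (parity k)" if "k \<in> insert j K" for k
      using that gr v j b' bj by auto
    show "inj_on b' (insert j K)"
    proof -
      have "inj_on b' K" using inj b' by (simp add: inj_on_def)
      moreover have "v \<notin> b ` K" using v(3) vec.span_base by metis
      moreover have "K - {j} = K" using j by simp
      ultimately show ?thesis unfolding inj_on_insert by (simp add: im bj)
    qed
    show "vec.independent (b' ` insert j K)"
      using ind v(3) by (simp add: im bj vec.independent_insertI)
    show "sc_mult s w (b' k) \<in> vec.span (b' ` {i \<in> insert j K. rk' i < rk' k})"
      "sc_mult s (b' k) w \<in> vec.span (b' ` {i \<in> insert j K. rk' i < rk' k})"
      if "k \<in> insert j K" for k w
    proof -
      have "sc_mult s w (b' k) \<in> vec.span (b' ` {i \<in> insert j K. rk' i < rk' k}) \<and>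
        sc_mult s (b' k) w \<in> vec.span (b' ` {i \<in> insert j K. rk' i < rk' k})"
      proof (cases "k = j")
        case True
        show ?thesis unfolding True set2 unfolding im bj by (rule vann)
      next
        case False
        then have "k \<in> K" using that by simp
        show ?thesis unfolding set1[OF \<open>k \<in> K\<close>] unfolding im1 b'[OF \<open>k \<in> K\<close>]
          by (rule ann[OF \<open>k \<in> K\<close>])
      qed
      then show "sc_mult s w (b' k) \<in> vec.span (b' ` {i \<in> insert j K. rk' i < rk' k})"
        "sc_mult s (b' k) w \<in> vec.span (b' ` {i \<in> insert j K. rk' i < rk' k})" by simp_all
    qed
    show "rk' k < Suc n" if "k \<in> insert j K" for k
      using that rk b' bj by (auto simp: less_Suc_eq)
    show "i \<in> insert j K" "rk' i < rk' k"
      if "k \<in> insert j K" "parity i = parity k \<and> pr i < pr k" for i k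
    proof -
      have "i \<in> K \<and> rk' i < rk' k"
      proof (cases "k = j")
        case True
        then have "i \<in> K" using that(2) least[of i] j by fastforce
        then show ?thesis using True bj b' rk by simp
      next
        case False
        then have "k \<in> K" using that by simp
        then show ?thesis using ord that b' by auto
      qed
      then show "i \<in> insert j K" "rk' i < rk' k" by simp_all
    qed
  qed
qed


text \<open>The basis vectors of rank below any given bound span an ideal, and multiplication by anything
  lowers the rank.\<close>

definition adapted :: "('m + 'n \<Rightarrow> nat) \<Rightarrow> ('m::finite, 'n::finite) struct_consts \<Rightarrow> bool" where
  "adapted rk t \<longleftrightarrow> (\<forall>i j k. sc_mult t (axis i 1) (axis j 1) $ k \<noteq> 0 \<longrightarrow> rk k < rk i \<and> rk k < rk j)"

lemma graded_bijection_is_iso: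
  fixes s :: "('m::finite, 'n::finite) struct_consts"
  assumes lin: "Vector_Spaces.linear (*s) (*s) \<psi>" and inj: "inj \<psi>"
    and gr: "\<forall>p \<in> {0, 1}. \<psi> ` std_grade p \<subseteq> std_grade p"
  shows "\<exists>t. sc_iso s t \<psi>"
proof -
  obtain g h where gh: "\<psi> = block g h" using graded_linear_is_block[OF lin gr] that by metis
  have z: "block g h 0 = 0"
    using linear_block[of g h] by (metis Vector_Spaces.linear_iff vec.scale_zero_left)
  have inj': "block g h x = block g h y \<Longrightarrow> x = y" for x y using inj unfolding gh by (rule injD)
  have "x = 0" if "g *v x = 0" for x
  proof -
    let ?v = "(\<chi> k. case k of Inl i \<Rightarrow> x $ i | Inr j \<Rightarrow> 0) :: complex ^ ('m + 'n)"
    have "block g h ?v = 0"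
      using that by (intro vec_sum_eqI) (simp_all add: block_nth vec_eq_iff matrix_vector_mult_def)
    then have v: "?v = 0" using z by (metis inj')
    have "x $ i = ?v $ Inl i" for i by simp
    then show ?thesis unfolding v by (simp add: vec_eq_iff)
  qed
  then have "invertible g" unfolding invertible_left_inverse matrix_left_invertible_ker by blast
  moreover have "x = 0" if "h *v x = 0" for x
  proof -
    let ?v = "(\<chi> k. case k of Inl i \<Rightarrow> 0 | Inr j \<Rightarrow> x $ j) :: complex ^ ('m + 'n)"
    have "block g h ?v = 0"
      using that by (intro vec_sum_eqI) (simp_all add: block_nth vec_eq_iff matrix_vector_mult_def)
    then have v: "?v = 0" using z by (metis inj')
    have "x $ i = ?v $ Inr i" for i by simp
    then show ?thesis unfolding v by (simp add: vec_eq_iff)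
  qed
  then have "invertible h" unfolding invertible_left_inverse matrix_left_invertible_ker by blast
  ultimately show ?thesis using sc_iso_block unfolding gh by blast
qed

text \<open>The flag basis becomes the standard basis of an isomorphic structure.\<close>

lemma exists_adapted:
  fixes s :: "('m::finite, 'n::finite) struct_consts" and pr :: "'m + 'n \<Rightarrow> nat"
  assumes comm: "supercomm s" and nil: "left_nil N s"
  shows "\<exists>t rk. isomorphic_sc s t \<and> adapted rk t \<and> (\<forall>k. rk k < CARD('m + 'n)) \<and>
    (\<forall>j k. parity j = parity k \<and> pr j < pr k \<longrightarrow> rk j < rk k)"
proof -
  obtain K b rk where K: "card K = CARD('m + 'n)"
    and gr: "\<forall>k\<in>K. b k \<in> std_grade (parity k)" and inj: "inj_on b K" and ind: "vec.independent (b ` K)"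
    and ann: "\<forall>k\<in>K. \<forall>w. sc_mult s w (b k) \<in> vec.span (b ` {j\<in>K. rk j < rk k}) \<and>
               sc_mult s (b k) w \<in> vec.span (b ` {j\<in>K. rk j < rk k})"
    and rk: "\<forall>k\<in>K. rk k < CARD('m + 'n)"
    and ord: "\<forall>k\<in>K. \<forall>j. parity j = parity k \<and> pr j < pr k \<longrightarrow> j \<in> K \<and> rk j < (rk k :: nat)"
    using exists_flag_basis[OF comm nil order_refl, of pr] by (elim exE conjE) (rule that)
  have U: "K = UNIV" using K by (intro card_subset_eq) simp_all
  define \<psi> where "\<psi> x = (\<Sum>k\<in>UNIV. x $ k *s b k)" for x
  have lin: "Vector_Spaces.linear (*s) (*s) \<psi>"
    unfolding Vector_Spaces.linear_iff
    by (simp add: vec.vector_space_axioms \<psi>_def vec.scale_left_distrib sum.distrib vec.scale_sum_right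
        vector_smult_assoc)
  have coeffs: "x = 0" if "\<psi> x = 0" for x
  proof -
    have "(\<Sum>v\<in>range b. x $ inv b v *s v) = 0"
      using that inj unfolding U by (simp add: sum.reindex \<psi>_def)
    then have "x $ inv b (b k) = 0" for k
      using ind[unfolded U vec.independent_explicit_finite_subsets, rule_format,
          of "range b" "\<lambda>v. x $ inv b v" "b k"] by simp
    then show ?thesis using inj unfolding U by (simp add: vec_eq_iff)
  qed
  have injp: "inj \<psi>"
  proof (rule injI)
    fix x y assume "\<psi> x = \<psi> y"
    moreover have "\<psi> (x + (- 1) *s y) = \<psi> x + (- 1) *s \<psi> y"
      using lin unfolding Vector_Spaces.linear_iff by metis
    ultimately have "\<psi> (x + (- 1) *s y) = 0" by (metis add.right_inverse vector_sneg_minus1)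
    from coeffs[OF this] show "x = y" by simp
  qed
  have "\<psi> x \<in> std_grade p" if p: "p \<in> {0, 1}" and x: "x \<in> std_grade p" for p x
  proof -
    have "x $ k *s b k \<in> std_grade p" for k
    proof (cases "parity k = p")
      case True
      then have "b k \<in> std_grade p" using gr U by blast
      then show ?thesis by (auto simp: std_grade_def split: if_splits)
    next
      case False
      then have "x $ k = 0" using x p by (cases k) (auto simp: std_grade_def split: if_splits)
      then show ?thesis by simp
    qed
    moreover have "vec.subspace (std_grade p :: (complex ^ ('m + 'n)) set)"
      by (auto simp: vec.subspace_def std_grade_def)
    ultimately show ?thesis unfolding \<psi>_def by (intro vec.subspace_sum)
  qed
  then have grp: "\<forall>p\<in>{0, 1}. \<psi> ` std_grade p \<subseteq> std_grade p" by blast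
  obtain t where iso: "sc_iso t s \<psi>"
  proof -
    obtain t' where t': "sc_iso s t' \<psi>" using graded_bijection_is_iso[OF lin injp grp] by blast
    have lin': "Vector_Spaces.linear (*s) (*s) (inv \<psi>)" "inj (inv \<psi>)"
      "\<forall>p\<in>{0, 1}. inv \<psi> ` std_grade p \<subseteq> std_grade p"
      using sc_iso_inv[OF t'] by (simp_all add: sc_iso_def bij_is_inj)
    then obtain t where "sc_iso s t (inv \<psi>)" using graded_bijection_is_iso by blast
    then have "sc_iso t s (inv (inv \<psi>))" by (rule sc_iso_inv)
    moreover have "bij \<psi>" using t' by (simp add: sc_iso_def)
    ultimately show ?thesis using that by (simp add: inv_inv_eq)
  qed
  have ax: "\<psi> (axis i 1) = b i" for i
  proof -
    have "\<psi> (axis i 1) = (\<Sum>k\<in>UNIV. if i = k then b k else 0)"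
      unfolding \<psi>_def by (rule sum.cong) (auto simp: axis_def)
    then show ?thesis by simp
  qed
  have sup: "x $ k = 0" if sp: "\<psi> x \<in> vec.span (b ` L)" and k: "k \<notin> L" for x L k
  proof -
    let ?V = "\<psi> ` {y. \<forall>k. k \<notin> L \<longrightarrow> y $ k = 0}"
    have "vec.subspace ?V"
      unfolding vec.subspace_def
    proof (intro conjI ballI allI)
      show "0 \<in> ?V" by (rule image_eqI[of _ _ 0]) (simp_all add: sc_iso_zero[OF iso])
      fix x y assume "x \<in> ?V" "y \<in> ?V"
      then obtain u v where uv: "x = \<psi> u" "y = \<psi> v"
        "\<forall>k. k \<notin> L \<longrightarrow> u $ k = 0" "\<forall>k. k \<notin> L \<longrightarrow> v $ k = 0" by blast
      then show "x + y \<in> ?V"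
        by (intro image_eqI[of _ _ "u + v"]) (simp_all add: sc_iso_add[OF iso])
      show "c *s x \<in> ?V" for c
        using uv by (intro image_eqI[of _ _ "c *s u"]) (simp_all add: sc_iso_scale[OF iso])
    qed
    moreover have "b ` L \<subseteq> ?V"
    proof
      fix v assume "v \<in> b ` L"
      then obtain i where "i \<in> L" "v = \<psi> (axis i 1)" using ax by auto
      then show "v \<in> ?V" by (auto simp: axis_def)
    qed
    ultimately have "\<psi> x \<in> ?V" using sp vec.span_minimal by blast
    then obtain y where "\<psi> x = \<psi> y" "y $ k = 0" using k by auto
    then show ?thesis using injD[OF injp] by blast
  qed
  have "adapted rk t"
    unfolding adapted_def
  proof (intro allI impI)
    fix i j k
    let ?x = "sc_mult t (axis i 1) (axis j 1)"
    assume nz: "?x $ k \<noteq> 0"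
    have "\<psi> ?x = sc_mult s (b i) (b j)" by (simp add: sc_iso_mult[OF iso] ax)
    then have "\<psi> ?x \<in> vec.span (b ` {l. rk l < rk i})" "\<psi> ?x \<in> vec.span (b ` {l. rk l < rk j})"
      using ann unfolding U by simp_all
    then show "rk k < rk i \<and> rk k < rk j" using sup nz by blast
  qed
  moreover have "isomorphic_sc s t" using iso isomorphic_sc_sym isomorphic_sc_iff by blast
  ultimately show ?thesis using rk ord unfolding U by blast
qed

definition level :: "('m + 'n \<Rightarrow> nat) \<Rightarrow> nat \<Rightarrow> (complex ^ ('m::finite + 'n::finite)) set" where
  "level rk r = {x. \<forall>k. x $ k \<noteq> 0 \<longrightarrow> rk k < r}"

lemma adapted_level:
  assumes ad: "adapted rk t" and xy: "x \<in> level rk r \<or> y \<in> level rk r"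
  shows "sc_mult t x y \<in> level rk (r - 1)"
  unfolding level_def
proof (intro CollectI allI impI)
  fix k assume nz: "sc_mult t x y $ k \<noteq> 0"
  have "sc_mult t x y = (\<Sum>i\<in>UNIV. \<Sum>j\<in>UNIV. (x $ i * y $ j) *s sc_mult t (axis i 1) (axis j 1))"
    by (subst vec_expansion[of x], subst vec_expansion[of y])
       (simp only: sc_mult_sum_left sc_mult_scale_left, simp add: sc_mult_sum_right
         sc_mult_scale_right vector_smult_assoc vec.scale_sum_right)
  then have "(\<Sum>i\<in>UNIV. \<Sum>j\<in>UNIV. x $ i * y $ j * sc_mult t (axis i 1) (axis j 1) $ k) \<noteq> 0"
    using nz by simp
  then obtain i where "(\<Sum>j\<in>UNIV. x $ i * y $ j * sc_mult t (axis i 1) (axis j 1) $ k) \<noteq> 0"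
    by (meson sum.neutral)
  then obtain j where "x $ i * y $ j * sc_mult t (axis i 1) (axis j 1) $ k \<noteq> 0"
    by (meson sum.neutral)
  then have "x $ i \<noteq> 0" "y $ j \<noteq> 0" "rk k < rk i" "rk k < rk j"
    using ad by (auto simp: adapted_def)
  then show "rk k < r - 1" using xy by (fastforce simp: level_def)
qed

lemma level_subspace: "vec.subspace (level rk r)"
  unfolding vec.subspace_def level_def by auto (metis add.right_neutral)

lemma level_0: "level rk 0 = {0}"
  by (auto simp: level_def vec_eq_iff)

lemma adapted_left_nil:
  assumes ad: "adapted rk t" and rk: "\<And>k. rk k < d"
  shows "left_nil d t"
proof -
  have "term_val t env (left_term n) \<in> level rk (d - n)" for env n
  proof (induction n)
    case 0
    then show ?case using rk by (simp add: level_def)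
  next
    case (Suc n)
    then show ?case using adapted_level[OF ad, of "env (Suc n)" "d - n"] by simp
  qed
  from this[of _ d] show ?thesis unfolding left_nil_iff by (simp add: level_0)
qed

text \<open>A power \<open>J\<^sup>m\<close> with \<open>m \<ge> 2\<^sup>n\<^sup>+\<^sup>1\<close> is spanned by products with a factor in some \<open>J\<^sup>i\<close>,
  \<open>i \<ge> 2\<^sup>n\<close>, so each doubling of the exponent descends one step of the flag.\<close>

lemma adapted_nilpotent:
  assumes ad: "adapted rk t" and rk: "\<And>k. rk k < d" and iso: "sc_iso s t \<phi>"
  shows "superalgebra.nilpotent_alg (*s) (sc_mult s)"
proof -
  let ?P = "superalgebra.alg_power (*s) (sc_mult s)"
  have "?P m \<subseteq> {x. \<phi> x \<in> level rk (d - n)}" if "2 ^ n \<le> m" for n m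
    using that
  proof (induction n arbitrary: m)
    case 0
    then show ?case using rk by (auto simp: level_def)
  next
    case (Suc n)
    have "2 * 1 \<le> 2 * (2::nat) ^ n" by (rule mult_le_mono2) simp
    then obtain k where k: "m = Suc (Suc k)" using Suc.prems
      by (metis add_2_eq_Suc le_Suc_ex mult_1_right order_trans power_Suc)
    have "{sc_mult s x y | x y. x \<in> ?P (Suc k - i) \<and> y \<in> ?P (Suc i)}
        \<subseteq> {x. \<phi> x \<in> level rk (d - Suc n)}" if i: "i \<in> {0..k}" for i
    proof clarify
      fix x y assume xy: "x \<in> ?P (Suc k - i)" "y \<in> ?P (Suc i)"
      have "2 ^ n \<le> Suc k - i \<or> 2 ^ n \<le> Suc i" using Suc.prems i k by auto
      then have "\<phi> x \<in> level rk (d - n) \<or> \<phi> y \<in> level rk (d - n)" using Suc.IH xy by blast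
      then have "sc_mult t (\<phi> x) (\<phi> y) \<in> level rk (d - n - 1)" by (rule adapted_level[OF ad])
      then show "\<phi> (sc_mult s x y) \<in> level rk (d - Suc n)" by (simp add: sc_iso_mult[OF iso])
    qed
    moreover have "vec.subspace {x. \<phi> x \<in> level rk (d - Suc n)}"
      using level_subspace[of rk "d - Suc n"]
      by (simp add: vec.subspace_def sc_iso_zero[OF iso] sc_iso_add[OF iso] sc_iso_scale[OF iso])
    ultimately show ?case
      unfolding k alg_power_simps by (intro vec.span_minimal UN_least)
  qed
  then have "?P (2 ^ d) \<subseteq> {x. \<phi> x \<in> level rk (d - d)}" by blast
  also have "\<dots> \<subseteq> {0}"
    using iso sc_iso_zero[OF iso] unfolding sc_iso_def by (auto simp: level_0) (metis bij_is_inj injD)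
  finally have "?P (2 ^ d) \<subseteq> {0}" .
  moreover have "0 \<in> ?P (Suc n)" for n
    by (cases n) (simp_all add: alg_power_simps vec.span_zero)
  from this[of "2 ^ d - 1"] have "0 \<in> ?P (2 ^ d)" by simp
  ultimately have "?P (2 ^ d) = {0}" by blast
  then show ?thesis
    unfolding superalgebra.nilpotent_alg_def[OF superalgebra_sc_mult]
    by (intro exI[of _ "2 ^ d"]) simp
qed

text \<open>Along a flag as many left multiplications as the dimension give zero, which turns
  nilpotency into identities of bounded length.\<close>

lemma NJS_iff:
  fixes s :: "('m::finite, 'n::finite) struct_consts"
  shows "s \<in> NJS \<longleftrightarrow> supercomm s \<and> jordan_identity s \<and> left_nil CARD('m + 'n) s"
proof -
  have "left_nil CARD('m + 'n) s \<and> superalgebra.nilpotent_alg (*s) (sc_mult s)"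
    if nil: "supercomm s" "left_nil N s" for N
  proof -
    obtain t rk where t: "isomorphic_sc s t" "adapted rk t" "\<forall>k. rk k < CARD('m + 'n)"
      using exists_adapted[OF nil] by blast
    then have "left_nil CARD('m + 'n) t" using adapted_left_nil by blast
    then have "left_nil CARD('m + 'n) s"
      using law_isomorphic[OF isomorphic_sc_sym[OF t(1)]] unfolding left_nil_def by blast
    moreover obtain \<phi> where "sc_iso s t \<phi>" using t(1) isomorphic_sc_iff by blast
    ultimately show ?thesis using adapted_nilpotent t(2,3) by blast
  qed
  then show ?thesis using nilpotent_imp_left_nil NJS_iff_nilpotent by blast
qed

lemma NJS_isomorphic: "isomorphic_sc s t \<Longrightarrow> s \<in> NJS \<Longrightarrow> t \<in> NJS"
  unfolding NJS_iff supercomm_law jordan_identity_def left_nil_def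
  using law_isomorphic by blast

text \<open>All conditions in \<open>NJS_iff\<close> are identities, so the variety is the intersection of the closed sets
  of those identities that hold on it.\<close>

lemma zariski_closed_NJS: "zariski_closed (NJS :: ('m::finite, 'n::finite) struct_consts set)"
proof -
  have "(NJS :: ('m, 'n) struct_consts set) = \<Inter>{{s. law par L s} | par L. (NJS :: ('m, 'n) struct_consts set) \<subseteq> {s. law par L s}}"
  proof (intro equalityI subsetI)
    fix s :: "('m, 'n) struct_consts"
    assume s: "s \<in> \<Inter>{{s. law par L s} | par L. (NJS :: ('m, 'n) struct_consts set) \<subseteq> {s. law par L s}}"
    have law: "law par L s" if "\<And>t :: ('m, 'n) struct_consts. t \<in> NJS \<Longrightarrow> law par L t" for par L
      using s that by blast
    show "s \<in> NJS"
      unfolding NJS_iff supercomm_law jordan_identity_def left_nil_def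
      by (intro conjI ballI allI; rule law;
          simp only: NJS_iff supercomm_law jordan_identity_def left_nil_def)
  qed blast
  note eq = this
  show ?thesis
    by (subst eq, rule zariski_closed_INT) (auto simp: zariski_closed_law)
qed

section \<open>Coordinates in type (2,3)\<close>

definition vec5 :: "complex \<Rightarrow> complex \<Rightarrow> complex \<Rightarrow> complex \<Rightarrow> complex \<Rightarrow> complex ^ (2 + 3)" where
  "vec5 x1 x2 y1 y2 y3 = (\<chi> k. case k of Inl i \<Rightarrow> if i = 1 then x1 else x2
     | Inr j \<Rightarrow> if j = 1 then y1 else if j = 2 then y2 else y3)"

lemma vec5_nth [simp]:
  "vec5 x1 x2 y1 y2 y3 $ Inl 1 = x1" "vec5 x1 x2 y1 y2 y3 $ Inl 2 = x2"
  "vec5 x1 x2 y1 y2 y3 $ Inr 1 = y1" "vec5 x1 x2 y1 y2 y3 $ Inr 2 = y2"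
  "vec5 x1 x2 y1 y2 y3 $ Inr 3 = y3"
  by (simp_all add: vec5_def)

lemma eq_5_iff:
  "(x :: complex ^ (2 + 3)) = y \<longleftrightarrow> x $ Inl 1 = y $ Inl 1 \<and> x $ Inl 2 = y $ Inl 2 \<and>
     x $ Inr 1 = y $ Inr 1 \<and> x $ Inr 2 = y $ Inr 2 \<and> x $ Inr 3 = y $ Inr 3"
proof -
  have "x = y \<longleftrightarrow> (\<forall>i. x $ Inl i = y $ Inl i) \<and> (\<forall>j. x $ Inr j = y $ Inr j)"
    using vec_sum_eqI[of x y] by blast
  then show ?thesis by (simp add: forall_2 forall_3)
qed

lemma vec5_eq_iff [simp]:
  "vec5 x1 x2 y1 y2 y3 = vec5 x1' x2' y1' y2' y3' \<longleftrightarrow>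
     x1 = x1' \<and> x2 = x2' \<and> y1 = y1' \<and> y2 = y2' \<and> y3 = y3'"
  "vec5 x1 x2 y1 y2 y3 = 0 \<longleftrightarrow> x1 = 0 \<and> x2 = 0 \<and> y1 = 0 \<and> y2 = 0 \<and> y3 = 0"
  by (simp_all add: eq_5_iff)

lemma vec5_exhaust: obtains x1 x2 y1 y2 y3 where "x = vec5 x1 x2 y1 y2 y3"
  by (rule that[of "x $ Inl 1" "x $ Inl 2" "x $ Inr 1" "x $ Inr 2" "x $ Inr 3"])
     (simp add: eq_5_iff)

lemma vec5_arith [simp]:
  "vec5 x1 x2 y1 y2 y3 + vec5 x1' x2' y1' y2' y3' = vec5 (x1 + x1') (x2 + x2') (y1 + y1') (y2 + y2') (y3 + y3')"
  "vec5 x1 x2 y1 y2 y3 - vec5 x1' x2' y1' y2' y3' = vec5 (x1 - x1') (x2 - x2') (y1 - y1') (y2 - y2') (y3 - y3')"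
  "- vec5 x1 x2 y1 y2 y3 = vec5 (- x1) (- x2) (- y1) (- y2) (- y3)"
  "a *s vec5 x1 x2 y1 y2 y3 = vec5 (a * x1) (a * x2) (a * y1) (a * y2) (a * y3)"
  by (simp_all add: eq_5_iff)

lemma grade_0_vec5: "x \<in> std_grade 0 \<longleftrightarrow> (\<exists>x1 x2. x = vec5 x1 x2 0 0 0)"
  by (cases x rule: vec5_exhaust) (simp add: std_grade_0 forall_3)

lemma grade_1_vec5: "x \<in> std_grade (Suc 0) \<longleftrightarrow> (\<exists>y1 y2 y3. x = vec5 0 0 y1 y2 y3)"
  by (cases x rule: vec5_exhaust) (simp add: std_grade_Suc_0 forall_2)

lemma all_grade_0: "(\<forall>x\<in>std_grade 0. P x) \<longleftrightarrow> (\<forall>x1 x2. P (vec5 x1 x2 0 0 0))"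
  and all_grade_1: "(\<forall>x\<in>std_grade (Suc 0). P x) \<longleftrightarrow> (\<forall>y1 y2 y3. P (vec5 0 0 y1 y2 y3))"
  by (auto simp: grade_0_vec5 grade_1_vec5)

text \<open>The structures \<open>e\<^sub>1\<^sup>2 = c e\<^sub>2\<close>, \<open>e\<^sub>1 f\<^sub>3 = a f\<^sub>2 + b f\<^sub>1\<close>, \<open>e\<^sub>1 f\<^sub>2 = d f\<^sub>1\<close>, \<open>e\<^sub>2 f\<^sub>3 = A f\<^sub>2 + B f\<^sub>1\<close>,
  \<open>e\<^sub>2 f\<^sub>2 = D f\<^sub>1\<close>, \<open>f\<^sub>2 f\<^sub>3 = p\<close>, \<open>f\<^sub>1 f\<^sub>3 = q\<close>, \<open>f\<^sub>1 f\<^sub>2 = r\<close> with \<open>p = p\<^sub>1 e\<^sub>1 + p\<^sub>2 e\<^sub>2\<close> and so on.\<close>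

definition tri :: "complex \<Rightarrow> complex \<Rightarrow> complex \<Rightarrow> complex \<Rightarrow> complex \<Rightarrow> complex \<Rightarrow> complex
    \<Rightarrow> complex \<Rightarrow> complex \<Rightarrow> complex \<Rightarrow> complex \<Rightarrow> complex \<Rightarrow> complex \<Rightarrow> (2, 3) struct_consts" where
  "tri c a b d A B D p1 p2 q1 q2 r1 r2 = make_sc
     (\<lambda>i j k. if (i, j, k) = (1, 1, 2) then c else 0)
     (\<lambda>i j k. if (i, j, k) = (1, 3, 2) then a else if (i, j, k) = (1, 3, 1) then b
        else if (i, j, k) = (1, 2, 1) then d else if (i, j, k) = (2, 3, 2) then A
        else if (i, j, k) = (2, 3, 1) then B else if (i, j, k) = (2, 2, 1) then D else 0)
     (\<lambda>i j k. let v = (\<lambda>u1 u2. if k = 1 then u1 else u2) in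
        if (i, j) = (2, 3) then v p1 p2 else if (i, j) = (3, 2) then - v p1 p2
        else if (i, j) = (1, 3) then v q1 q2 else if (i, j) = (3, 1) then - v q1 q2
        else if (i, j) = (1, 2) then v r1 r2 else if (i, j) = (2, 1) then - v r1 r2 else 0)"

lemma tri_mult [simp]:
  "sc_mult (tri c a b d A B D p1 p2 q1 q2 r1 r2) (vec5 x1 x2 y1 y2 y3) (vec5 x1' x2' y1' y2' y3') =
    vec5 (p1 * (y2 * y3' - y3 * y2') + q1 * (y1 * y3' - y3 * y1') + r1 * (y1 * y2' - y2 * y1'))
      (c * (x1 * x1') + p2 * (y2 * y3' - y3 * y2') + q2 * (y1 * y3' - y3 * y1') + r2 * (y1 * y2' - y2 * y1'))
      (b * (x1 * y3' + x1' * y3) + d * (x1 * y2' + x1' * y2) + B * (x2 * y3' + x2' * y3) + D * (x2 * y2' + x2' * y2))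
      (a * (x1 * y3' + x1' * y3) + A * (x2 * y3' + x2' * y3)) 0"
  by (simp add: eq_5_iff sc_mult_Inl sc_mult_Inr sum_2 sum_3 tri_def make_sc_def algebra_simps)

lemma make_sc_cong:
  "(\<forall>i j k. c i j k = c' i j k) \<and> (\<forall>i j k. r i j k = r' i j k) \<and> (\<forall>i j k. g i j k = g' i j k) \<Longrightarrow>
     make_sc c r g = make_sc c' r' g'"
  by (intro sc_eqI) (simp_all add: make_sc_def)

lemma alg15_tri: "alg15 = tri 0 0 0 1 1 0 0 0 0 0 0 0 0"
  unfolding alg15_def tri_def by (rule make_sc_cong) (simp add: forall_2 forall_3)

lemma alg31_tri: "alg31 l = tri 1 0 0 1 0 0 0 1 0 0 l 0 0"
  unfolding alg31_def tri_def by (rule make_sc_cong) (simp add: forall_2 forall_3)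

lemma alg33_tri: "alg33 = tri 1 1 0 1 0 0 0 0 0 0 1 0 0"
  unfolding alg33_def tri_def by (rule make_sc_cong) (simp add: forall_2 forall_3)

lemma alg41_tri: "alg41 = tri 1 0 1 0 0 0 1 1 0 0 0 0 0"
  unfolding alg41_def tri_def by (rule make_sc_cong) (simp add: forall_2 forall_3)

lemma alg44_mult [simp]:
  "sc_mult (alg44 l) (vec5 x1 x2 y1 y2 y3) (vec5 x1' x2' y1' y2' y3') =
    vec5 0 (x1 * x1' + (y2 * y3' - y3 * y2')) (l * (x1 * y3' + x1' * y3) + (x2 * y2' + x2' * y2)) 0
      (x1 * y2' + x1' * y2)"
  by (simp add: eq_5_iff sc_mult_Inl sc_mult_Inr sum_2 sum_3 alg44_def make_sc_def algebra_simps)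

definition mat2 :: "complex \<Rightarrow> complex \<Rightarrow> complex \<Rightarrow> complex \<Rightarrow> complex ^ 2 ^ 2" where
  "mat2 a b c d = (\<chi> i j. if i = 1 then if j = 1 then a else b else if j = 1 then c else d)"

definition mat3 :: "complex \<Rightarrow> complex \<Rightarrow> complex \<Rightarrow> complex \<Rightarrow> complex \<Rightarrow> complex \<Rightarrow> complex \<Rightarrow> complex
    \<Rightarrow> complex \<Rightarrow> complex ^ 3 ^ 3" where
  "mat3 a b c d e f g h i = (\<chi> k l. if k = 1 then if l = 1 then a else if l = 2 then b else c
     else if k = 2 then if l = 1 then d else if l = 2 then e else f
     else if l = 1 then g else if l = 2 then h else i)"

lemma block_vec5 [simp]:
  "block (mat2 a b c d) (mat3 a' b' c' d' e' f' g' h' i') (vec5 x1 x2 y1 y2 y3) =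
     vec5 (a * x1 + b * x2) (c * x1 + d * x2)
       (a' * y1 + b' * y2 + c' * y3) (d' * y1 + e' * y2 + f' * y3) (g' * y1 + h' * y2 + i' * y3)"
  by (simp add: eq_5_iff block_nth sum_2 sum_3 mat2_def mat3_def)

text \<open>The columns of the two matrices are the coordinates, in the algebra \<open>s\<close>, of a basis whose
  multiplication table is that of \<open>t\<close>.\<close>

lemma isomorphic_by_basis:
  fixes s t :: "(2, 3) struct_consts"
  assumes g: "g = mat2 a b c d" and h: "h = mat3 a' b' c' d' e' f' g' h' i'"
    and det: "a * d - b * c \<noteq> 0"
      "a' * e' * i' + b' * f' * g' + c' * d' * h' - a' * f' * h' - b' * d' * i' - c' * e' * g' \<noteq> 0"
    and hom: "\<And>x1 x2 y1 y2 y3 z1 z2 w1 w2 w3.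
      sc_mult s (block g h (vec5 x1 x2 y1 y2 y3)) (block g h (vec5 z1 z2 w1 w2 w3))
        = block g h (sc_mult t (vec5 x1 x2 y1 y2 y3) (vec5 z1 z2 w1 w2 w3))"
  shows "isomorphic_sc s t"
proof -
  have inv: "invertible g" "invertible h"
    using det by (simp_all add: g h invertible_det_nz det_2 det_3 mat2_def mat3_def)
  have "block g h (sc_mult t x y) = sc_mult s (block g h x) (block g h y)" for x y
    by (cases x rule: vec5_exhaust; cases y rule: vec5_exhaust) (simp only: hom)
  then have "sc_iso t s (block g h)"
    unfolding sc_iso_def using linear_block bij_block[OF inv] block_grade by blast
  then show ?thesis using isomorphic_sc_iff isomorphic_sc_sym by blast
qed

lemma tendsto_if:
  "(P \<Longrightarrow> (f \<longlongrightarrow> a) F) \<Longrightarrow> (\<not> P \<Longrightarrow> (g \<longlongrightarrow> b) F) \<Longrightarrow>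
     ((\<lambda>t. if P then f t else g t) \<longlongrightarrow> (if P then a else b)) F"
  by simp

lemma tendsto_tri:
  assumes "(c \<longlongrightarrow> c') F" "(a \<longlongrightarrow> a') F" "(b \<longlongrightarrow> b') F" "(d \<longlongrightarrow> d') F" "(A \<longlongrightarrow> A') F"
    "(B \<longlongrightarrow> B') F" "(D \<longlongrightarrow> D') F" "(p1 \<longlongrightarrow> p1') F" "(p2 \<longlongrightarrow> p2') F" "(q1 \<longlongrightarrow> q1') F"
    "(q2 \<longlongrightarrow> q2') F" "(r1 \<longlongrightarrow> r1') F" "(r2 \<longlongrightarrow> r2') F"
  shows "((\<lambda>t. tri (c t) (a t) (b t) (d t) (A t) (B t) (D t) (p1 t) (p2 t) (q1 t) (q2 t) (r1 t) (r2 t))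
    \<longlongrightarrow> tri c' a' b' d' A' B' D' p1' p2' q1' q2' r1' r2') F"
proof (rule vec_tendstoI)
  fix k
  show "((\<lambda>t. tri (c t) (a t) (b t) (d t) (A t) (B t) (D t) (p1 t) (p2 t) (q1 t) (q2 t) (r1 t) (r2 t) $ k)
    \<longlongrightarrow> tri c' a' b' d' A' B' D' p1' p2' q1' q2' r1' r2' $ k) F"
    unfolding tri_def make_sc_def Let_def vec_lambda_beta
    by (cases k; (cases "projl k")?; (cases "projr k")?; (cases "projl (projr k)")?; (cases "projr (projr k)")?;
        simp only: sum.case prod.case sum.sel;
        intro tendsto_if tendsto_const tendsto_minus assms)
qed

section \<open>Generic members of the five families\<close>

text \<open>\<open>E\<^sub>1 = A e\<^sub>1 - a e\<^sub>2\<close> is the combination for which \<open>E\<^sub>1 f\<^sub>3\<close> has no \<open>f\<^sub>2\<close>, and \<open>E\<^sub>2 = D e\<^sub>1 - d e\<^sub>2\<close> the one with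
  \<open>E\<^sub>2 f\<^sub>2 = 0\<close>.  Then \<open>F\<^sub>3\<close> is \<open>f\<^sub>3\<close> corrected by \<open>f\<^sub>2\<close> so that \<open>E\<^sub>1 F\<^sub>3 = 0\<close>, scaled by \<open>\<Delta>\<close> to avoid
  a denominator, and \<open>F\<^sub>2 = E\<^sub>2 F\<^sub>3\<close>, \<open>F\<^sub>1 = E\<^sub>1 F\<^sub>2\<close>.\<close>

lemma generic_15:
  assumes "a * D - A * d \<noteq> 0"
  shows "isomorphic_sc (tri 0 a b d A B D 0 0 0 0 0 0) alg15"
proof -
  define \<Delta> where "\<Delta> = a * D - A * d"
  have nz: "\<Delta> \<noteq> 0" using assms by (simp add: \<Delta>_def)
  show ?thesis
    unfolding alg15_tri
    by (rule isomorphic_by_basis[where g = "mat2 A D (- a) (- d)" and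
          h = "mat3 (- (\<Delta> ^ 3)) (\<Delta> * (D * b - d * B)) 0 0 (\<Delta> ^ 2) (A * b - a * B) 0 0 \<Delta>", OF refl refl];
        (simp add: nz; fail)?;
        use assms in \<open>simp add: \<Delta>_def algebra_simps power2_eq_square power3_eq_cube\<close>)
qed

text \<open>Here \<open>F\<^sub>2\<close> is a multiple of \<open>f\<^sub>3\<close> and the rest of the basis is forced: \<open>F\<^sub>3 = E\<^sub>1 F\<^sub>2\<close>, \<open>E\<^sub>2 = E\<^sub>1\<^sup>2\<close>,
  \<open>F\<^sub>1 = E\<^sub>2 F\<^sub>2\<close>.  The factor \<open>\<epsilon>\<close> in \<open>E\<^sub>1 = \<epsilon> e\<^sub>1\<close> is determined by \<open>F\<^sub>2 F\<^sub>3 = E\<^sub>2\<close>.\<close>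

lemma generic_44:
  assumes "c \<noteq> 0" "a \<noteq> 0" "B \<noteq> 0" "p2 \<noteq> 0"
  shows "isomorphic_sc (tri c a b d 0 B 0 0 p2 0 0 0 0) (alg44 (a * d / (c * B)))"
proof -
  define \<epsilon> where "\<epsilon> = - c * a * p2"
  define \<phi> where "\<phi> = a * d / (c * B)"
  have nz: "\<epsilon> \<noteq> 0" using assms by (simp add: \<epsilon>_def)
  have \<phi>: "\<phi> * c * B = a * d" using assms by (simp add: \<phi>_def)
  show ?thesis
    unfolding \<phi>_def[symmetric]
    by (rule isomorphic_by_basis[where g = "mat2 \<epsilon> 0 0 (\<epsilon> ^ 2 * c)" and
          h = "mat3 (\<epsilon> ^ 2 * c ^ 2 * B) 0 (\<epsilon> * c * b) 0 0 (\<epsilon> * c * a) 0 c 0", OF refl refl];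
        (simp add: nz assms; fail)?; simp; (intro conjI)?; (simp add: algebra_simps; fail)?; use \<phi> \<epsilon>_def in algebra)
qed

text \<open>With \<open>F\<^sub>3 = \<beta> f\<^sub>3 + \<gamma> f\<^sub>2\<close>, \<open>F\<^sub>2 = e\<^sub>1 F\<^sub>3\<close> and \<open>F\<^sub>1 = e\<^sub>1 F\<^sub>2\<close>, the condition \<open>F\<^sub>2 F\<^sub>3 = 0\<close>
  determines \<open>\<gamma>\<close> and \<open>F\<^sub>1 F\<^sub>3 = e\<^sub>1\<^sup>2\<close> determines \<open>\<beta>\<close> up to sign.\<close>

lemma generic_33:
  assumes "c \<noteq> 0" "a \<noteq> 0" "d \<noteq> 0" "q2 \<noteq> 0"
  shows "isomorphic_sc (tri c a b d 0 0 0 0 p2 0 q2 0 0) alg33"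
proof -
  define \<beta> where "\<beta> = csqrt (c / (a * d * q2))"
  define \<gamma> where "\<gamma> = - \<beta> * (a * p2 + b * q2) / (d * q2)"
  have "\<beta> ^ 2 = c / (a * d * q2)" by (simp add: \<beta>_def)
  then have \<beta>: "c = \<beta> * \<beta> * (a * d * q2)" using assms by (simp add: power2_eq_square)
  then have nz: "\<beta> \<noteq> 0" using assms by auto
  have \<gamma>: "\<gamma> * d * q2 + \<beta> * a * p2 + \<beta> * b * q2 = 0" using assms by (simp add: \<gamma>_def field_simps)
  show ?thesis
    unfolding alg33_tri
    by (rule isomorphic_by_basis[where g = "mat2 1 0 0 c" and
          h = "mat3 (\<beta> * a * d) (\<beta> * b + \<gamma> * d) 0 0 (\<beta> * a) \<gamma> 0 0 \<beta>", OF refl refl];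
        (simp add: nz assms; fail)?; simp; (intro conjI)?; (simp add: algebra_simps; fail)?; use \<beta> \<gamma> in algebra)
qed

text \<open>\<open>E\<^sub>1\<close> must be proportional to \<open>f\<^sub>2 f\<^sub>3\<close>, and in the span of \<open>f\<^sub>2, f\<^sub>3\<close> the vector \<open>F\<^sub>2\<close> is annihilated
  by \<open>E\<^sub>1\<close> and \<open>F\<^sub>3\<close> by \<open>e\<^sub>2\<close>.  The factor \<open>\<mu>\<close> of \<open>F\<^sub>2\<close> is adjusted to make \<open>E\<^sub>1 F\<^sub>3 = E\<^sub>2 F\<^sub>2\<close>.\<close>

lemma generic_41:
  assumes "c \<noteq> 0" "p1 \<noteq> 0" "b * D - d * B \<noteq> 0"
  shows "isomorphic_sc (tri c 0 b d 0 B D p1 p2 0 0 0 0) alg41"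
proof -
  define \<delta> where "\<delta> = p1 * (b * D - d * B)"
  define \<mu> where "\<mu> = csqrt (1 / (\<delta> * p1 ^ 2 * c))"
  define \<kappa> where "\<kappa> = - \<mu> * \<delta>"
  have \<delta>: "\<delta> \<noteq> 0" using assms by (simp add: \<delta>_def)
  have "\<mu> ^ 2 = 1 / (\<delta> * p1 ^ 2 * c)" by (simp add: \<mu>_def)
  then have \<mu>: "\<mu> * \<mu> * (\<delta> * p1 * p1 * c) = 1" using assms \<delta> by (simp add: power2_eq_square)
  then have nz: "\<mu> \<noteq> 0" "\<kappa> \<noteq> 0" using \<delta> by (auto simp: \<kappa>_def)
  have det: "(- \<kappa> * \<delta>) * (\<mu> * (p1 * b + p2 * B)) * (- D) - (- \<kappa> * \<delta>) * B * (- (\<mu> * (p1 * d + p2 * D))) \<noteq> 0"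
  proof -
    have "(- \<kappa> * \<delta>) * (\<mu> * (p1 * b + p2 * B)) * (- D) - (- \<kappa> * \<delta>) * B * (- (\<mu> * (p1 * d + p2 * D)))
        = \<kappa> * \<delta> * \<mu> * \<delta>"
      unfolding \<delta>_def by (simp add: algebra_simps)
    then show ?thesis using nz \<delta> by simp
  qed
  show ?thesis
    unfolding alg41_tri
    by (rule isomorphic_by_basis[where g = "mat2 (\<kappa> * p1) 0 (\<kappa> * p2) (\<kappa> ^ 2 * p1 ^ 2 * c)" and
          h = "mat3 (- \<kappa> * \<delta>) 0 0 0 (\<mu> * (p1 * b + p2 * B)) B 0 (- (\<mu> * (p1 * d + p2 * D))) (- D)",
          OF refl refl];
        (simp add: nz assms; fail)?; (use det in simp; fail)?; simp; (intro conjI)?; (simp add: algebra_simps; fail)?;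
        use \<mu> \<kappa>_def \<delta>_def in algebra)
qed

text \<open>In the span of \<open>f\<^sub>2, f\<^sub>3\<close> the vector \<open>F\<^sub>2\<close> is annihilated by \<open>f\<^sub>1\<close> and \<open>F\<^sub>3\<close> by \<open>e\<^sub>1\<close>; then
  \<open>E\<^sub>1 = F\<^sub>2 F\<^sub>3\<close> and \<open>F\<^sub>1 = E\<^sub>1 F\<^sub>2\<close>, and the parameter is the ratio of \<open>F\<^sub>1 F\<^sub>3\<close> to \<open>E\<^sub>1\<^sup>2\<close>.\<close>

lemma generic_31:
  assumes "c \<noteq> 0" "p1 \<noteq> 0" "d * q2 - b * r2 \<noteq> 0"
  shows "isomorphic_sc (tri c 0 b d 0 0 0 p1 p2 0 q2 0 r2) (alg31 ((d * q2 - b * r2) / (p1 * c)))"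
proof -
  define \<kappa> where "\<kappa> = d * q2 - b * r2"
  define \<Lambda> where "\<Lambda> = \<kappa> / (p1 * c)"
  have nz: "\<kappa> \<noteq> 0" using assms by (simp add: \<kappa>_def)
  have \<Lambda>: "\<Lambda> * p1 * c = \<kappa>" using assms by (simp add: \<Lambda>_def)
  have E: "\<kappa> ^ 2 * p1 ^ 2 * c * (X + \<Lambda> * Y) = \<kappa> ^ 2 * p1 ^ 2 * c * X + \<kappa> ^ 3 * p1 * Y" for X Y
  proof -
    have "\<kappa> ^ 2 * p1 ^ 2 * c * (\<Lambda> * Y) = \<kappa> ^ 2 * p1 * (\<Lambda> * p1 * c) * Y"
      by (simp add: power2_eq_square)
    also have "\<dots> = \<kappa> ^ 3 * p1 * Y"
      unfolding \<Lambda> by (simp add: power2_eq_square power3_eq_cube)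
    finally show ?thesis by (simp add: distrib_left)
  qed
  have det: "q2 * d - (- b) * (- r2) \<noteq> 0" using assms by (simp add: mult.commute)
  show ?thesis
    unfolding \<kappa>_def[symmetric] \<Lambda>_def[symmetric] alg31_tri
    by (rule isomorphic_by_basis[where g = "mat2 (\<kappa> * p1) 0 (\<kappa> * p2) (\<kappa> ^ 2 * p1 ^ 2 * c)" and
          h = "mat3 (\<kappa> ^ 2 * p1) 0 0 0 q2 (- b) 0 (- r2) d", OF refl refl];
        (simp add: nz assms; fail)?; (use det nz assms in \<open>simp flip: right_diff_distrib mult.assoc\<close>; fail)?;
        simp; (intro conjI)?; (simp add: algebra_simps; fail)?; (simp only: E)?; simp add: \<kappa>_def algebra_simps power2_eq_square power3_eq_cube)
qed

section \<open>Changes of basis between patterns\<close>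

text \<open>When \<open>e\<^sub>2\<close> acts with rank one, its image can be taken as the line of \<open>f\<^sub>1\<close>.\<close>

lemma change_image_line_e2:
  assumes "A \<noteq> 0"
  shows "isomorphic_sc (tri c a b 0 A B 0 0 0 0 0 0 0) (tri c (b - a * B / A) (a / A) 0 0 1 0 0 0 0 0 0 0)"
  by (rule isomorphic_by_basis[where g = "mat2 1 0 0 1" and h = "mat3 B 1 0 A 0 0 0 0 1", OF refl refl])
     (use assms in \<open>simp_all add: field_simps\<close>)

text \<open>The same with \<open>e\<^sub>1\<close> in place of \<open>e\<^sub>2\<close>: the new \<open>f\<^sub>1\<close> is \<open>e\<^sub>1 f\<^sub>3\<close>.\<close>

lemma change_image_line_e1:
  assumes "a \<noteq> 0"
  shows "isomorphic_sc (tri c a b 0 0 0 0 0 p2 0 q2 0 r2)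
    (tri c 0 1 0 0 0 0 0 q2 0 (a * p2 + b * q2) 0 (- a * r2))"
  by (rule isomorphic_by_basis[where g = "mat2 1 0 0 1" and h = "mat3 b 1 0 a 0 0 0 0 1", OF refl refl])
     (use assms in \<open>simp_all add: algebra_simps\<close>)

text \<open>The \<open>e\<^sub>1\<close>-component of the odd product is an alternating form in three variables, so it has a
  nonzero kernel vector, which is taken as the new \<open>f\<^sub>1\<close>.  Unless the form is zero, this vector is
  \<open>p\<^sub>1 f\<^sub>1 - q\<^sub>1 f\<^sub>2 + r\<^sub>1 f\<^sub>3\<close>.\<close>

lemma kernel_of_form:
  "\<exists>p1' p2' q2' r2'. isomorphic_sc (tri c 0 0 0 0 0 0 p1 p2 q1 q2 r1 r2) (tri c 0 0 0 0 0 0 p1' p2' 0 q2' 0 r2')"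
proof -
  consider "p1 \<noteq> 0" | "p1 = 0" "q1 \<noteq> 0" | "p1 = 0" "q1 = 0" "r1 \<noteq> 0" | "q1 = 0" "r1 = 0" by blast
  then show ?thesis
  proof cases
    case 1
    have "isomorphic_sc (tri c 0 0 0 0 0 0 p1 p2 q1 q2 r1 r2)
      (tri c 0 0 0 0 0 0 p1 p2 0 (p1 * q2 - q1 * p2) 0 (p1 * r2 - r1 * p2))"
      by (rule isomorphic_by_basis[where g = "mat2 1 0 0 1" and
            h = "mat3 p1 0 0 (- q1) 1 0 r1 0 1", OF refl refl])
         (use 1 in \<open>simp_all add: algebra_simps\<close>)
    then show ?thesis by blast
  next
    case 2
    have "isomorphic_sc (tri c 0 0 0 0 0 0 p1 p2 q1 q2 r1 r2)
      (tri c 0 0 0 0 0 0 q1 q2 0 (- q1 * p2) 0 (q1 * r2 - r1 * q2))"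
      by (rule isomorphic_by_basis[where g = "mat2 1 0 0 1" and
            h = "mat3 0 1 0 (- q1) 0 0 r1 0 1", OF refl refl])
         (use 2 in \<open>simp_all add: algebra_simps\<close>)
    then show ?thesis by blast
  next
    case 3
    have "isomorphic_sc (tri c 0 0 0 0 0 0 p1 p2 q1 q2 r1 r2)
      (tri c 0 0 0 0 0 0 r1 r2 0 (- p2) 0 (- q2))"
      by (rule isomorphic_by_basis[where g = "mat2 1 0 0 1" and
            h = "mat3 0 1 0 0 0 1 1 0 0", OF refl refl])
         (use 3 in \<open>simp_all add: algebra_simps\<close>)
    then show ?thesis by blast
  next
    case 4
    then show ?thesis using isomorphic_sc_refl by blast
  qed
qed

section \<open>Irreducibility of a line of orbits\<close>

lemma rational_away_det:
  assumes "\<And>i j. rational_away D (\<lambda>t. M t $ i $ j)"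
  shows "rational_away D (\<lambda>t. det (M t :: complex ^ 'n::finite ^ 'n))"
  unfolding det_def
  by (intro rational_away_sum rational_away_mult rational_away_const rational_away_prod assms)

lemma rational_away_one: "rational_away 1 f \<longleftrightarrow> (\<exists>P. f = poly P)"
  by (auto simp: rational_away_def fun_eq_iff)

lemma det_of_line:
  fixes g g' :: "complex ^ 'n::finite ^ 'n"
  shows "\<exists>D. \<forall>t. det (\<chi> i j. g $ i $ j + t * (g' $ i $ j - g $ i $ j)) = poly D t"
proof -
  have "rational_away 1 (\<lambda>t. (\<chi> i j. g $ i $ j + t * (g' $ i $ j - g $ i $ j)) $ i $ j)" for i j
    unfolding rational_away_one by (intro exI[of _ "[:g $ i $ j, g' $ i $ j - g $ i $ j:]"]) auto
  then have "rational_away 1 (\<lambda>t. det (\<chi> i j. g $ i $ j + t * (g' $ i $ j - g $ i $ j)))"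
    by (rule rational_away_det)
  then show ?thesis unfolding rational_away_one fun_eq_iff .
qed

lemma matrix_inv_entry:
  fixes A :: "complex ^ 'n::finite ^ 'n"
  assumes "det A \<noteq> 0"
  shows "matrix_inv A $ i $ j = det (\<chi> k l. if l = i then (if k = j then 1 else 0) else A $ k $ l) / det A"
proof -
  have inv: "invertible A" using assms by (simp add: invertible_det_nz)
  have "A *v (matrix_inv A *v axis j 1) = axis j 1"
    by (simp only: matrix_vector_mul_assoc matrix_inv_mult[OF inv] matrix_vector_mul_lid)
  then have "matrix_inv A *v axis j 1 = (\<chi> i. det (\<chi> k l. if l = i then axis j 1 $ k else A $ k $ l) / det A)"
    by (simp only: cramer[OF assms])
  moreover have "(matrix_inv A *v axis j 1) $ i = matrix_inv A $ i $ j"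
  proof -
    have "(matrix_inv A *v axis j 1) $ i = (\<Sum>k\<in>UNIV. if k = j then matrix_inv A $ i $ k else 0)"
      unfolding matrix_vector_mult_def vec_lambda_beta by (rule sum.cong) (auto simp: axis_def)
    then show ?thesis by simp
  qed
  ultimately show ?thesis by (simp add: axis_def cong: if_cong)
qed

text \<open>Two points of the family are joined by letting the two matrices and the parameter move
  along straight lines; by Cramer's rule the action depends rationally on the time.\<close>

lemma irreducible_orbits:
  fixes u v :: "('m::finite, 'n::finite) struct_consts"
  assumes R: "R \<noteq> 0"
  shows "irreducible_in zariski (\<Union>l\<in>{l. poly R l \<noteq> 0}. orbit (u + l *s v))"
proof (rule irreducible_by_rational_curves)
  have "\<exists>l. poly R l \<noteq> 0" using R poly_all_0_iff_0 by blast
  then show "(\<Union>l\<in>{l. poly R l \<noteq> 0}. orbit (u + l *s v)) \<noteq> {}"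
    using isomorphic_sc_refl by (auto simp: orbit_eq)
next
  let ?S = "\<Union>l\<in>{l. poly R l \<noteq> 0}. orbit (u + l *s v)"
  fix x y assume "x \<in> ?S" "y \<in> ?S"
  then obtain l0 g0 h0 l1 g1 h1 where R01: "poly R l0 \<noteq> 0" "poly R l1 \<noteq> 0"
    and inv: "invertible g0" "invertible h0" "invertible g1" "invertible h1"
    and xy: "x = gl_act g0 h0 (u + l0 *s v)" "y = gl_act g1 h1 (u + l1 *s v)"
    by (auto simp: orbit_def)
  define G where "G t = (\<chi> i j. g0 $ i $ j + t * (g1 $ i $ j - g0 $ i $ j))" for t
  define H where "H t = (\<chi> i j. h0 $ i $ j + t * (h1 $ i $ j - h0 $ i $ j))" for t
  define L where "L = [:l0, l1 - l0:]"
  define \<gamma> where "\<gamma> t = gl_act (G t) (H t) (u + poly L t *s v)" for t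
  obtain DG where DG: "\<And>t. det (G t) = poly DG t" unfolding G_def using det_of_line[of g0 g1] by blast
  obtain DH where DH: "\<And>t. det (H t) = poly DH t" unfolding H_def using det_of_line[of h0 h1] by blast
  define D where "D = DG * DH * pcompose R L"
  have D: "poly D t = det (G t) * det (H t) * poly R (poly L t)" for t
    by (simp add: D_def DG DH poly_pcompose)
  have ends: "G 0 = g0" "H 0 = h0" "G 1 = g1" "H 1 = h1" "poly L 0 = l0" "poly L 1 = l1"
    by (simp_all add: G_def H_def L_def vec_eq_iff)
  have rGH: "rational_away E (\<lambda>t. G t $ i $ j)" "rational_away E (\<lambda>t. H t $ i' $ j')" for E i j i' j'
    using rational_away_poly[of E "[:g0 $ i $ j, g1 $ i $ j - g0 $ i $ j:]"]
      rational_away_poly[of E "[:h0 $ i' $ j', h1 $ i' $ j' - h0 $ i' $ j':]"]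
    by (simp_all add: G_def H_def rational_away_def)
  have rinv: "rational_away D (\<lambda>t. matrix_inv (M t) $ i $ j)"
    if M: "\<And>i j. rational_away 1 (\<lambda>t. M t $ i $ j)" and Q: "\<And>t. poly D t = det (M t) * poly Q t"
    for M :: "complex \<Rightarrow> complex ^ 'k::finite ^ 'k" and Q i j
  proof -
    let ?N = "\<lambda>t. det (\<chi> k l. if l = i then (if k = j then 1 else 0) else M t $ k $ l)"
    have "rational_away 1 ?N"
    proof (rule rational_away_det)
      fix k l
      show "rational_away 1 (\<lambda>t. (\<chi> k l. if l = i then (if k = j then 1 else 0) else M t $ k $ l) $ k $ l)"
        using M by (cases "l = i"; cases "k = j") (simp_all add: rational_away_const)
    qed
    then obtain P where "?N = poly P" unfolding rational_away_one by (elim exE)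
    note P = fun_cong[OF this]
    show ?thesis
      unfolding rational_away_def
    proof (intro exI[of _ "P * Q"] exI[of _ 1] allI impI)
      fix t assume nz: "poly D t \<noteq> 0"
      then have "det (M t) \<noteq> 0" using Q by auto
      from matrix_inv_entry[OF this, of i j] have "matrix_inv (M t) $ i $ j = poly P t / det (M t)"
        unfolding P[of t] .
      then show "matrix_inv (M t) $ i $ j = poly (P * Q) t / poly D t ^ 1"
        using nz Q by (simp add: field_simps)
    qed
  qed
  have "poly D t = det (G t) * poly (DH * pcompose R L) t" for t
    by (simp add: D DH poly_pcompose)
  note rG = rinv[OF rGH(1) this]
  have "poly D t = det (H t) * poly (DG * pcompose R L) t" for t
    by (simp add: D DG poly_pcompose)
  note rH = rinv[OF rGH(2) this]
  have rF: "rational_away D (\<lambda>t. u $ k + poly L t * v $ k)" for k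
    by (intro rational_away_add rational_away_mult rational_away_const rational_away_poly)
  have r\<gamma>: "rational_away D (\<lambda>t. \<gamma> t $ k)" for k
  proof (cases k)
    case (Inl a)
    then show ?thesis
      by (cases a) (simp add: \<gamma>_def gl_act_nth,
          intro rational_away_sum rational_away_mult rG rGH rF)
  next
    case (Inr a)
    then show ?thesis
    proof (cases a)
      case (Inl b)
      then show ?thesis using Inr
        by (cases b) (simp add: \<gamma>_def gl_act_nth,
            intro rational_away_sum rational_away_mult rG rH rGH rF)
    next
      case a: (Inr b)
      then show ?thesis using Inr
        by (cases b) (simp add: \<gamma>_def gl_act_nth,
            intro rational_away_sum rational_away_mult rH rGH rF)
    qed
  qed
  have "\<gamma> t \<in> ?S" if "poly D t \<noteq> 0" for t
    using that unfolding D \<gamma>_def orbit_def by (auto simp: invertible_det_nz)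
  moreover have "poly D 0 \<noteq> 0" "poly D 1 \<noteq> 0"
    using inv R01 unfolding D ends by (simp_all add: invertible_det_nz)
  moreover have "\<gamma> 0 = x" "\<gamma> 1 = y" by (simp_all only: \<gamma>_def ends xy)
  ultimately show "\<exists>\<gamma> D. poly D 0 \<noteq> 0 \<and> poly D 1 \<noteq> 0 \<and> \<gamma> 0 = x \<and> \<gamma> 1 = y \<and>
        (\<forall>t. poly D t \<noteq> 0 \<longrightarrow> \<gamma> t \<in> ?S) \<and> (\<forall>k. rational_away D (\<lambda>t. \<gamma> t $ k))"
    using r\<gamma> by blast
qed

section \<open>Reduction to five linear slices\<close>

text \<open>Slices are named after the family to which their generic points belong.\<close>

definition slice15 :: "(2, 3) struct_consts set" where
  "slice15 = {tri 0 a b d A B D 0 0 0 0 0 0 | a b d A B D. True}"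

definition slice44 :: "(2, 3) struct_consts set" where
  "slice44 = {tri c a b d 0 B 0 0 p2 0 0 0 0 | c a b d B p2. True}"

definition slice33 :: "(2, 3) struct_consts set" where
  "slice33 = {tri c a b d 0 0 0 0 p2 0 q2 0 0 | c a b d p2 q2. True}"

definition slice41 :: "(2, 3) struct_consts set" where
  "slice41 = {tri c 0 b d 0 B D p1 p2 0 0 0 0 | c b d B D p1 p2. True}"

definition slice31 :: "(2, 3) struct_consts set" where
  "slice31 = {tri c 0 b d 0 0 0 p1 p2 0 q2 0 r2 | c b d p1 p2 q2 r2. True}"

lemmas slice_defs = slice15_def slice44_def slice33_def slice41_def slice31_def

lemma jordan_identityD:
  assumes "jordan_identity s" "pw \<in> {0, 1}" "px \<in> {0, 1}" "py \<in> {0, 1}" "pz \<in> {0, 1}"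
    "w \<in> std_grade pw" "x \<in> std_grade px" "y \<in> std_grade py" "z \<in> std_grade pz"
  shows "sc_mult s (sc_mult s w x) (sc_mult s y z)
         + ((- 1) ^ (px * py)) *s sc_mult s (sc_mult s w y) (sc_mult s x z)
         + ((- 1) ^ ((px + py) * pz)) *s sc_mult s (sc_mult s w z) (sc_mult s x y)
         - ((- 1) ^ (pw * px)) *s sc_mult s x (sc_mult s w (sc_mult s y z))
         - ((- 1) ^ (py * (pw + px))) *s sc_mult s y (sc_mult s w (sc_mult s x z))
         - ((- 1) ^ (pz * (pw + px + py))) *s sc_mult s z (sc_mult s w (sc_mult s x y)) = 0"
  by (rule assms(1)[unfolded jordan_identity_iff, rule_format, OF assms(2-9)])

lemma vec5_grade [simp]:
  "vec5 x1 x2 y1 y2 y3 \<in> std_grade 0 \<longleftrightarrow> y1 = 0 \<and> y2 = 0 \<and> y3 = 0"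
  "vec5 x1 x2 y1 y2 y3 \<in> std_grade 1 \<longleftrightarrow> x1 = 0 \<and> x2 = 0"
  "vec5 x1 x2 y1 y2 y3 \<in> std_grade (Suc 0) \<longleftrightarrow> x1 = 0 \<and> x2 = 0"
  by (auto simp: std_grade_0 std_grade_Suc_0 forall_2 forall_3)

lemma tri_jordan_constraints:
  assumes "jordan_identity (tri c a b d A B D p1 p2 q1 q2 r1 r2)"
  shows "D * a * c = 0" "A * D * c = 0" "A * d * c = 0" "a * d * r2 = 0"
    "A = 0 \<Longrightarrow> p1 = 0 \<Longrightarrow> q1 = 0 \<Longrightarrow> q2 = 0 \<Longrightarrow> r1 = 0 \<Longrightarrow> r2 = 0 \<Longrightarrow> D * a * p2 = 0"
proof -
  let ?e1 = "vec5 1 0 0 0 0" and ?e2 = "vec5 0 1 0 0 0" and ?f2 = "vec5 0 0 0 1 0" and ?f3 = "vec5 0 0 0 0 1"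
  show "D * a * c = 0"
    using jordan_identityD[OF assms, of 0 0 0 1 ?e1 ?e1 ?e1 ?f3] by auto
  then show "A * d * c = 0"
    using jordan_identityD[OF assms, of 1 0 0 0 ?f3 ?e1 ?e1 ?e1] by (auto simp: algebra_simps)
  show "A * D * c = 0"
    using jordan_identityD[OF assms, of 0 0 0 1 ?e1 ?e1 ?e2 ?f3] by (auto simp: algebra_simps)
  show "a * d * r2 = 0"
    using jordan_identityD[OF assms, of 0 0 1 1 ?e1 ?e1 ?f2 ?f3] by (auto simp: algebra_simps)
  show "D * a * p2 = 0" if "A = 0" "p1 = 0" "q1 = 0" "q2 = 0" "r1 = 0" "r2 = 0"
    using jordan_identityD[OF assms, of 1 0 1 1 ?f3 ?e1 ?f2 ?f3] that by (auto simp: algebra_simps)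
qed

lemma sc_from_products:
  "sc_c s i j k = sc_mult s (axis (Inl i) 1) (axis (Inl j) 1) $ Inl k"
  "sc_rho s i j' k' = sc_mult s (axis (Inl i) 1) (axis (Inr j') 1) $ Inr k'"
  "sc_Gamma s i' j' k = sc_mult s (axis (Inr i') 1) (axis (Inr j') 1) $ Inl k"
  using sc_mult_even_even[of s i j] sc_mult_even_odd[of s i j'] sc_mult_odd_odd[of s i' j']
  unfolding even_basis_def odd_basis_def by (simp_all only: sum_axis_nth) simp_all

text \<open>The ranks of a flag order the basis; the six ways in which \<open>e\<^sub>1\<close> and \<open>e\<^sub>2\<close> can be placed
  relative to \<open>f\<^sub>1\<close> and \<open>f\<^sub>2\<close> give six patterns of vanishing structure constants.\<close>

lemma triangular_form:
  fixes s :: "(2, 3) struct_consts"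
  assumes "s \<in> NJS"
  shows "\<exists>c a b d A B D p1 p2 q1 q2 r1 r2. isomorphic_sc s (tri c a b d A B D p1 p2 q1 q2 r1 r2) \<and>
    (p1 = 0 \<and> p2 = 0 \<and> q1 = 0 \<and> q2 = 0 \<and> r1 = 0 \<and> r2 = 0
     \<or> A = 0 \<and> p1 = 0 \<and> q1 = 0 \<and> q2 = 0 \<and> r1 = 0 \<and> r2 = 0
     \<or> A = 0 \<and> B = 0 \<and> D = 0 \<and> p1 = 0 \<and> q1 = 0 \<and> r1 = 0
     \<or> a = 0 \<and> A = 0 \<and> q1 = 0 \<and> q2 = 0 \<and> r1 = 0 \<and> r2 = 0
     \<or> a = 0 \<and> A = 0 \<and> B = 0 \<and> D = 0 \<and> q1 = 0 \<and> r1 = 0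
     \<or> a = 0 \<and> b = 0 \<and> d = 0 \<and> A = 0 \<and> B = 0 \<and> D = 0)"
proof -
  \<comment> \<open>The priorities make \<open>e\<^sub>2\<close> and \<open>f\<^sub>1\<close> the lowest vectors of their parities.\<close>
  define pr :: "2 + 3 \<Rightarrow> nat" where
    "pr k = (case k of Inl i \<Rightarrow> if i = 1 then 1 else 0 | Inr j \<Rightarrow> if j = 1 then 0 else if j = 2 then 1 else 2)" for k
  obtain t rk where t: "isomorphic_sc s t" "adapted rk t"
    and ord: "\<And>j k. parity j = parity k \<Longrightarrow> pr j < pr k \<Longrightarrow> rk j < (rk k :: nat)"
    using exists_adapted[of s _ pr] assms unfolding NJS_iff by blast
  have rk: "rk (Inl 2) < rk (Inl 1)" "rk (Inr 1) < rk (Inr 2)" "rk (Inr 2) < rk (Inr 3)"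
    by (rule ord; simp add: pr_def)+
  have c: "rk (Inl k) < rk (Inl i) \<and> rk (Inl k) < rk (Inl j)" if "sc_c t i j k \<noteq> 0" for i j k
    using t(2) that unfolding adapted_def sc_from_products by blast
  have rho: "rk (Inr k) < rk (Inl i) \<and> rk (Inr k) < rk (Inr j)" if "sc_rho t i j k \<noteq> 0" for i j k
    using t(2) that unfolding adapted_def sc_from_products by blast
  have Gam: "rk (Inl k) < rk (Inr i) \<and> rk (Inl k) < rk (Inr j)" if "sc_Gamma t i j k \<noteq> 0" for i j k
    using t(2) that unfolding adapted_def sc_from_products by blast
  have comm: "supercomm t" using NJS_isomorphic[OF t(1) assms] unfolding NJS_iff by blast
  have anti: "sc_Gamma t j i k = - sc_Gamma t i j k" for i j k
  proof -
    have "axis (Inr i) 1 \<in> (std_grade 1 :: (complex ^ (2 + 3)) set)" for i :: 3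
      by (simp add: std_grade_Suc_0 axis_def)
    then have "sc_mult t (axis (Inr j) 1) (axis (Inr i) 1)
        = ((- 1) ^ (1 * 1)) *s sc_mult t (axis (Inr i) 1) (axis (Inr j) 1)"
      using comm unfolding supercomm_def by blast
    then show ?thesis unfolding sc_from_products by simp
  qed
  have "sc_c t i j 1 = 0" for i j
    using c[of i j 1] rk(1) exhaust_2[of i] by fastforce
  moreover have "sc_c t 2 j k = 0" "sc_c t j 2 k = 0" for j k
    using c[of 2 j k] c[of j 2 k] rk(1) exhaust_2[of k] by fastforce+
  moreover have "sc_rho t i 1 k = 0" for i k
    using rho[of i 1 k] rk(2,3) exhaust_3[of k] by fastforce
  moreover have "sc_rho t i 2 2 = 0" for i
    using rho[of i 2 2] by fastforce
  moreover have "sc_rho t i j 3 = 0" for i j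
    using rho[of i j 3] rk(2,3) exhaust_3[of j] by fastforce
  moreover have "sc_Gamma t j j k = 0" for j k
    using anti[of j j k] by simp
  ultimately have z: "sc_c t i j 1 = 0" "sc_c t 2 j k = 0" "sc_c t j 2 k = 0" "sc_rho t i 1 l = 0"
    "sc_rho t i 2 2 = 0" "sc_rho t i l 3 = 0" "sc_Gamma t l l k = 0" for i j k l
    by blast+
  have tt: "t = tri (sc_c t 1 1 2) (sc_rho t 1 3 2) (sc_rho t 1 3 1) (sc_rho t 1 2 1) (sc_rho t 2 3 2)
      (sc_rho t 2 3 1) (sc_rho t 2 2 1) (sc_Gamma t 2 3 1) (sc_Gamma t 2 3 2) (sc_Gamma t 1 3 1)
      (sc_Gamma t 1 3 2) (sc_Gamma t 1 2 1) (sc_Gamma t 1 2 2)" (is "t = ?t")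
  proof -
    have "(\<forall>i j k. sc_c t i j k = sc_c ?t i j k) \<and> (\<forall>i j k. sc_rho t i j k = sc_rho ?t i j k) \<and>
        (\<forall>i j k. sc_Gamma t i j k = sc_Gamma ?t i j k)"
      unfolding tri_def make_sc_def
      by (simp add: forall_2 forall_3 z anti[of 2 1] anti[of 3 1] anti[of 3 2])
    then show ?thesis by (intro sc_eqI) blast+
  qed
  have imp: "\<not> rk (Inr 2) < rk (Inl 1) \<Longrightarrow> sc_rho t 1 3 2 = 0"
    "\<not> rk (Inr 1) < rk (Inl 1) \<Longrightarrow> sc_rho t 1 3 1 = 0 \<and> sc_rho t 1 2 1 = 0"
    "\<not> rk (Inr 2) < rk (Inl 2) \<Longrightarrow> sc_rho t 2 3 2 = 0"
    "\<not> rk (Inr 1) < rk (Inl 2) \<Longrightarrow> sc_rho t 2 3 1 = 0 \<and> sc_rho t 2 2 1 = 0"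
    "rk (Inr 2) < rk (Inl 1) \<Longrightarrow> sc_Gamma t 2 3 1 = 0"
    "rk (Inr 2) < rk (Inl 2) \<Longrightarrow> sc_Gamma t 2 3 2 = 0"
    "rk (Inr 1) < rk (Inl 1) \<Longrightarrow> sc_Gamma t 1 3 1 = 0 \<and> sc_Gamma t 1 2 1 = 0"
    "rk (Inr 1) < rk (Inl 2) \<Longrightarrow> sc_Gamma t 1 3 2 = 0 \<and> sc_Gamma t 1 2 2 = 0"
    by (blast dest: rho Gam less_not_sym)+
  consider "rk (Inr 2) < rk (Inl 2)" "rk (Inr 2) < rk (Inl 1)" "rk (Inr 1) < rk (Inl 2)" "rk (Inr 1) < rk (Inl 1)"
    | "\<not> rk (Inr 2) < rk (Inl 2)" "rk (Inr 2) < rk (Inl 1)" "rk (Inr 1) < rk (Inl 2)" "rk (Inr 1) < rk (Inl 1)"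
    | "\<not> rk (Inr 2) < rk (Inl 2)" "rk (Inr 2) < rk (Inl 1)" "\<not> rk (Inr 1) < rk (Inl 2)" "rk (Inr 1) < rk (Inl 1)"
    | "\<not> rk (Inr 2) < rk (Inl 2)" "\<not> rk (Inr 2) < rk (Inl 1)" "rk (Inr 1) < rk (Inl 2)" "rk (Inr 1) < rk (Inl 1)"
    | "\<not> rk (Inr 2) < rk (Inl 2)" "\<not> rk (Inr 2) < rk (Inl 1)" "\<not> rk (Inr 1) < rk (Inl 2)" "rk (Inr 1) < rk (Inl 1)"
    | "\<not> rk (Inr 2) < rk (Inl 2)" "\<not> rk (Inr 2) < rk (Inl 1)" "\<not> rk (Inr 1) < rk (Inl 2)" "\<not> rk (Inr 1) < rk (Inl 1)"
    using rk by linarith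
  then have pat: "sc_Gamma t 2 3 1 = 0 \<and> sc_Gamma t 2 3 2 = 0 \<and> sc_Gamma t 1 3 1 = 0 \<and> sc_Gamma t 1 3 2 = 0
        \<and> sc_Gamma t 1 2 1 = 0 \<and> sc_Gamma t 1 2 2 = 0
     \<or> sc_rho t 2 3 2 = 0 \<and> sc_Gamma t 2 3 1 = 0 \<and> sc_Gamma t 1 3 1 = 0 \<and> sc_Gamma t 1 3 2 = 0
        \<and> sc_Gamma t 1 2 1 = 0 \<and> sc_Gamma t 1 2 2 = 0
     \<or> sc_rho t 2 3 2 = 0 \<and> sc_rho t 2 3 1 = 0 \<and> sc_rho t 2 2 1 = 0 \<and> sc_Gamma t 2 3 1 = 0
        \<and> sc_Gamma t 1 3 1 = 0 \<and> sc_Gamma t 1 2 1 = 0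
     \<or> sc_rho t 1 3 2 = 0 \<and> sc_rho t 2 3 2 = 0 \<and> sc_Gamma t 1 3 1 = 0 \<and> sc_Gamma t 1 3 2 = 0
        \<and> sc_Gamma t 1 2 1 = 0 \<and> sc_Gamma t 1 2 2 = 0
     \<or> sc_rho t 1 3 2 = 0 \<and> sc_rho t 2 3 2 = 0 \<and> sc_rho t 2 3 1 = 0 \<and> sc_rho t 2 2 1 = 0
        \<and> sc_Gamma t 1 3 1 = 0 \<and> sc_Gamma t 1 2 1 = 0
     \<or> sc_rho t 1 3 2 = 0 \<and> sc_rho t 1 3 1 = 0 \<and> sc_rho t 1 2 1 = 0 \<and> sc_rho t 2 3 2 = 0
        \<and> sc_rho t 2 3 1 = 0 \<and> sc_rho t 2 2 1 = 0"
    by cases (simp_all add: imp)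
  show ?thesis
    by (intro exI, rule conjI[OF subst[OF tt, of "isomorphic_sc s", OF t(1)] pat])
qed

text \<open>The Jordan identity forces some products of parameters to vanish; in each case a coordinate
  can be dropped, if necessary after a change of basis.\<close>

lemma normal_form:
  fixes s :: "(2, 3) struct_consts"
  assumes s: "s \<in> NJS"
  shows "\<exists>t. isomorphic_sc s t \<and> t \<in> slice15 \<union> slice44 \<union> slice33 \<union> slice41 \<union> slice31"
proof -
  obtain c a b d A B D p1 p2 q1 q2 r1 r2 where
    iso: "isomorphic_sc s (tri c a b d A B D p1 p2 q1 q2 r1 r2)" and
    pat: "p1 = 0 \<and> p2 = 0 \<and> q1 = 0 \<and> q2 = 0 \<and> r1 = 0 \<and> r2 = 0
     \<or> A = 0 \<and> p1 = 0 \<and> q1 = 0 \<and> q2 = 0 \<and> r1 = 0 \<and> r2 = 0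
     \<or> A = 0 \<and> B = 0 \<and> D = 0 \<and> p1 = 0 \<and> q1 = 0 \<and> r1 = 0
     \<or> a = 0 \<and> A = 0 \<and> q1 = 0 \<and> q2 = 0 \<and> r1 = 0 \<and> r2 = 0
     \<or> a = 0 \<and> A = 0 \<and> B = 0 \<and> D = 0 \<and> q1 = 0 \<and> r1 = 0
     \<or> a = 0 \<and> b = 0 \<and> d = 0 \<and> A = 0 \<and> B = 0 \<and> D = 0"
    using triangular_form[OF s] by (elim exE conjE) (rule that)
  have "jordan_identity (tri c a b d A B D p1 p2 q1 q2 r1 r2)"
    using NJS_isomorphic[OF iso s] unfolding NJS_iff by blast
  note rel = tri_jordan_constraints[OF this]
  have via: ?thesis if "isomorphic_sc (tri c a b d A B D p1 p2 q1 q2 r1 r2) t"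
    "t \<in> slice15 \<union> slice44 \<union> slice33 \<union> slice41 \<union> slice31" for t
    using isomorphic_sc_trans[OF iso that(1)] that(2) by blast
  have self: ?thesis
    if "tri c a b d A B D p1 p2 q1 q2 r1 r2 \<in> slice15 \<union> slice44 \<union> slice33 \<union> slice41 \<union> slice31"
    using via isomorphic_sc_refl that by blast
  have in15: "tri 0 a b d A B D 0 0 0 0 0 0 \<in> slice15" for a b d A B D
    unfolding slice15_def by blast
  have in44: "tri c a b d 0 B 0 0 p2 0 0 0 0 \<in> slice44" for c a b d B p2
    unfolding slice44_def by blast
  have in33: "tri c a b d 0 0 0 0 p2 0 q2 0 0 \<in> slice33" for c a b d p2 q2
    unfolding slice33_def by blast
  have in41: "tri c 0 b d 0 B D p1 p2 0 0 0 0 \<in> slice41" for c b d B D p1 p2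
    unfolding slice41_def by blast
  have in31: "tri c 0 b d 0 0 0 p1 p2 0 q2 0 r2 \<in> slice31" for c b d p1 p2 q2 r2
    unfolding slice31_def by blast
  from pat show ?thesis
  proof (elim disjE conjE)
    assume z: "p1 = 0" "p2 = 0" "q1 = 0" "q2 = 0" "r1 = 0" "r2 = 0"
    consider "c = 0" | "c \<noteq> 0" "A = 0" "D = 0" | "c \<noteq> 0" "A = 0" "a = 0" | "c \<noteq> 0" "A \<noteq> 0" "d = 0" "D = 0"
      using rel(1-3) by auto
    then show ?thesis
    proof cases
      case 1
      then show ?thesis using in15 by (intro self) (simp add: z)
    next
      case 2
      then show ?thesis using in44[of c a b d B 0] by (intro self) (simp add: z)
    next
      case 3
      then show ?thesis using in41[of c b d B D 0 0] by (intro self) (simp add: z)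
    next
      case 4
      then have "isomorphic_sc (tri c a b d A B D p1 p2 q1 q2 r1 r2)
          (tri c (b - a * B / A) (a / A) 0 0 1 0 0 0 0 0 0 0)"
        using change_image_line_e2[of A c a b B] by (simp add: z)
      from via[OF this] in44 show ?thesis by blast
    qed
  next
    assume z: "A = 0" "p1 = 0" "q1 = 0" "q2 = 0" "r1 = 0" "r2 = 0"
    consider "D = 0" | "a = 0" | "c = 0" "p2 = 0" using rel(1) rel(5)[OF z] by auto
    then show ?thesis
    proof cases
      case 1
      then show ?thesis using in44 by (intro self) (simp add: z)
    next
      case 2
      then show ?thesis using in41[of c b d B D 0 p2] by (intro self) (simp add: z)
    next
      case 3
      then show ?thesis using in15[of a b d 0 B D] by (intro self) (simp add: z)
    qed
  next
    assume z: "A = 0" "B = 0" "D = 0" "p1 = 0" "q1 = 0" "r1 = 0"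
    consider "r2 = 0" | "a = 0" | "a \<noteq> 0" "d = 0" using rel(4) by auto
    then show ?thesis
    proof cases
      case 1
      then show ?thesis using in33 by (intro self) (simp add: z)
    next
      case 2
      then show ?thesis using in31[of c b d 0 p2 q2 r2] by (intro self) (simp add: z)
    next
      case 3
      then have "isomorphic_sc (tri c a b d A B D p1 p2 q1 q2 r1 r2)
          (tri c 0 1 0 0 0 0 0 q2 0 (a * p2 + b * q2) 0 (- a * r2))"
        using change_image_line_e1[of a c b p2 q2 r2] by (simp add: z)
      from via[OF this] in31 show ?thesis by blast
    qed
  next
    assume "a = 0" "A = 0" "q1 = 0" "q2 = 0" "r1 = 0" "r2 = 0"
    then show ?thesis using in41 by (intro self) simp
  next
    assume "a = 0" "A = 0" "B = 0" "D = 0" "q1 = 0" "r1 = 0"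
    then show ?thesis using in31 by (intro self) simp
  next
    assume z: "a = 0" "b = 0" "d = 0" "A = 0" "B = 0" "D = 0"
    obtain p1' p2' q2' r2' where
      "isomorphic_sc (tri c 0 0 0 0 0 0 p1 p2 q1 q2 r1 r2) (tri c 0 0 0 0 0 0 p1' p2' 0 q2' 0 r2')"
      using kernel_of_form by blast
    then have "isomorphic_sc (tri c a b d A B D p1 p2 q1 q2 r1 r2)
        (tri c 0 0 0 0 0 0 p1' p2' 0 q2' 0 r2')"
      by (simp add: z)
    from via[OF this] in31 show ?thesis by blast
  qed
qed

lemma eventually_shift_nonzero: "\<forall>\<^sub>F t in at 0. c + t \<noteq> (0::complex)"
proof -
  have "\<not> 0 islimpt {- c}" by (rule islimpt_finite) simp
  then have "\<forall>\<^sub>F t in at 0. t \<noteq> - c" unfolding islimpt_iff_eventually by simp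
  then show ?thesis by eventually_elim (simp add: add_eq_0_iff)
qed

lemma eventually_shift_product: "\<forall>\<^sub>F t in at 0. (x + t) * (y + t) - k \<noteq> (0::complex)"
proof -
  have *: "poly [:x * y - k, x + y, 1:] t = (x + t) * (y + t) - k" for t
    by (simp add: algebra_simps)
  have "\<not> 0 islimpt {t. poly [:x * y - k, x + y, 1:] t = 0}"
    by (rule islimpt_finite) (rule poly_roots_finite, simp)
  then show ?thesis unfolding islimpt_iff_eventually by (simp only: * mem_Collect_eq not_not)
qed

lemma tendsto_shift: "((\<lambda>t. x + t) \<longlongrightarrow> x) (at (0::complex))"
  by (rule tendsto_eq_intros refl | simp)+

text \<open>Shifting some of the coordinates of a point of a slice by a small \<open>t\<close> makes the point generic.\<close>

lemma slice15_closure: "slice15 \<subseteq> zariski closure_of (orbit alg15)"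
proof
  fix s assume "s \<in> slice15"
  then obtain a b d A B D where s: "s = tri 0 a b d A B D 0 0 0 0 0 0"
    unfolding slice15_def by blast
  have lim: "((\<lambda>t. tri 0 (a + t) b d A B (D + t) 0 0 0 0 0 0) \<longlongrightarrow> s) (at 0)"
    unfolding s by (intro tendsto_tri tendsto_shift tendsto_const)
  have "\<forall>\<^sub>F t in at 0. tri 0 (a + t) b d A B (D + t) 0 0 0 0 0 0 \<in> orbit alg15"
    using eventually_shift_product[of a D "A * d"]
  proof eventually_elim
    case (elim t)
    then show ?case using isomorphic_sc_sym[OF generic_15] unfolding orbit_eq by blast
  qed
  then show "s \<in> zariski closure_of (orbit alg15)" by (rule limit_in_closure[OF lim])
qed

lemma slice44_closure: "slice44 \<subseteq> zariski closure_of (\<Union>l\<in>UNIV. orbit (alg44 l))"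
proof
  fix s assume "s \<in> slice44"
  then obtain c a b d B p2 where s: "s = tri c a b d 0 B 0 0 p2 0 0 0 0"
    unfolding slice44_def by blast
  have lim: "((\<lambda>t. tri (c + t) (a + t) b d 0 (B + t) 0 0 (p2 + t) 0 0 0 0) \<longlongrightarrow> s) (at 0)"
    unfolding s by (intro tendsto_tri tendsto_shift tendsto_const)
  have "\<forall>\<^sub>F t in at 0. tri (c + t) (a + t) b d 0 (B + t) 0 0 (p2 + t) 0 0 0 0 \<in> (\<Union>l\<in>UNIV. orbit (alg44 l))"
    using eventually_shift_nonzero[of c] eventually_shift_nonzero[of a] eventually_shift_nonzero[of B]
      eventually_shift_nonzero[of p2]
  proof eventually_elim
    case (elim t)
    then show ?case using isomorphic_sc_sym[OF generic_44] unfolding orbit_eq by blast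
  qed
  then show "s \<in> zariski closure_of (\<Union>l\<in>UNIV. orbit (alg44 l))" by (rule limit_in_closure[OF lim])
qed

lemma slice33_closure: "slice33 \<subseteq> zariski closure_of (orbit alg33)"
proof
  fix s assume "s \<in> slice33"
  then obtain c a b d p2 q2 where s: "s = tri c a b d 0 0 0 0 p2 0 q2 0 0"
    unfolding slice33_def by blast
  have lim: "((\<lambda>t. tri (c + t) (a + t) b (d + t) 0 0 0 0 p2 0 (q2 + t) 0 0) \<longlongrightarrow> s) (at 0)"
    unfolding s by (intro tendsto_tri tendsto_shift tendsto_const)
  have "\<forall>\<^sub>F t in at 0. tri (c + t) (a + t) b (d + t) 0 0 0 0 p2 0 (q2 + t) 0 0 \<in> orbit alg33"
    using eventually_shift_nonzero[of c] eventually_shift_nonzero[of a] eventually_shift_nonzero[of d]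
      eventually_shift_nonzero[of q2]
  proof eventually_elim
    case (elim t)
    then show ?case using isomorphic_sc_sym[OF generic_33] unfolding orbit_eq by blast
  qed
  then show "s \<in> zariski closure_of (orbit alg33)" by (rule limit_in_closure[OF lim])
qed

lemma slice41_closure: "slice41 \<subseteq> zariski closure_of (orbit alg41)"
proof
  fix s assume "s \<in> slice41"
  then obtain c b d B D p1 p2 where s: "s = tri c 0 b d 0 B D p1 p2 0 0 0 0"
    unfolding slice41_def by blast
  have lim: "((\<lambda>t. tri (c + t) 0 (b + t) d 0 B (D + t) (p1 + t) p2 0 0 0 0) \<longlongrightarrow> s) (at 0)"
    unfolding s by (intro tendsto_tri tendsto_shift tendsto_const)
  have "\<forall>\<^sub>F t in at 0. tri (c + t) 0 (b + t) d 0 B (D + t) (p1 + t) p2 0 0 0 0 \<in> orbit alg41"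
    using eventually_shift_nonzero[of c] eventually_shift_nonzero[of p1] eventually_shift_product[of b D "d * B"]
  proof eventually_elim
    case (elim t)
    then show ?case using isomorphic_sc_sym[OF generic_41] unfolding orbit_eq by blast
  qed
  then show "s \<in> zariski closure_of (orbit alg41)" by (rule limit_in_closure[OF lim])
qed

lemma slice31_closure: "slice31 \<subseteq> zariski closure_of (\<Union>l\<in>- {0}. orbit (alg31 l))"
proof
  fix s assume "s \<in> slice31"
  then obtain c b d p1 p2 q2 r2 where s: "s = tri c 0 b d 0 0 0 p1 p2 0 q2 0 r2"
    unfolding slice31_def by blast
  have lim: "((\<lambda>t. tri (c + t) 0 b (d + t) 0 0 0 (p1 + t) p2 0 (q2 + t) 0 r2) \<longlongrightarrow> s) (at 0)"
    unfolding s by (intro tendsto_tri tendsto_shift tendsto_const)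
  have "\<forall>\<^sub>F t in at 0. tri (c + t) 0 b (d + t) 0 0 0 (p1 + t) p2 0 (q2 + t) 0 r2 \<in> (\<Union>l\<in>- {0}. orbit (alg31 l))"
    using eventually_shift_nonzero[of c] eventually_shift_nonzero[of p1] eventually_shift_product[of d q2 "b * r2"]
  proof eventually_elim
    case (elim t)
    let ?l = "((d + t) * (q2 + t) - b * r2) / ((p1 + t) * (c + t))"
    have "?l \<in> - {0}" using elim by simp
    moreover have "tri (c + t) 0 b (d + t) 0 0 0 (p1 + t) p2 0 (q2 + t) 0 r2 \<in> orbit (alg31 ?l)"
      using isomorphic_sc_sym[OF generic_31] elim unfolding orbit_eq by blast
    ultimately show ?case by blast
  qed
  then show "s \<in> zariski closure_of (\<Union>l\<in>- {0}. orbit (alg31 l))" by (rule limit_in_closure[OF lim])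
qed

section \<open>The five families consist of nilpotent Jordan superalgebras\<close>

text \<open>Five nested left multiplications suffice, by \<open>NJS_iff\<close>.\<close>

lemma NJS_by_coordinates:
  fixes s :: "(2, 3) struct_consts"
  assumes "supercomm s" "jordan_identity s"
    and nil: "\<And>u v w x y z. sc_mult s u (sc_mult s v (sc_mult s w (sc_mult s x (sc_mult s y z)))) = 0"
  shows "s \<in> NJS"
proof -
  have "left_nil 5 s"
    unfolding left_nil_iff by (simp add: numeral_eq_Suc nil)
  then show ?thesis using assms unfolding NJS_iff by simp
qed

lemma alg15_NJS: "alg15 \<in> NJS"
proof (rule NJS_by_coordinates)
  show "supercomm alg15"
    unfolding supercomm_def alg15_tri by (simp add: all_grade_0 all_grade_1 algebra_simps)
  show "jordan_identity alg15"
    unfolding jordan_identity_iff alg15_tri by (simp add: all_grade_0 all_grade_1 algebra_simps)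
  fix u v w x y z
  show "sc_mult alg15 u (sc_mult alg15 v (sc_mult alg15 w (sc_mult alg15 x (sc_mult alg15 y z)))) = 0"
    by (cases u rule: vec5_exhaust; cases v rule: vec5_exhaust; cases w rule: vec5_exhaust;
        cases x rule: vec5_exhaust; cases y rule: vec5_exhaust; cases z rule: vec5_exhaust)
       (simp add: alg15_tri)
qed

lemma alg33_NJS: "alg33 \<in> NJS"
proof (rule NJS_by_coordinates)
  show "supercomm alg33"
    unfolding supercomm_def alg33_tri by (simp add: all_grade_0 all_grade_1 algebra_simps)
  show "jordan_identity alg33"
    unfolding jordan_identity_iff alg33_tri by (simp add: all_grade_0 all_grade_1 algebra_simps)
  fix u v w x y z
  show "sc_mult alg33 u (sc_mult alg33 v (sc_mult alg33 w (sc_mult alg33 x (sc_mult alg33 y z)))) = 0"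
    by (cases u rule: vec5_exhaust; cases v rule: vec5_exhaust; cases w rule: vec5_exhaust;
        cases x rule: vec5_exhaust; cases y rule: vec5_exhaust; cases z rule: vec5_exhaust)
       (simp add: alg33_tri)
qed

lemma alg41_NJS: "alg41 \<in> NJS"
proof (rule NJS_by_coordinates)
  show "supercomm alg41"
    unfolding supercomm_def alg41_tri by (simp add: all_grade_0 all_grade_1 algebra_simps)
  show "jordan_identity alg41"
    unfolding jordan_identity_iff alg41_tri by (simp add: all_grade_0 all_grade_1 algebra_simps)
  fix u v w x y z
  show "sc_mult alg41 u (sc_mult alg41 v (sc_mult alg41 w (sc_mult alg41 x (sc_mult alg41 y z)))) = 0"
    by (cases u rule: vec5_exhaust; cases v rule: vec5_exhaust; cases w rule: vec5_exhaust;
        cases x rule: vec5_exhaust; cases y rule: vec5_exhaust; cases z rule: vec5_exhaust)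
       (simp add: alg41_tri)
qed

lemma alg31_NJS: "alg31 l \<in> NJS"
proof (rule NJS_by_coordinates)
  show "supercomm (alg31 l)"
    unfolding supercomm_def alg31_tri by (simp add: all_grade_0 all_grade_1 algebra_simps)
  show "jordan_identity (alg31 l)"
    unfolding jordan_identity_iff alg31_tri by (simp add: all_grade_0 all_grade_1 algebra_simps)
  fix u v w x y z
  show "sc_mult (alg31 l) u (sc_mult (alg31 l) v (sc_mult (alg31 l) w
      (sc_mult (alg31 l) x (sc_mult (alg31 l) y z)))) = 0"
    by (cases u rule: vec5_exhaust; cases v rule: vec5_exhaust; cases w rule: vec5_exhaust;
        cases x rule: vec5_exhaust; cases y rule: vec5_exhaust; cases z rule: vec5_exhaust)
       (simp add: alg31_tri)
qed

lemma alg44_NJS: "alg44 l \<in> NJS"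
proof (rule NJS_by_coordinates)
  show "supercomm (alg44 l)"
    unfolding supercomm_def by (simp add: all_grade_0 all_grade_1 algebra_simps)
  show "jordan_identity (alg44 l)"
    unfolding jordan_identity_iff by (simp add: all_grade_0 all_grade_1 algebra_simps)
  fix u v w x y z
  show "sc_mult (alg44 l) u (sc_mult (alg44 l) v (sc_mult (alg44 l) w
      (sc_mult (alg44 l) x (sc_mult (alg44 l) y z)))) = 0"
    by (cases u rule: vec5_exhaust; cases v rule: vec5_exhaust; cases w rule: vec5_exhaust;
        cases x rule: vec5_exhaust; cases y rule: vec5_exhaust; cases z rule: vec5_exhaust)
       simp
qed

section \<open>Identities that separate the families\<close>

text \<open>Variables are listed with their parities, 0 even and 1 odd.  The last two identities single out
  the value \<open>l\<close> of the parameter in the families (2,3)_31 and (2,3)_44.\<close>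

definition commuting_law :: "('m::finite, 'n::finite) struct_consts \<Rightarrow> bool" where
  "commuting_law = law (four 0 0 1 0)
     [(1, Prod (Var 0) (Prod (Var 1) (Var 2))), (- 1, Prod (Var 1) (Prod (Var 0) (Var 2)))]"

definition double_action_law :: "('m::finite, 'n::finite) struct_consts \<Rightarrow> bool" where
  "double_action_law = law (four 0 0 1 1) [(1, Prod (Prod (Var 0) (Prod (Var 1) (Var 2))) (Var 3))]"

definition odd_square_law :: "('m::finite, 'n::finite) struct_consts \<Rightarrow> bool" where
  "odd_square_law = law (four 1 1 0 0) [(1, Prod (Prod (Var 0) (Var 1)) (Prod (Var 0) (Var 1)))]"

definition odd_square_acts_trivially :: "('m::finite, 'n::finite) struct_consts \<Rightarrow> bool" where
  "odd_square_acts_trivially = law (four 1 1 1 0)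
     [(1, Prod (Prod (Prod (Var 0) (Var 1)) (Prod (Var 0) (Var 1))) (Var 2))]"

definition even_odd_odd_law :: "('m::finite, 'n::finite) struct_consts \<Rightarrow> bool" where
  "even_odd_odd_law = law (four 0 1 1 0) [(1, Prod (Prod (Var 0) (Var 1)) (Var 2))]"

definition even_even_odd_law :: "('m::finite, 'n::finite) struct_consts \<Rightarrow> bool" where
  "even_even_odd_law = law (four 0 0 1 0) [(1, Prod (Prod (Var 0) (Var 1)) (Var 2))]"

definition even_even_law :: "('m::finite, 'n::finite) struct_consts \<Rightarrow> bool" where
  "even_even_law = law (four 0 0 0 0) [(1, Prod (Var 0) (Var 1))]"

definition ratio31_law :: "complex \<Rightarrow> ('m::finite, 'n::finite) struct_consts \<Rightarrow> bool" where
  "ratio31_law l = law (four 0 1 1 0) [(1, Prod (Prod (Var 0) (Var 1)) (Var 2)),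
     (- 1, Prod (Prod (Var 0) (Var 2)) (Var 1)), (- l, Prod (Var 0) (Prod (Var 1) (Var 2)))]"

definition ratio44_law :: "complex \<Rightarrow> ('m::finite, 'n::finite) struct_consts \<Rightarrow> bool" where
  "ratio44_law l = law (four 0 0 1 0)
     [(1, Prod (Var 0) (Prod (Var 1) (Var 2))), (- l, Prod (Prod (Var 0) (Var 1)) (Var 2))]"

lemmas law_defs = commuting_law_def double_action_law_def odd_square_law_def
  odd_square_acts_trivially_def even_odd_odd_law_def even_even_odd_law_def even_even_law_def
  ratio31_law_def ratio44_law_def

lemma grade_inhabited: "\<exists>x. x \<in> std_grade p"
  using zero_grade by blast

lemma commuting_law_iff: "commuting_law s \<longleftrightarrow> (\<forall>x\<in>std_grade 0. \<forall>y\<in>std_grade 0. \<forall>f\<in>std_grade 1.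
    sc_mult s x (sc_mult s y f) - sc_mult s y (sc_mult s x f) = 0)"
  unfolding commuting_law_def by (subst law_four) (simp_all add: grade_inhabited)

lemma double_action_law_iff: "double_action_law s \<longleftrightarrow> (\<forall>x\<in>std_grade 0. \<forall>y\<in>std_grade 0. \<forall>f\<in>std_grade 1.
    \<forall>g\<in>std_grade 1. sc_mult s (sc_mult s x (sc_mult s y f)) g = 0)"
  unfolding double_action_law_def by (subst law_four) (simp_all add: grade_inhabited)

lemma odd_square_law_iff: "odd_square_law s \<longleftrightarrow> (\<forall>f\<in>std_grade 1. \<forall>g\<in>std_grade 1.
    sc_mult s (sc_mult s f g) (sc_mult s f g) = 0)"
  unfolding odd_square_law_def by (subst law_four) (simp_all add: grade_inhabited)

lemma odd_square_acts_trivially_iff: "odd_square_acts_trivially s \<longleftrightarrow> (\<forall>f\<in>std_grade 1. \<forall>g\<in>std_grade 1.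
    \<forall>h\<in>std_grade 1. sc_mult s (sc_mult s (sc_mult s f g) (sc_mult s f g)) h = 0)"
  unfolding odd_square_acts_trivially_def by (subst law_four) (simp_all add: grade_inhabited)

lemma even_odd_odd_law_iff: "even_odd_odd_law s \<longleftrightarrow> (\<forall>x\<in>std_grade 0. \<forall>f\<in>std_grade 1. \<forall>g\<in>std_grade 1.
    sc_mult s (sc_mult s x f) g = 0)"
  unfolding even_odd_odd_law_def by (subst law_four) (simp_all add: grade_inhabited)

lemma even_even_odd_law_iff: "even_even_odd_law s \<longleftrightarrow> (\<forall>x\<in>std_grade 0. \<forall>y\<in>std_grade 0. \<forall>f\<in>std_grade 1.
    sc_mult s (sc_mult s x y) f = 0)"
  unfolding even_even_odd_law_def by (subst law_four) (simp_all add: grade_inhabited)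

lemma even_even_law_iff: "even_even_law s \<longleftrightarrow> (\<forall>x\<in>std_grade 0. \<forall>y\<in>std_grade 0. sc_mult s x y = 0)"
  unfolding even_even_law_def by (subst law_four) (simp_all add: grade_inhabited)

lemma ratio31_law_iff: "ratio31_law l s \<longleftrightarrow> (\<forall>x\<in>std_grade 0. \<forall>f\<in>std_grade 1. \<forall>g\<in>std_grade 1.
    sc_mult s (sc_mult s x f) g - (sc_mult s (sc_mult s x g) f + l *s sc_mult s x (sc_mult s f g)) = 0)"
  unfolding ratio31_law_def by (subst law_four) (simp_all add: grade_inhabited vec.scale_minus_left algebra_simps)

lemma ratio44_law_iff: "ratio44_law l s \<longleftrightarrow> (\<forall>x\<in>std_grade 0. \<forall>y\<in>std_grade 0. \<forall>f\<in>std_grade 1.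
    sc_mult s x (sc_mult s y f) - l *s sc_mult s (sc_mult s x y) f = 0)"
  unfolding ratio44_law_def by (subst law_four) (simp_all add: grade_inhabited vec.scale_minus_left)

lemmas law_iffs = commuting_law_iff double_action_law_iff odd_square_law_iff
  odd_square_acts_trivially_iff even_odd_odd_law_iff even_even_odd_law_iff even_even_law_iff
  ratio31_law_iff ratio44_law_iff

lemmas alg_tris = alg15_tri alg31_tri alg33_tri alg41_tri

lemmas law_eval = law_iffs all_grade_0 all_grade_1 algebra_simps

lemma commuting_law_slices:
  "s \<in> slice44 \<union> slice33 \<union> slice41 \<union> slice31 \<Longrightarrow> commuting_law s"
  by (auto simp: slice_defs law_eval)

lemma commuting_law_algs: "commuting_law (alg31 l)" "commuting_law (alg44 l)" "commuting_law alg33" "commuting_law alg41"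
  by (simp_all add: alg_tris law_eval)

lemma not_commuting_law_alg15: "\<not> commuting_law alg15"
proof
  assume "commuting_law alg15"
  from this[unfolded commuting_law_iff, rule_format, of "vec5 1 0 0 0 0" "vec5 0 1 0 0 0" "vec5 0 0 0 0 1"]
  show False by (simp add: alg15_tri)
qed

lemma double_action_law_slices:
  "s \<in> slice15 \<union> slice44 \<union> slice41 \<union> slice31 \<Longrightarrow> double_action_law s"
  by (auto simp: slice_defs law_eval)

lemma double_action_law_algs:
  "double_action_law (alg31 l)" "double_action_law (alg44 l)" "double_action_law alg15" "double_action_law alg41"
  by (simp_all add: alg_tris law_eval)

lemma not_double_action_law_alg33: "\<not> double_action_law alg33"
proof
  assume "double_action_law alg33"
  from this[unfolded double_action_law_iff, rule_format, of "vec5 1 0 0 0 0" "vec5 1 0 0 0 0" "vec5 0 0 0 0 1" "vec5 0 0 0 0 1"]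
  show False by (simp add: alg33_tri)
qed

lemma not_even_even_law_alg33: "\<not> even_even_law alg33"
proof
  assume "even_even_law alg33"
  from this[unfolded even_even_law_iff, rule_format, of "vec5 1 0 0 0 0" "vec5 1 0 0 0 0"]
  show False by (simp add: alg33_tri)
qed

lemma odd_square_acts_slices:
  "s \<in> slice15 \<union> slice44 \<union> slice33 \<union> slice31 \<Longrightarrow> odd_square_acts_trivially s"
  by (auto simp: slice_defs law_eval)

lemma odd_square_acts_algs:
  "odd_square_acts_trivially (alg31 l)" "odd_square_acts_trivially (alg44 l)" "odd_square_acts_trivially alg15"
  "odd_square_acts_trivially alg33"
  by (simp_all add: alg_tris law_eval)

lemma not_odd_square_acts_alg41: "\<not> odd_square_acts_trivially alg41"
proof
  assume "odd_square_acts_trivially alg41"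
  from this[unfolded odd_square_acts_trivially_iff, rule_format, of "vec5 0 0 0 1 0" "vec5 0 0 0 0 1" "vec5 0 0 0 1 0"]
  show False by (simp add: alg41_tri)
qed

lemma odd_square_law_algs: "odd_square_law (alg44 l)" "odd_square_law alg15" "odd_square_law alg33"
  by (simp_all add: alg_tris law_eval)

lemma not_odd_square_law_alg31: "\<not> odd_square_law (alg31 l)"
proof
  assume "odd_square_law (alg31 l)"
  from this[unfolded odd_square_law_iff, rule_format, of "vec5 0 0 0 1 0" "vec5 0 0 0 0 1"]
  show False by (simp add: alg31_tri)
qed

lemma even_odd_odd_law_alg41: "even_odd_odd_law alg41"
  by (simp add: alg_tris law_eval)

lemma not_even_odd_odd_law_alg31: "l \<noteq> 0 \<Longrightarrow> \<not> even_odd_odd_law (alg31 l)"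
proof
  assume "l \<noteq> 0" "even_odd_odd_law (alg31 l)"
  from this(2)[unfolded even_odd_odd_law_iff, rule_format, of "vec5 1 0 0 0 0" "vec5 0 0 0 1 0" "vec5 0 0 0 0 1"] \<open>l \<noteq> 0\<close>
  show False by (simp add: alg31_tri)
qed

lemma not_even_odd_odd_law_alg44: "\<not> even_odd_odd_law (alg44 l)"
proof
  assume "even_odd_odd_law (alg44 l)"
  from this[unfolded even_odd_odd_law_iff, rule_format, of "vec5 1 0 0 0 0" "vec5 0 0 0 1 0" "vec5 0 0 0 1 0"]
  show False by simp
qed

lemma even_even_odd_law_algs: "even_even_odd_law (alg31 l)" "even_even_odd_law alg15" "even_even_odd_law alg33"
  by (simp_all add: alg_tris law_eval)

lemma not_even_even_odd_law_alg44: "\<not> even_even_odd_law (alg44 l)"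
proof
  assume "even_even_odd_law (alg44 l)"
  from this[unfolded even_even_odd_law_iff, rule_format, of "vec5 1 0 0 0 0" "vec5 1 0 0 0 0" "vec5 0 0 0 1 0"]
  show False by simp
qed

lemma ratio31_law_alg31: "ratio31_law l (alg31 l') \<longleftrightarrow> l = l'"
proof
  assume "ratio31_law l (alg31 l')"
  from this[unfolded ratio31_law_iff, rule_format, of "vec5 1 0 0 0 0" "vec5 0 0 0 1 0" "vec5 0 0 0 0 1"]
  show "l = l'" by (simp add: alg31_tri)
qed (simp add: alg31_tri law_eval)

lemma ratio44_law_alg44: "ratio44_law l (alg44 l') \<longleftrightarrow> l = l'"
proof
  assume "ratio44_law l (alg44 l')"
  from this[unfolded ratio44_law_iff, rule_format, of "vec5 1 0 0 0 0" "vec5 1 0 0 0 0" "vec5 0 0 0 1 0"]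
  show "l = l'" by simp
qed (simp add: law_eval)

section \<open>Components and rigid superalgebras\<close>

definition closed_invariant :: "('m::finite, 'n::finite) struct_consts set \<Rightarrow> bool" where
  "closed_invariant Z \<longleftrightarrow> zariski_closed Z \<and> (\<forall>s t. isomorphic_sc s t \<longrightarrow> s \<in> Z \<longrightarrow> t \<in> Z)"

lemma closed_invariant_law: "closed_invariant {s. law par L s}"
  unfolding closed_invariant_def using zariski_closed_law law_isomorphic by blast

lemma closed_invariant_laws:
  "closed_invariant {s. commuting_law s}" "closed_invariant {s. double_action_law s}"
  "closed_invariant {s. odd_square_law s}" "closed_invariant {s. odd_square_acts_trivially s}"
  "closed_invariant {s. even_odd_odd_law s}" "closed_invariant {s. even_even_odd_law s}"
  "closed_invariant {s. even_even_law s}" "closed_invariant {s. ratio31_law l s}"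
  "closed_invariant {s. ratio44_law l s}"
  by (simp_all only: law_defs closed_invariant_law)

lemma closed_invariant_closure:
  assumes Z: "closed_invariant Z" and F: "\<And>l. l \<in> T \<Longrightarrow> F l \<in> Z"
  shows "zariski closure_of (\<Union>l\<in>T. orbit (F l)) \<subseteq> Z"
proof (rule closure_minimal)
  show "(\<Union>l\<in>T. orbit (F l)) \<subseteq> Z" using Z F unfolding closed_invariant_def orbit_eq by blast
  show "zariski_closed Z" using Z unfolding closed_invariant_def by blast
qed

lemma self_in_orbit: "s \<in> orbit s"
  by (simp add: orbit_eq isomorphic_sc_refl)

lemma orbit_isomorphic: "isomorphic_sc s t \<Longrightarrow> orbit s = orbit t"
  unfolding orbit_eq using isomorphic_sc_sym isomorphic_sc_trans by blast

lemma rigid_isomorphic: "isomorphic_sc s t \<Longrightarrow> rigid s \<Longrightarrow> rigid t"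
  unfolding rigid_def using orbit_isomorphic NJS_isomorphic by metis

lemma rigid_by_closed_complement:
  assumes Z: "zariski_closed Z" and s: "s \<in> NJS" "orbit s = NJS - Z"
  shows "rigid s"
  unfolding rigid_def openin_subtopology
proof (intro conjI exI)
  show "openin zariski (- Z)" using Z by (simp add: openin_zariski)
  show "orbit s = - Z \<inter> NJS" using s(2) by blast
qed (rule s(1))

lemma rigid_meets:
  assumes "rigid s" "s \<in> zariski closure_of S" "S \<subseteq> NJS"
  shows "\<exists>y\<in>S. isomorphic_sc s y"
proof -
  obtain U where U: "openin zariski U" "orbit s = U \<inter> NJS"
    using assms(1) unfolding rigid_def openin_subtopology by blast
  then have "s \<in> U" using self_in_orbit by blast
  then obtain y where "y \<in> S" "y \<in> U" using assms(2) U(1) unfolding in_closure_of by blast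
  then have "y \<in> orbit s" using U(2) assms(3) by blast
  then show ?thesis using \<open>y \<in> S\<close> unfolding orbit_eq by blast
qed

text \<open>An open orbit in an irreducible family is dense, so every closed invariant condition that
  holds on it holds on the whole family.\<close>

lemma line_not_rigid:
  assumes irr: "irreducible_in zariski (\<Union>l\<in>T. orbit (F l))" and sub: "(\<Union>l\<in>T. orbit (F l)) \<subseteq> NJS"
    and Z: "closed_invariant Z" and l: "l \<in> T" "F l \<in> Z" and l': "l' \<in> T" "F l' \<notin> Z"
  shows "\<not> rigid (F l)"
proof
  assume "rigid (F l)"
  then obtain U where U: "openin zariski U" "orbit (F l) = U \<inter> NJS"
    unfolding rigid_def openin_subtopology by blast
  have "orbit (F l) \<subseteq> Z" using Z l unfolding closed_invariant_def orbit_eq by blast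
  then have "(\<Union>l\<in>T. orbit (F l)) \<subseteq> Z \<union> - U" using U(2) sub by blast
  moreover have "closedin zariski Z" "closedin zariski (- U)"
    using Z U(1) by (simp_all add: closed_invariant_def closedin_zariski openin_zariski)
  ultimately have "(\<Union>l\<in>T. orbit (F l)) \<subseteq> Z \<or> (\<Union>l\<in>T. orbit (F l)) \<subseteq> - U"
    using irr unfolding irreducible_in_def by blast
  moreover have "F l' \<in> (\<Union>l\<in>T. orbit (F l))" "F l \<in> (\<Union>l\<in>T. orbit (F l))"
    using l l' self_in_orbit by blast+
  moreover have "F l \<in> U" using U(2) self_in_orbit by blast
  ultimately show False using l'(2) by blast
qed

text \<open>For every linear functional \<open>L\<close> the bilinear form \<open>(x, f) \<mapsto> L (x f)\<close> on the even times the odd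
  part has rank at most one: its minors of order two vanish.  Functionals are needed because this
  condition is quadratic and the values \<open>x f\<close> in question annihilate the algebra in the slice
  of (2,3)_41, so that no product of them can express it.\<close>

definition action_rank_le_one :: "('m::finite, 'n::finite) struct_consts \<Rightarrow> bool" where
  "action_rank_le_one s \<longleftrightarrow> (\<forall>L. Vector_Spaces.linear (*s) (*) L \<longrightarrow>
     (\<forall>x\<in>std_grade 0. \<forall>y\<in>std_grade 0. \<forall>f\<in>std_grade 1. \<forall>g\<in>std_grade 1.
       L (sc_mult s x f) * L (sc_mult s y g) = L (sc_mult s x g) * L (sc_mult s y f)))"

lemma action_rank_isomorphic:
  assumes st: "isomorphic_sc s t" and s: "action_rank_le_one s"
  shows "action_rank_le_one t"
  unfolding action_rank_le_one_def
proof (intro allI impI ballI)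
  fix L :: "complex ^ ('a + 'b) \<Rightarrow> complex" and x y f g :: "complex ^ ('a + 'b)"
  assume L: "Vector_Spaces.linear (*s) (*) L"
    and gr: "x \<in> std_grade 0" "y \<in> std_grade 0" "f \<in> std_grade 1" "g \<in> std_grade 1"
  obtain \<phi> where \<phi>: "sc_iso s t \<phi>" using st isomorphic_sc_iff by blast
  let ?\<psi> = "inv \<phi>"
  have inv: "\<phi> (?\<psi> u) = u" for u using \<phi> by (simp add: sc_iso_def bij_is_surj surj_f_inv_f)
  have mult: "\<phi> (sc_mult s (?\<psi> u) (?\<psi> v)) = sc_mult t u v" for u v
    by (simp add: sc_iso_mult[OF \<phi>] inv)
  have "Vector_Spaces.linear (*s) (*) (\<lambda>u. L (\<phi> u))"
    using L by (simp add: Vector_Spaces.linear_iff sc_iso_add[OF \<phi>] sc_iso_scale[OF \<phi>])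
  then have "L (\<phi> (sc_mult s (?\<psi> x) (?\<psi> f))) * L (\<phi> (sc_mult s (?\<psi> y) (?\<psi> g)))
      = L (\<phi> (sc_mult s (?\<psi> x) (?\<psi> g))) * L (\<phi> (sc_mult s (?\<psi> y) (?\<psi> f)))"
    using s gr sc_iso_graded[OF sc_iso_inv[OF \<phi>]] unfolding action_rank_le_one_def by blast
  then show "L (sc_mult t x f) * L (sc_mult t y g) = L (sc_mult t x g) * L (sc_mult t y f)"
    by (simp only: mult)
qed

lemma poly_function_functional:
  assumes L: "Vector_Spaces.linear (*s) (*) (L :: complex ^ 'i::finite \<Rightarrow> complex)" and F: "poly_map F"
  shows "(\<lambda>s. L (F s)) \<in> poly_functions"
proof -
  have add: "L (u + v) = L u + L v" and scale: "L (a *s u) = a * L u" for u v a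
    using L by (simp_all add: Vector_Spaces.linear_iff)
  have zero: "L 0 = 0" using scale[of 0 0] by simp
  have sum: "L (\<Sum>k\<in>A. h k) = (\<Sum>k\<in>A. L (h k))" for h :: "'i \<Rightarrow> _" and A
    by (induction A rule: infinite_finite_induct) (simp_all add: add zero)
  have "L u = (\<Sum>k\<in>UNIV. u $ k * L (axis k 1))" for u
    using arg_cong[OF vec_expansion[of u], of L] by (simp add: sum scale)
  then have "(\<lambda>s. L (F s)) = (\<lambda>s. \<Sum>k\<in>UNIV. F s $ k * L (axis k 1))" by blast
  moreover have "(\<lambda>s. F s $ k * L (axis k 1)) \<in> poly_functions" for k
    using F unfolding poly_map_def by (intro poly_functions.mult poly_functions.const) blast
  then have "(\<lambda>s. \<Sum>k\<in>UNIV. F s $ k * L (axis k 1)) \<in> poly_functions"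
    by (rule poly_functions_sum)
  ultimately show ?thesis by (simp only:)
qed

lemma zariski_closed_action_rank: "zariski_closed {s :: ('m::finite, 'n::finite) struct_consts. action_rank_le_one s}"
proof -
  have "zariski_closed {s :: ('m, 'n) struct_consts. \<forall>(L, x, y, f, g)\<in>{(L, x, y, f, g).
      Vector_Spaces.linear (*s) (*) L \<and> x \<in> std_grade 0 \<and> y \<in> std_grade 0 \<and> f \<in> std_grade 1 \<and> g \<in> std_grade 1}.
      L (sc_mult s x f) * L (sc_mult s y g) + (- 1) * (L (sc_mult s x g) * L (sc_mult s y f)) = 0}"
  proof (rule zariski_closed_all, clarify)
    fix L :: "complex ^ ('m + 'n) \<Rightarrow> complex" and x y f g :: "complex ^ ('m + 'n)"
    assume L: "Vector_Spaces.linear (*s) (*) L"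
    have "(\<lambda>s :: ('m, 'n) struct_consts. L (sc_mult s u v)) \<in> poly_functions" for u v
      by (rule poly_function_functional[OF L poly_map_sc_mult[OF poly_map_const poly_map_const]])
    then show "zariski_closed {s :: ('m, 'n) struct_consts.
        L (sc_mult s x f) * L (sc_mult s y g) + (- 1) * (L (sc_mult s x g) * L (sc_mult s y f)) = 0}"
      by (intro zariski_closed_zero poly_functions.add poly_functions.mult poly_functions.const)
  qed
  moreover have "{s :: ('m, 'n) struct_consts. action_rank_le_one s} = {s. \<forall>(L, x, y, f, g)\<in>{(L, x, y, f, g).
      Vector_Spaces.linear (*s) (*) L \<and> x \<in> std_grade 0 \<and> y \<in> std_grade 0 \<and> f \<in> std_grade 1 \<and> g \<in> std_grade 1}.
      L (sc_mult s x f) * L (sc_mult s y g) + (- 1) * (L (sc_mult s x g) * L (sc_mult s y f)) = 0}"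
    unfolding action_rank_le_one_def by auto
  ultimately show ?thesis by simp
qed

lemma action_rank_slice41:
  assumes "b * D = d * B"
  shows "action_rank_le_one (tri c 0 b d 0 B D p1 p2 0 0 0 0)"
  unfolding action_rank_le_one_def
proof (intro allI impI)
  fix L :: "complex ^ (2 + 3) \<Rightarrow> complex"
  assume L: "Vector_Spaces.linear (*s) (*) L"
  have "L (a *s vec5 0 0 1 0 0) = a * L (vec5 0 0 1 0 0)" for a
    using L unfolding Vector_Spaces.linear_iff by blast
  from this[unfolded vec5_arith mult_zero_right mult_1_right]
  have e: "L (vec5 0 0 a 0 0) = a * L (vec5 0 0 1 0 0)" for a .
  have m: "(b * x1 * y3 + d * x1 * y2 + B * x2 * y3 + D * x2 * y2) * (b * z1 * w3 + d * z1 * w2 + B * z2 * w3 + D * z2 * w2)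
      = (b * x1 * w3 + d * x1 * w2 + B * x2 * w3 + D * x2 * w2) * (b * z1 * y3 + d * z1 * y2 + B * z2 * y3 + D * z2 * y2)"
    for x1 x2 y2 y3 z1 z2 w2 w3
    using assms by algebra
  show "\<forall>x\<in>std_grade 0. \<forall>y\<in>std_grade 0. \<forall>f\<in>std_grade 1. \<forall>g\<in>std_grade 1.
      L (sc_mult (tri c 0 b d 0 B D p1 p2 0 0 0 0) x f) * L (sc_mult (tri c 0 b d 0 B D p1 p2 0 0 0 0) y g)
      = L (sc_mult (tri c 0 b d 0 B D p1 p2 0 0 0 0) x g) * L (sc_mult (tri c 0 b d 0 B D p1 p2 0 0 0 0) y f)"
    using m by (simp add: all_grade_0 all_grade_1 e[of "_ + _"] mult.assoc)
qed

lemma not_action_rank_alg41: "\<not> action_rank_le_one alg41"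
proof
  assume R: "action_rank_le_one alg41"
  have "Vector_Spaces.linear (*s) (*) (\<lambda>v :: complex ^ (2 + 3). v $ Inr 1)"
    by (simp add: Vector_Spaces.linear_iff vec.vector_space_axioms vector_space_over_itself.vector_space_axioms)
  from R[unfolded action_rank_le_one_def, rule_format, OF this,
      of "vec5 1 0 0 0 0" "vec5 0 1 0 0 0" "vec5 0 0 0 0 1" "vec5 0 0 0 1 0"]
  show False by (simp add: alg41_tri)
qed

text \<open>The commuting law holds on the four other slices, and a point of \<open>slice15\<close> that violates it is
  generic.  The next two lemmas follow the same pattern, with a second closed condition to
  guarantee genericity.\<close>

lemma alg15_orbit: "orbit alg15 = NJS - {s. commuting_law s}"
proof (intro equalityI subsetI)
  fix s :: "(2, 3) struct_consts"
  assume "s \<in> orbit alg15"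
  then have iso: "isomorphic_sc alg15 s" by (simp add: orbit_eq)
  have "\<not> commuting_law s"
    using not_commuting_law_alg15 law_isomorphic[OF isomorphic_sc_sym[OF iso]]
    unfolding commuting_law_def by blast
  then show "s \<in> NJS - {s. commuting_law s}" using NJS_isomorphic[OF iso alg15_NJS] by blast
next
  fix s :: "(2, 3) struct_consts"
  assume s: "s \<in> NJS - {s. commuting_law s}"
  then obtain t where t: "isomorphic_sc s t" "t \<in> slice15 \<union> slice44 \<union> slice33 \<union> slice41 \<union> slice31"
    using normal_form by blast
  have nt: "\<not> commuting_law t"
    using s law_isomorphic[OF isomorphic_sc_sym[OF t(1)]] unfolding commuting_law_def by blast
  then have "t \<in> slice15" using t(2) commuting_law_slices by blast
  then obtain a b d A B D where tt: "t = tri 0 a b d A B D 0 0 0 0 0 0" unfolding slice15_def by blast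
  have det: "a * D - A * d \<noteq> 0"
  proof
    assume "a * D - A * d = 0"
    then have "D * a = A * d" by (simp add: mult.commute)
    then have "commuting_law t" unfolding tt by (simp add: law_eval)
    then show False using nt by simp
  qed
  from isomorphic_sc_trans[OF t(1)[unfolded tt] generic_15[OF det]] show "s \<in> orbit alg15"
    unfolding orbit_eq using isomorphic_sc_sym by blast
qed

lemma alg33_orbit: "orbit alg33 = NJS - ({s. double_action_law s} \<union> {s. even_even_law s})"
proof (intro equalityI subsetI)
  fix s :: "(2, 3) struct_consts"
  assume "s \<in> orbit alg33"
  then have iso: "isomorphic_sc alg33 s" by (simp add: orbit_eq)
  have "\<not> double_action_law s"
    using not_double_action_law_alg33 law_isomorphic[OF isomorphic_sc_sym[OF iso]]
    unfolding double_action_law_def by blast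
  moreover have "\<not> even_even_law s"
    using not_even_even_law_alg33 law_isomorphic[OF isomorphic_sc_sym[OF iso]]
    unfolding even_even_law_def by blast
  ultimately show "s \<in> NJS - ({s. double_action_law s} \<union> {s. even_even_law s})"
    using NJS_isomorphic[OF iso alg33_NJS] by blast
next
  fix s :: "(2, 3) struct_consts"
  assume s: "s \<in> NJS - ({s. double_action_law s} \<union> {s. even_even_law s})"
  then obtain t where t: "isomorphic_sc s t" "t \<in> slice15 \<union> slice44 \<union> slice33 \<union> slice41 \<union> slice31"
    using normal_form by blast
  have nt: "\<not> double_action_law t" "\<not> even_even_law t"
    using s law_isomorphic[OF isomorphic_sc_sym[OF t(1)]]
    unfolding double_action_law_def even_even_law_def by blast+
  then have "t \<in> slice33" using t(2) double_action_law_slices by blast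
  then obtain c a b d p2 q2 where tt: "t = tri c a b d 0 0 0 0 p2 0 q2 0 0" unfolding slice33_def by blast
  have "double_action_law t" if "a = 0 \<or> d = 0 \<or> q2 = 0"
    using that unfolding tt by (auto simp: law_eval)
  moreover have "even_even_law t" if "c = 0" using that unfolding tt by (simp add: law_eval)
  ultimately have nz: "c \<noteq> 0" "a \<noteq> 0" "d \<noteq> 0" "q2 \<noteq> 0" using nt by blast+
  from isomorphic_sc_trans[OF t(1)[unfolded tt] generic_33[OF nz]] show "s \<in> orbit alg33"
    unfolding orbit_eq using isomorphic_sc_sym by blast
qed

lemma alg41_orbit: "orbit alg41 = NJS - ({s. odd_square_acts_trivially s} \<union> {s. action_rank_le_one s})"
proof (intro equalityI subsetI)
  fix s :: "(2, 3) struct_consts"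
  assume "s \<in> orbit alg41"
  then have iso: "isomorphic_sc alg41 s" by (simp add: orbit_eq)
  have "\<not> odd_square_acts_trivially s"
    using not_odd_square_acts_alg41 law_isomorphic[OF isomorphic_sc_sym[OF iso]]
    unfolding odd_square_acts_trivially_def by blast
  moreover have "\<not> action_rank_le_one s"
    using not_action_rank_alg41 action_rank_isomorphic[OF isomorphic_sc_sym[OF iso]] by blast
  ultimately show "s \<in> NJS - ({s. odd_square_acts_trivially s} \<union> {s. action_rank_le_one s})"
    using NJS_isomorphic[OF iso alg41_NJS] by blast
next
  fix s :: "(2, 3) struct_consts"
  assume s: "s \<in> NJS - ({s. odd_square_acts_trivially s} \<union> {s. action_rank_le_one s})"
  then obtain t where t: "isomorphic_sc s t" "t \<in> slice15 \<union> slice44 \<union> slice33 \<union> slice41 \<union> slice31"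
    using normal_form by blast
  have nt: "\<not> odd_square_acts_trivially t"
    using s law_isomorphic[OF isomorphic_sc_sym[OF t(1)]]
    unfolding odd_square_acts_trivially_def by blast
  have nt': "\<not> action_rank_le_one t" using s action_rank_isomorphic[OF isomorphic_sc_sym[OF t(1)]] by blast
  have "t \<in> slice41" using nt t(2) odd_square_acts_slices by blast
  then obtain c b d B D p1 p2 where tt: "t = tri c 0 b d 0 B D p1 p2 0 0 0 0" unfolding slice41_def by blast
  have "odd_square_acts_trivially t" if "c = 0 \<or> p1 = 0"
    using that unfolding tt by (auto simp: law_eval)
  then have nz: "c \<noteq> 0" "p1 \<noteq> 0" using nt by blast+
  have det: "b * D - d * B \<noteq> 0" using action_rank_slice41[of b D d B] nt' unfolding tt by auto
  from isomorphic_sc_trans[OF t(1)[unfolded tt] generic_41[OF nz det]] show "s \<in> orbit alg41"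
    unfolding orbit_eq using isomorphic_sc_sym by blast
qed

lemma rigid_algs: "rigid alg15" "rigid alg33" "rigid alg41"
proof -
  have "zariski_closed {s :: (2, 3) struct_consts. commuting_law s}"
    "zariski_closed ({s :: (2, 3) struct_consts. double_action_law s} \<union> {s. even_even_law s})"
    "zariski_closed ({s :: (2, 3) struct_consts. odd_square_acts_trivially s} \<union> {s. action_rank_le_one s})"
    using closed_invariant_laws zariski_closed_action_rank
    by (auto simp: closed_invariant_def intro!: zariski_closed_Un)
  then show "rigid alg15" "rigid alg33" "rigid alg41"
    using rigid_by_closed_complement alg15_NJS alg33_NJS alg41_NJS alg15_orbit alg33_orbit alg41_orbit
    by blast+
qed

lemma alg31_line: "alg31 l = alg31 0 + l *s (alg31 1 - alg31 0)"
  by (rule sc_eqI) (auto simp: alg31_def make_sc_def)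

lemma alg44_line: "alg44 l = alg44 0 + l *s (alg44 1 - alg44 0)"
  by (rule sc_eqI) (auto simp: alg44_def make_sc_def)

text \<open>The orbits in each family are indexed by a line minus the zeros of a polynomial.\<close>

lemma irreducible_31: "irreducible_in zariski (\<Union>l\<in>- {0}. orbit (alg31 l))"
proof -
  have "- {0} = {l. poly [:0, 1:] l \<noteq> (0::complex)}" by auto
  then show ?thesis
    using irreducible_orbits[of "[:0, 1:]" "alg31 0" "alg31 1 - alg31 0"]
    by (simp only: alg31_line[symmetric]) simp
qed

lemma irreducible_44: "irreducible_in zariski (\<Union>l\<in>UNIV. orbit (alg44 l))"
  using irreducible_orbits[of 1 "alg44 0" "alg44 1 - alg44 0"]
  by (simp only: alg44_line[symmetric]) simp

lemma irreducible_orbit: "irreducible_in zariski (orbit s)"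
  using irreducible_orbits[of 1 s 0] by simp

theorem theorem4p4:
  shows "irreducible_components zariski (NJS :: (2, 3) struct_consts set) =
           {zariski closure_of (\<Union>l \<in> - {0}. orbit (alg31 l)),
            zariski closure_of (\<Union>a \<in> UNIV. orbit (alg44 a)),
            zariski closure_of (orbit alg15),
            zariski closure_of (orbit alg33),
            zariski closure_of (orbit alg41)} \<and>
         card (irreducible_components zariski (NJS :: (2, 3) struct_consts set)) = 5 \<and>
         (\<forall>s :: (2, 3) struct_consts.
           rigid s \<longleftrightarrow> (\<exists>t \<in> {alg15, alg33, alg41}. isomorphic_sc s t))"
proof -
  let ?S31 = "\<Union>l \<in> - {0}. orbit (alg31 l)" and ?S44 = "\<Union>a \<in> UNIV. orbit (alg44 a)"
  let ?S15 = "orbit alg15" and ?S33 = "orbit alg33" and ?S41 = "orbit alg41"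
  define C31 where "C31 = zariski closure_of ?S31"
  define C44 where "C44 = zariski closure_of ?S44"
  define C15 where "C15 = zariski closure_of ?S15"
  define C33 where "C33 = zariski closure_of ?S33"
  define C41 where "C41 = zariski closure_of ?S41"
  let ?\<C> = "{C31, C44, C15, C33, C41}"
  note C = C31_def C44_def C15_def C33_def C41_def
  have sub: "?S31 \<subseteq> NJS" "?S44 \<subseteq> NJS" "?S15 \<subseteq> NJS" "?S33 \<subseteq> NJS" "?S41 \<subseteq> NJS"
    using alg31_NJS alg44_NJS alg15_NJS alg33_NJS alg41_NJS NJS_isomorphic
    unfolding orbit_eq by blast+
  have C_NJS: "C31 \<subseteq> NJS" "C44 \<subseteq> NJS" "C15 \<subseteq> NJS" "C33 \<subseteq> NJS" "C41 \<subseteq> NJS"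
    unfolding C by (rule closure_minimal[OF _ zariski_closed_NJS], rule sub)+
  have cover: "NJS \<subseteq> C31 \<union> C44 \<union> C15 \<union> C33 \<union> C41"
  proof
    fix s :: "(2, 3) struct_consts" assume "s \<in> NJS"
    then obtain t where t: "isomorphic_sc s t" "t \<in> slice15 \<union> slice44 \<union> slice33 \<union> slice41 \<union> slice31"
      using normal_form by blast
    have stable: "z \<in> S" if "S \<in> {?S31, ?S44, ?S15, ?S33, ?S41}" "y \<in> S" "isomorphic_sc y z" for S y z
      using that isomorphic_sc_trans[OF _ that(3)] unfolding orbit_eq by auto
    have "\<exists>S\<in>{?S31, ?S44, ?S15, ?S33, ?S41}. t \<in> zariski closure_of S"
      using t(2) slice31_closure slice44_closure slice15_closure slice33_closure slice41_closure by auto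
    then obtain S where S: "S \<in> {?S31, ?S44, ?S15, ?S33, ?S41}" "t \<in> zariski closure_of S" ..
    have "s \<in> zariski closure_of S"
      using closure_isomorphic[OF stable[OF S(1)] S(2) isomorphic_sc_sym[OF t(1)]] .
    then show "s \<in> C31 \<union> C44 \<union> C15 \<union> C33 \<union> C41"
      using S(1) unfolding C by auto
  qed
  have mem: "alg31 1 \<in> C31" "alg44 0 \<in> C44" "alg15 \<in> C15" "alg33 \<in> C33" "alg41 \<in> C41"
    unfolding C
    by (rule subsetD[OF subset_closure], (rule UN_I[of 1] UN_I[of 0])?, simp_all add: self_in_orbit)+
  have below: "zariski closure_of (orbit s) \<subseteq> Z" if "closed_invariant Z" "s \<in> Z" for s Z
    using closed_invariant_closure[OF that(1), of UNIV "\<lambda>_. s"] that(2) by simp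
  note inv = closed_invariant_laws
  have out31: "alg31 1 \<notin> C44" "alg31 1 \<notin> C15" "alg31 1 \<notin> C33" "alg31 1 \<notin> C41"
    using closed_invariant_closure[OF inv(3), of UNIV alg44] below[OF inv(3), of alg15]
      below[OF inv(3), of alg33] below[OF inv(5), of alg41]
      odd_square_law_algs even_odd_odd_law_alg41 not_odd_square_law_alg31[of 1]
      not_even_odd_odd_law_alg31[of 1] unfolding C by auto
  have out44: "alg44 0 \<notin> C31" "alg44 0 \<notin> C15" "alg44 0 \<notin> C33" "alg44 0 \<notin> C41"
    using closed_invariant_closure[OF inv(6), of "- {0}" alg31] below[OF inv(6), of alg15]
      below[OF inv(6), of alg33] below[OF inv(5), of alg41]
      even_even_odd_law_algs even_odd_odd_law_alg41 not_even_even_odd_law_alg44[of 0]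
      not_even_odd_odd_law_alg44[of 0] unfolding C by auto
  have out15: "alg15 \<notin> C31" "alg15 \<notin> C44" "alg15 \<notin> C33" "alg15 \<notin> C41"
    using closed_invariant_closure[OF inv(1), of "- {0}" alg31] closed_invariant_closure[OF inv(1), of UNIV alg44]
      below[OF inv(1), of alg33] below[OF inv(1), of alg41]
      commuting_law_algs not_commuting_law_alg15 unfolding C by auto
  have out33: "alg33 \<notin> C31" "alg33 \<notin> C44" "alg33 \<notin> C15" "alg33 \<notin> C41"
    using closed_invariant_closure[OF inv(2), of "- {0}" alg31] closed_invariant_closure[OF inv(2), of UNIV alg44]
      below[OF inv(2), of alg15] below[OF inv(2), of alg41]
      double_action_law_algs not_double_action_law_alg33 unfolding C by auto
  have out41: "alg41 \<notin> C31" "alg41 \<notin> C44" "alg41 \<notin> C15" "alg41 \<notin> C33"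
    using closed_invariant_closure[OF inv(4), of "- {0}" alg31] closed_invariant_closure[OF inv(4), of UNIV alg44]
      below[OF inv(4), of alg15] below[OF inv(4), of alg33]
      odd_square_acts_algs not_odd_square_acts_alg41 unfolding C by auto
  have comp: "irreducible_components zariski (NJS :: (2, 3) struct_consts set) = ?\<C>"
  proof (rule irreducible_components_eq)
    show "closedin zariski X" if "X \<in> ?\<C>" for X
      using that unfolding C by (auto simp: closedin_closure_of)
    show "irreducible_in zariski X" if "X \<in> ?\<C>" for X
      using that irreducible_31 irreducible_44 irreducible_orbit unfolding C
      by (auto intro!: irreducible_in_closure)
    show "\<Union>?\<C> = NJS" using cover C_NJS by auto
    show "X = Y" if "X \<in> ?\<C>" "Y \<in> ?\<C>" "X \<subseteq> Y" for X Y
      using that mem out31 out44 out15 out33 out41 by auto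
  qed simp
  have "C31 \<noteq> C44" "C31 \<noteq> C15" "C31 \<noteq> C33" "C31 \<noteq> C41" "C44 \<noteq> C15" "C44 \<noteq> C33" "C44 \<noteq> C41"
    "C15 \<noteq> C33" "C15 \<noteq> C41" "C33 \<noteq> C41"
    using mem out31 out44 out15 out33 by metis+
  then have card: "card ?\<C> = 5" by simp
  have "rigid s \<longleftrightarrow> (\<exists>t \<in> {alg15, alg33, alg41}. isomorphic_sc s t)" for s
  proof
    assume "\<exists>t \<in> {alg15, alg33, alg41}. isomorphic_sc s t"
    then show "rigid s" using rigid_algs rigid_isomorphic isomorphic_sc_sym by blast
  next
    assume s: "rigid s"
    then have "s \<in> NJS" by (simp add: rigid_def)
    then consider "s \<in> C31" | "s \<in> C44" | "s \<in> C15" | "s \<in> C33" | "s \<in> C41" using cover by blast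
    then show "\<exists>t \<in> {alg15, alg33, alg41}. isomorphic_sc s t"
    proof cases
      case 1
      then obtain y where "y \<in> ?S31" "isomorphic_sc s y" using rigid_meets[OF s _ sub(1)] unfolding C by blast
      then obtain l where l: "l \<noteq> 0" "isomorphic_sc s (alg31 l)"
        unfolding orbit_eq using isomorphic_sc_sym isomorphic_sc_trans by blast
      \<comment> \<open>\<open>2 * l\<close> is a nonzero parameter different from \<open>l\<close>.\<close>
      have "\<not> rigid (alg31 l)"
        by (rule line_not_rigid[OF irreducible_31 sub(1) closed_invariant_laws(8)[of l], of l "2 * l"])
           (use l(1) in \<open>simp_all add: ratio31_law_alg31\<close>)
      then show ?thesis using rigid_isomorphic[OF l(2) s] by blast
    next
      case 2
      then obtain y where "y \<in> ?S44" "isomorphic_sc s y" using rigid_meets[OF s _ sub(2)] unfolding C by blast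
      then obtain l where l: "isomorphic_sc s (alg44 l)"
        unfolding orbit_eq using isomorphic_sc_sym isomorphic_sc_trans by blast
      have "\<not> rigid (alg44 l)"
        by (rule line_not_rigid[OF irreducible_44 sub(2) closed_invariant_laws(9)[of l], of l "l + 1"])
           (simp_all add: ratio44_law_alg44)
      then show ?thesis using rigid_isomorphic[OF l s] by blast
    next
      case 3
      then obtain y where "y \<in> ?S15" "isomorphic_sc s y" using rigid_meets[OF s _ sub(3)] unfolding C by blast
      then show ?thesis unfolding orbit_eq using isomorphic_sc_sym isomorphic_sc_trans by blast
    next
      case 4
      then obtain y where "y \<in> ?S33" "isomorphic_sc s y" using rigid_meets[OF s _ sub(4)] unfolding C by blast
      then show ?thesis unfolding orbit_eq using isomorphic_sc_sym isomorphic_sc_trans by blast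
    next
      case 5
      then obtain y where "y \<in> ?S41" "isomorphic_sc s y" using rigid_meets[OF s _ sub(5)] unfolding C by blast
      then show ?thesis unfolding orbit_eq using isomorphic_sc_sym isomorphic_sc_trans by blast
    qed
  qed
  then show ?thesis using comp card unfolding C by simp
qed

end
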